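(* Let $\mathcal{H}_1=L^2(X,\mu)$, $\mathcal{H}_2=L^2(Y,\nu)$ and let $\mathcal{U}\subseteq\mathcal{B}(\mathcal{H}_1,\mathcal{H}_2)$ be a w*-closed normalizing space which is a bimodule over the multiplication masas $\mathcal{D}_i\subseteq\mathcal{B}(\mathcal{H}_i)$ $(i=1,2)$, i.e. $\mathcal{D}_2\mathcal{U}\mathcal{D}_1\subseteq\mathcal{U}$. Then there exist Borel functions $f:X\to[0,1]$ and $g:Y\to[0,1]$ such that the $\omega$-support of $\mathcal{U}$ is the set $$\kappa=\{(x,y)\in X\times Y: f(x)=g(y)\}.$$ Conversely, for any Borel functions $f:X\to[0,1]$ and $g:Y\to[0,1]$, the set of all operators in $\mathcal{B}(\mathcal{H}_1,\mathcal{H}_2)$ supported by $\{(x,y)\in X\times Y:f(x)=g(y)\}$ is a w*-closed normalizing masa bimodule (over $\mathcal{D}_2,\mathcal{D}_1$).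
   Context: $(X,\mu)$ and $(Y,\nu)$ are standard Borel spaces with $\sigma$-finite Borel measures; the Hilbert spaces $L^2(X,\mu),L^2(Y,\nu)$ are separable. $\mathcal{D}_1,\mathcal{D}_2$ are the algebras of multiplication operators by $L^\infty(X,\mu)$, $L^\infty(Y,\nu)$; masa = maximal abelian selfadjoint algebra. For Borel $\alpha\subseteq X$, $\beta\subseteq Y$, $E(\alpha)\in\mathcal{D}_1$ and $F(\beta)\in\mathcal{D}_2$ are the multiplication projections by the characteristic functions. A linear subspace $\mathcal{U}$ is normalizing if $AB^*C\in\mathcal{U}$ for all $A,B,C\in\mathcal{U}$. An operator $T:\mathcal{H}_1\to\mathcal{H}_2$ is supported by $\kappa\subseteq X\times Y$ if $F(\beta)TE(\alpha)=0$ whenever $\alpha\subseteq X,\beta\subseteq Y$ are Borel with $(\alpha\times\beta)\cap\kappa=\emptyset$. Two subsets of $X\times Y$ are marginally equivalent if their symmetric difference is contained in $(M\times Y)\cup(X\times N)$ with $\mu(M)=\nu(N)=0$. For a reflexive $\mathcal{D}_2,\mathcal{D}_1$-bimodule $\mathcal{U}$ (reflexive: $T\in\mathcal{U}$ whenever $Tx\in\overline{\mathcal{U}x}$ for all $x$; w*-closed normalizing spaces are reflexive), the $\omega$-support of $\mathcal{U}$ is the set $\kappa$, unique up to marginal equivalence, whose complement is marginally equivalent to a countable union of Borel rectangles and such that $\mathcal{U}$ consists of all operators supported by $\kappa$. *)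

theory Defs
  imports "HOL-Analysis.Analysis"
begin

definition standard_borel :: "'a measure \<Rightarrow> bool" where
  "standard_borel M \<longleftrightarrow>
     (\<exists>\<tau>. completely_metrizable_space \<tau> \<and> second_countable \<tau> \<and> topspace \<tau> = space M \<and>
          sets M = sigma_sets (space M) {U. openin \<tau> U})"


section \<open>The Hilbert space \<open>L\<^sup>2\<close> of a measure\<close>

definition sq_integrable :: "'a measure \<Rightarrow> ('a \<Rightarrow> complex) set" where
  "sq_integrable M = {f \<in> borel_measurable M. integrable M (\<lambda>x. (cmod (f x))\<^sup>2)}"

definition ae_rel :: "'a measure \<Rightarrow> (('a \<Rightarrow> complex) \<times> ('a \<Rightarrow> complex)) set" where
  "ae_rel M = {(f, g). f \<in> sq_integrable M \<and> g \<in> sq_integrable M \<and> (AE x in M. f x = g x)}"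

definition L2 :: "'a measure \<Rightarrow> ('a \<Rightarrow> complex) set set" where
  "L2 M = sq_integrable M // ae_rel M"

definition l2_class :: "'a measure \<Rightarrow> ('a \<Rightarrow> complex) \<Rightarrow> ('a \<Rightarrow> complex) set" where
  "l2_class M f = ae_rel M `` {f}"

text \<open>
  The structure of \<open>L2 M\<close> is defined on representatives. None of the operations below
  depends, on elements of \<open>L2 M\<close>, on the representative chosen here.
\<close>

definition l2_rep :: "('a \<Rightarrow> complex) set \<Rightarrow> 'a \<Rightarrow> complex" where
  "l2_rep u = (SOME f. f \<in> u)"

definition l2_zero :: "'a measure \<Rightarrow> ('a \<Rightarrow> complex) set" where
  "l2_zero M = l2_class M (\<lambda>x. 0)"

definition l2_add :: "'a measure \<Rightarrow> ('a \<Rightarrow> complex) set \<Rightarrow> ('a \<Rightarrow> complex) set \<Rightarrow> ('a \<Rightarrow> complex) set" where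
  "l2_add M u v = l2_class M (\<lambda>x. l2_rep u x + l2_rep v x)"

definition l2_scale :: "'a measure \<Rightarrow> complex \<Rightarrow> ('a \<Rightarrow> complex) set \<Rightarrow> ('a \<Rightarrow> complex) set" where
  "l2_scale M c u = l2_class M (\<lambda>x. c * l2_rep u x)"

definition l2_inner :: "'a measure \<Rightarrow> ('a \<Rightarrow> complex) set \<Rightarrow> ('a \<Rightarrow> complex) set \<Rightarrow> complex" where
  "l2_inner M u v = (\<integral>x. l2_rep u x * cnj (l2_rep v x) \<partial>M)"

definition l2_norm :: "'a measure \<Rightarrow> ('a \<Rightarrow> complex) set \<Rightarrow> real" where
  "l2_norm M u = sqrt (\<integral>x. (cmod (l2_rep u x))\<^sup>2 \<partial>M)"

definition l2_dist :: "'a measure \<Rightarrow> ('a \<Rightarrow> complex) set \<Rightarrow> ('a \<Rightarrow> complex) set \<Rightarrow> real" where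
  "l2_dist M u v = sqrt (\<integral>x. (cmod (l2_rep u x - l2_rep v x))\<^sup>2 \<partial>M)"


section \<open>Bounded operators\<close>

type_synonym ('a, 'b) l2_op = "('a \<Rightarrow> complex) set \<Rightarrow> ('b \<Rightarrow> complex) set"

text \<open>
  Operators are extensional functions (equal to \<open>undefined\<close> off \<open>L2 M\<close>), so that equality of
  operators is equality in HOL. Accordingly, products are formed with \<^const>\<open>compose\<close>.
\<close>

definition bounded_ops :: "'a measure \<Rightarrow> 'b measure \<Rightarrow> ('a, 'b) l2_op set" where
  "bounded_ops M N = {T \<in> L2 M \<rightarrow>\<^sub>E L2 N.
     (\<forall>u\<in>L2 M. \<forall>v\<in>L2 M. T (l2_add M u v) = l2_add N (T u) (T v)) \<and>
     (\<forall>c. \<forall>u\<in>L2 M. T (l2_scale M c u) = l2_scale N c (T u)) \<and>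
     (\<exists>C. \<forall>u\<in>L2 M. l2_norm N (T u) \<le> C * l2_norm M u)}"

definition op_zero :: "'a measure \<Rightarrow> 'b measure \<Rightarrow> ('a, 'b) l2_op" where
  "op_zero M N = (\<lambda>u\<in>L2 M. l2_zero N)"

definition op_add :: "'a measure \<Rightarrow> 'b measure \<Rightarrow> ('a, 'b) l2_op \<Rightarrow> ('a, 'b) l2_op \<Rightarrow> ('a, 'b) l2_op" where
  "op_add M N S T = (\<lambda>u\<in>L2 M. l2_add N (S u) (T u))"

definition op_scale :: "'a measure \<Rightarrow> 'b measure \<Rightarrow> complex \<Rightarrow> ('a, 'b) l2_op \<Rightarrow> ('a, 'b) l2_op" where
  "op_scale M N c T = (\<lambda>u\<in>L2 M. l2_scale N c (T u))"

definition op_adj :: "'a measure \<Rightarrow> 'b measure \<Rightarrow> ('a, 'b) l2_op \<Rightarrow> ('b, 'a) l2_op" where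
  "op_adj M N T = (THE S. S \<in> bounded_ops N M \<and>
     (\<forall>u\<in>L2 M. \<forall>v\<in>L2 N. l2_inner N (T u) v = l2_inner M u (S v)))"

definition linear_subspace :: "'a measure \<Rightarrow> 'b measure \<Rightarrow> ('a, 'b) l2_op set \<Rightarrow> bool" where
  "linear_subspace M N U \<longleftrightarrow> U \<subseteq> bounded_ops M N \<and> op_zero M N \<in> U \<and>
     (\<forall>S\<in>U. \<forall>T\<in>U. op_add M N S T \<in> U) \<and> (\<forall>c. \<forall>T\<in>U. op_scale M N c T \<in> U)"

definition normalizing :: "'a measure \<Rightarrow> 'b measure \<Rightarrow> ('a, 'b) l2_op set \<Rightarrow> bool" where
  "normalizing M N U \<longleftrightarrow> linear_subspace M N U \<and>
     (\<forall>A\<in>U. \<forall>B\<in>U. \<forall>C\<in>U. compose (L2 M) A (compose (L2 M) (op_adj M N B) C) \<in> U)"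

text \<open>
  The predual of \<open>B(H\<^sub>1,H\<^sub>2)\<close> is the space of trace class operators \<open>A : H\<^sub>2 \<rightarrow> H\<^sub>1\<close>, paired with
  \<open>B(H\<^sub>1,H\<^sub>2)\<close> by \<open>T \<mapsto> tr (T A)\<close>. These \<open>A\<close> are the operators
  \<open>v \<mapsto> (\<Sum>n. \<langle>v, y\<^sub>n\<rangle> x\<^sub>n)\<close> with \<open>\<Sum>n. \<parallel>x\<^sub>n\<parallel>\<^sup>2\<close> and \<open>\<Sum>n. \<parallel>y\<^sub>n\<parallel>\<^sup>2\<close> finite, and then
  \<open>tr (T A) = (\<Sum>n. \<langle>T x\<^sub>n, y\<^sub>n\<rangle>)\<close>.
\<close>

definition sq_summable_seq :: "'a measure \<Rightarrow> (nat \<Rightarrow> ('a \<Rightarrow> complex) set) \<Rightarrow> bool" where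
  "sq_summable_seq M x \<longleftrightarrow> range x \<subseteq> L2 M \<and> summable (\<lambda>n. (l2_norm M (x n))\<^sup>2)"

definition wstar_topology :: "'a measure \<Rightarrow> 'b measure \<Rightarrow> ('a, 'b) l2_op topology" where
  "wstar_topology M N = topology_generated_by
     {{T \<in> bounded_ops M N. (\<Sum>n. l2_inner N (T (x n)) (y n)) \<in> G} | x y G.
        sq_summable_seq M x \<and> sq_summable_seq N y \<and> open G}"


section \<open>Multiplication algebras and their bimodules\<close>

definition mult_op :: "'a measure \<Rightarrow> ('a \<Rightarrow> complex) \<Rightarrow> ('a, 'a) l2_op" where
  "mult_op M \<phi> = (\<lambda>u\<in>L2 M. l2_class M (\<lambda>x. \<phi> x * l2_rep u x))"

definition ess_bounded :: "'a measure \<Rightarrow> ('a \<Rightarrow> complex) set" where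
  "ess_bounded M = {\<phi> \<in> borel_measurable M. \<exists>C. AE x in M. cmod (\<phi> x) \<le> C}"

definition mult_algebra :: "'a measure \<Rightarrow> ('a, 'a) l2_op set" where
  "mult_algebra M = mult_op M ` ess_bounded M"

definition mult_proj :: "'a measure \<Rightarrow> 'a set \<Rightarrow> ('a, 'a) l2_op" where
  "mult_proj M \<alpha> = mult_op M (indicator \<alpha>)"

definition masa_bimodule :: "'a measure \<Rightarrow> 'b measure \<Rightarrow> ('a, 'b) l2_op set \<Rightarrow> bool" where
  "masa_bimodule M N U \<longleftrightarrow> linear_subspace M N U \<and>
     (\<forall>S\<in>mult_algebra N. \<forall>T\<in>U. \<forall>R\<in>mult_algebra M.
        compose (L2 M) S (compose (L2 M) T R) \<in> U)"

definition reflexive_space :: "'a measure \<Rightarrow> 'b measure \<Rightarrow> ('a, 'b) l2_op set \<Rightarrow> bool" where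
  "reflexive_space M N U \<longleftrightarrow>
     (\<forall>T\<in>bounded_ops M N.
        (\<forall>u\<in>L2 M. T u \<in> Metric_space.mtopology (L2 N) (l2_dist N) closure_of ((\<lambda>A. A u) ` U))
        \<longrightarrow> T \<in> U)"


section \<open>Supports\<close>

definition supported_by :: "'a measure \<Rightarrow> 'b measure \<Rightarrow> ('a, 'b) l2_op \<Rightarrow> ('a \<times> 'b) set \<Rightarrow> bool" where
  "supported_by M N T \<kappa> \<longleftrightarrow>
     (\<forall>\<alpha>\<in>sets M. \<forall>\<beta>\<in>sets N. (\<alpha> \<times> \<beta>) \<inter> \<kappa> = {} \<longrightarrow>
        compose (L2 M) (mult_proj N \<beta>) (compose (L2 M) T (mult_proj M \<alpha>)) = op_zero M N)"

definition ops_supported :: "'a measure \<Rightarrow> 'b measure \<Rightarrow> ('a \<times> 'b) set \<Rightarrow> ('a, 'b) l2_op set" where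
  "ops_supported M N \<kappa> = {T \<in> bounded_ops M N. supported_by M N T \<kappa>}"

definition marginally_equiv :: "'a measure \<Rightarrow> 'b measure \<Rightarrow> ('a \<times> 'b) set \<Rightarrow> ('a \<times> 'b) set \<Rightarrow> bool" where
  "marginally_equiv M N \<kappa> \<kappa>' \<longleftrightarrow>
     (\<exists>P\<in>null_sets M. \<exists>Q\<in>null_sets N.
        (\<kappa> - \<kappa>') \<union> (\<kappa>' - \<kappa>) \<subseteq> (P \<times> space N) \<union> (space M \<times> Q))"

definition countable_rectangle_union :: "'a measure \<Rightarrow> 'b measure \<Rightarrow> ('a \<times> 'b) set \<Rightarrow> bool" where
  "countable_rectangle_union M N \<rho> \<longleftrightarrow>
     (\<exists>(\<alpha> :: nat \<Rightarrow> 'a set) (\<beta> :: nat \<Rightarrow> 'b set).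
        range \<alpha> \<subseteq> sets M \<and> range \<beta> \<subseteq> sets N \<and> \<rho> = (\<Union>n. \<alpha> n \<times> \<beta> n))"

text \<open>
  A relation rather than a function, since the \<open>\<omega>\<close>-support is determined only up to marginal
  equivalence. The first two conjuncts are the domain on which the notion is defined.
\<close>

definition is_omega_support :: "'a measure \<Rightarrow> 'b measure \<Rightarrow> ('a, 'b) l2_op set \<Rightarrow> ('a \<times> 'b) set \<Rightarrow> bool" where
  "is_omega_support M N U \<kappa> \<longleftrightarrow>
     masa_bimodule M N U \<and> reflexive_space M N U \<and>
     \<kappa> \<subseteq> space M \<times> space N \<and>
     (\<exists>\<rho>. countable_rectangle_union M N \<rho> \<and>
          marginally_equiv M N (space M \<times> space N - \<kappa>) \<rho>) \<and>
     U = ops_supported M N \<kappa>"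

end

theory Submission
  imports Defs
begin

text \<open>
  Two sequences of measurable sets \<open>\<alpha> n \<subseteq> X\<close> and \<open>\<beta> n \<subseteq> Y\<close> have an \<^emph>\<open>agreement set\<close>, the set of
  all \<open>(x, y)\<close> such that \<open>x \<in> \<alpha> n \<longleftrightarrow> y \<in> \<beta> n\<close> for every \<open>n\<close>. The sets \<open>f x = g y\<close> are exactly the
  agreement sets: in one direction take the level sets of \<open>f\<close> and \<open>g\<close> at rational heights
  (\<open>level_sets_agreement\<close>), in the other one encode the sequence of bits \<open>x \<in> \<alpha> n\<close> as a point of the
  Cantor set (\<open>agreement_cantor\<close>). So the theorem is about agreement sets, and the bridge to operators
  is \<open>ops_supported_agreement\<close>: a bounded operator \<open>T\<close> is supported by the agreement set iff it
  intertwines the projections, \<open>T 1\<^bsub>\<alpha> n\<^esub> = 1\<^bsub>\<beta> n\<^esub> T\<close> for all \<open>n\<close>.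

  One half of this bridge only looks at the rectangles \<open>\<alpha> n \<times> (Y - \<beta> n)\<close> and \<open>(X - \<alpha> n) \<times> \<beta> n\<close>. The
  other half rests on the Polish topologies behind the two Borel structures. A rectangle \<open>A \<times> B\<close> that misses the
  agreement set is covered by countably many rectangles on which \<open>T\<close> vanishes, and this does not
  formally imply that \<open>T\<close> vanishes on \<open>A \<times> B\<close>. But finite Borel measures on a Polish space are tight,
  so up to small measure \<open>A\<close> and \<open>B\<close> may be replaced by compact sets \<open>K\<close> and \<open>L\<close> in which all
  \<open>\<alpha> n\<close> and \<open>\<beta> n\<close> are relatively clopen. By compactness finitely many indices separate \<open>K\<close> from
  \<open>L\<close>, and for finitely many indices one cuts \<open>K\<close> and \<open>L\<close> into pieces (\<open>vanishes_off_agreement\<close>).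

  The bridge gives the converse part of the theorem at once, because the intertwining relations pass
  from \<open>A\<close>, \<open>B\<close>, \<open>C\<close> to \<open>A B\<^sup>* C\<close>, and because the operators supported by any given set form a
  weak-star closed, reflexive bimodule.

  For the direct part let \<open>U\<close> be a weak-star closed normalizing bimodule, and let \<open>\<A>\<close> be the algebra of
  all \<open>A\<close> on \<open>L\<^sup>2(X)\<close> such that \<open>U A \<subseteq> U\<close> and \<open>U A\<^sup>* \<subseteq> U\<close>. It contains the multiplications and, since \<open>U\<close> is
  normalizing, all products \<open>S\<^sup>* \<psi> T\<close> with \<open>S\<close>, \<open>T \<in> U\<close>. For a projection \<open>1\<^bsub>\<alpha>\<^esub>\<close> commuting with \<open>\<A>\<close>, the
  ranges of \<open>U 1\<^bsub>\<alpha>\<^esub>\<close> and \<open>U 1\<^bsub>X - \<alpha>\<^esub>\<close> live on disjoint sets, so there is \<open>\<beta>\<close> with \<open>S 1\<^bsub>\<alpha>\<^esub> = 1\<^bsub>\<beta>\<^esub> S\<close> for all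
  \<open>S \<in> U\<close> (\<open>partner\<close>). The measure algebra is separable, so a countable dense family of such pairs
  \<open>(\<alpha> n, \<beta> n)\<close> exists, and its agreement set is the required support.

  It remains to see that every \<open>T\<close> which intertwines these pairs lies in \<open>U\<close>. This is von Neumann's
  double commutant argument. A weak-star neighbourhood of \<open>T\<close> is controlled by a single vector \<open>\<xi>\<close> of
  \<open>\<ell>\<^sup>2(L\<^sup>2(X))\<close> (\<open>wstar_open_strong_nbhd\<close>), so it suffices to approximate \<open>T\<^sup>\<infinity> \<xi>\<close> by vectors \<open>S\<^sup>\<infinity> \<xi>\<close>, \<open>S \<in> U\<close>,
  where \<open>T\<^sup>\<infinity>\<close> acts on each entry of the sequence. The projection \<open>Q\<close> onto the closure of \<open>\<A>\<^sup>\<infinity> \<xi>\<close>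
  commutes with \<open>\<A>\<^sup>\<infinity>\<close>. Its matrix entries commute with the multiplications, hence are multiplications
  themselves, and the level sets of their symbols give projections that commute with \<open>\<A>\<close>. Therefore
  \<open>S\<^sup>* T\<close>, which commutes with those projections, commutes with \<open>Q\<close>, and \<open>(S\<^sup>* T)\<^sup>\<infinity> \<xi>\<close> stays in the closure
  of \<open>\<A>\<^sup>\<infinity> \<xi>\<close> for every \<open>S \<in> U\<close> (\<open>adjoint_product_in_closure\<close>). From this, \<open>T\<^sup>\<infinity> \<xi>\<close> itself is in the closure of
  \<open>U\<^sup>\<infinity> \<xi>\<close> (\<open>strongly_dense\<close>).

  The Hilbert space arguments are carried out with square integrable functions and operators that
  are linear and well defined up to null sets. The functions \<open>lift\<close> and \<open>rop\<close> translate between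
  these and the operators on equivalence classes.
\<close>

section \<open>Square integrable functions\<close>

abbreviation SQ :: "'a measure \<Rightarrow> ('a \<Rightarrow> complex) set" where
  "SQ M \<equiv> sq_integrable M"

definition ip :: "'a measure \<Rightarrow> ('a \<Rightarrow> complex) \<Rightarrow> ('a \<Rightarrow> complex) \<Rightarrow> complex" where
  "ip M f g = (\<integral>x. f x * cnj (g x) \<partial>M)"

definition nrm :: "'a measure \<Rightarrow> ('a \<Rightarrow> complex) \<Rightarrow> real" where
  "nrm M f = sqrt (\<integral>x. (cmod (f x))\<^sup>2 \<partial>M)"

lemma borel_measurable_cnj [measurable (raw)]:
  fixes f :: "'a \<Rightarrow> complex"
  shows "f \<in> borel_measurable M \<Longrightarrow> (\<lambda>x. cnj (f x)) \<in> borel_measurable M"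
  by (rule measurable_compose[OF _ borel_measurable_continuous_onI]) (auto intro: continuous_intros)

lemma cnj_indicator [simp]: "cnj (indicator A x) = indicator A x"
  by (simp add: indicator_def)

lemma sq_measurable: "f \<in> SQ M \<Longrightarrow> f \<in> borel_measurable M"
  by (simp add: sq_integrable_def)

lemma sq_integrable_square: "f \<in> SQ M \<Longrightarrow> integrable M (\<lambda>x. (cmod (f x))\<^sup>2)"
  by (simp add: sq_integrable_def)

text \<open>
  Domination is the source of square integrability for products with bounded functions, for
  quotients by a weight and for cut-offs.
\<close>

lemma sq_bound:
  assumes g: "g \<in> SQ M" and [measurable]: "f \<in> borel_measurable M"
    and le: "AE x in M. cmod (f x) \<le> C * cmod (g x)"
  shows "f \<in> SQ M"
proof -
  have "integrable M (\<lambda>x. (cmod (f x))\<^sup>2)"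
  proof (rule Bochner_Integration.integrable_bound)
    show "integrable M (\<lambda>x. C\<^sup>2 * (cmod (g x))\<^sup>2)"
      using sq_integrable_square[OF g] by simp
    show "AE x in M. norm ((cmod (f x))\<^sup>2) \<le> norm (C\<^sup>2 * (cmod (g x))\<^sup>2)"
      using le by eventually_elim (simp add: power_mono flip: power_mult_distrib)
  qed simp
  then show ?thesis by (simp add: sq_integrable_def)
qed

lemma sq_zero [simp]: "(\<lambda>x. 0) \<in> SQ M"
  by (simp add: sq_integrable_def)

lemma sq_add:
  assumes "f \<in> SQ M" "g \<in> SQ M" shows "(\<lambda>x. f x + g x) \<in> SQ M"
proof -
  have [measurable]: "f \<in> borel_measurable M" "g \<in> borel_measurable M"
    using assms by (auto simp: sq_integrable_def)
  have "integrable M (\<lambda>x. (cmod (f x + g x))\<^sup>2)"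
  proof (rule Bochner_Integration.integrable_bound)
    show "integrable M (\<lambda>x. 2 * (cmod (f x))\<^sup>2 + 2 * (cmod (g x))\<^sup>2)"
      using assms by (auto simp: sq_integrable_def)
    have "(cmod (f x + g x))\<^sup>2 \<le> 2 * (cmod (f x))\<^sup>2 + 2 * (cmod (g x))\<^sup>2" for x
    proof -
      have "(cmod (f x + g x))\<^sup>2 \<le> (cmod (f x) + cmod (g x))\<^sup>2"
        by (simp add: norm_triangle_ineq power_mono)
      also have "\<dots> \<le> 2 * (cmod (f x))\<^sup>2 + 2 * (cmod (g x))\<^sup>2"
        using sum_squares_bound[of "cmod (f x)" "cmod (g x)"] by (simp add: power2_sum)
      finally show ?thesis .
    qed
    then show "AE x in M. norm ((cmod (f x + g x))\<^sup>2) \<le> norm (2 * (cmod (f x))\<^sup>2 + 2 * (cmod (g x))\<^sup>2)"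
      by (auto intro!: AE_I2)
  qed simp
  then show ?thesis by (simp add: sq_integrable_def)
qed

lemma sq_mult:
  assumes "f \<in> SQ M" "\<phi> \<in> borel_measurable M" "AE x in M. cmod (\<phi> x) \<le> C"
  shows "(\<lambda>x. \<phi> x * f x) \<in> SQ M"
proof (rule sq_bound[OF assms(1)])
  show "AE x in M. cmod (\<phi> x * f x) \<le> C * cmod (f x)"
    using assms(3) by eventually_elim (simp add: norm_mult mult_right_mono)
qed (use assms in \<open>auto simp: sq_integrable_def\<close>)

lemma sq_scale: "f \<in> SQ M \<Longrightarrow> (\<lambda>x. c * f x) \<in> SQ M"
  by (rule sq_mult[where C = "cmod c"]) auto

lemma sq_diff: "f \<in> SQ M \<Longrightarrow> g \<in> SQ M \<Longrightarrow> (\<lambda>x. f x - g x) \<in> SQ M"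
  using sq_add[of f M "\<lambda>x. (-1) * g x"] sq_scale[of g M "-1"] by simp

lemma sq_cut: "f \<in> SQ M \<Longrightarrow> A \<in> sets M \<Longrightarrow> (\<lambda>x. indicator A x * f x) \<in> SQ M"
  by (rule sq_mult[where C = 1]) (auto simp: indicator_def)

lemma integrable_ip:
  assumes "f \<in> SQ M" "g \<in> SQ M" shows "integrable M (\<lambda>x. f x * cnj (g x))"
proof (rule Bochner_Integration.integrable_bound)
  show "integrable M (\<lambda>x. (cmod (f x))\<^sup>2 + (cmod (g x))\<^sup>2)"
    using assms by (auto simp: sq_integrable_def)
  show "(\<lambda>x. f x * cnj (g x)) \<in> borel_measurable M"
    using assms by (auto simp: sq_integrable_def)
  have "cmod (f x) * cmod (g x) \<le> (cmod (f x))\<^sup>2 + (cmod (g x))\<^sup>2" for x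
    using sum_squares_bound[of "cmod (f x)" "cmod (g x)"]
      mult_nonneg_nonneg[OF norm_ge_zero[of "f x"] norm_ge_zero[of "g x"]] by linarith
  then show "AE x in M. norm (f x * cnj (g x)) \<le> norm ((cmod (f x))\<^sup>2 + (cmod (g x))\<^sup>2)"
    by (auto simp: norm_mult intro!: AE_I2)
qed

lemma ip_add_left: "f \<in> SQ M \<Longrightarrow> g \<in> SQ M \<Longrightarrow> k \<in> SQ M \<Longrightarrow> ip M (\<lambda>x. f x + g x) k = ip M f k + ip M g k"
  by (simp add: ip_def distrib_right integrable_ip)

lemma ip_diff_left: "f \<in> SQ M \<Longrightarrow> g \<in> SQ M \<Longrightarrow> k \<in> SQ M \<Longrightarrow> ip M (\<lambda>x. f x - g x) k = ip M f k - ip M g k"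
  by (simp add: ip_def left_diff_distrib integrable_ip)

lemma ip_scale_left: "ip M (\<lambda>x. c * f x) k = c * ip M f k"
  by (simp add: ip_def mult.assoc)

lemma ip_commute: "ip M g f = cnj (ip M f g)"
  unfolding ip_def Bochner_Integration.integral_cnj[symmetric] by (simp add: mult.commute)

lemma ip_add_right: "f \<in> SQ M \<Longrightarrow> g \<in> SQ M \<Longrightarrow> k \<in> SQ M \<Longrightarrow> ip M k (\<lambda>x. f x + g x) = ip M k f + ip M k g"
  by (simp add: ip_def distrib_left integrable_ip)

lemma ip_scale_right: "ip M k (\<lambda>x. c * f x) = cnj c * ip M k f"
  by (metis complex_cnj_mult ip_commute ip_scale_left)

lemma ip_mult_move: "ip M (\<lambda>x. \<phi> x * f x) g = ip M f (\<lambda>x. cnj (\<phi> x) * g x)"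
  by (simp add: ip_def mult_ac)

lemma ip_cut_move: "ip M (\<lambda>x. indicator A x * f x) g = ip M f (\<lambda>x. indicator A x * g x)"
  by (simp add: ip_mult_move)

lemma nrm_square: "(nrm M f)\<^sup>2 = (\<integral>x. (cmod (f x))\<^sup>2 \<partial>M)"
  by (simp add: nrm_def)

lemma nrm_nonneg [simp]: "0 \<le> nrm M f"
  by (simp add: nrm_def)

lemma nrm_zero [simp]: "nrm M (\<lambda>x. 0) = 0"
  by (simp add: nrm_def)

lemma ip_self: "ip M f f = of_real ((nrm M f)\<^sup>2)"
proof -
  have "ip M f f = (\<integral>x. complex_of_real ((cmod (f x))\<^sup>2) \<partial>M)"
    unfolding ip_def complex_norm_square by simp
  then show ?thesis by (simp only: integral_complex_of_real nrm_square)
qed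

lemma nrm_eq_0_iff:
  assumes "f \<in> SQ M" shows "nrm M f = 0 \<longleftrightarrow> (AE x in M. f x = 0)"
proof -
  have "nrm M f = 0 \<longleftrightarrow> (\<integral>x. (cmod (f x))\<^sup>2 \<partial>M) = 0" by (simp add: nrm_def)
  also have "\<dots> \<longleftrightarrow> (AE x in M. (cmod (f x))\<^sup>2 = 0)"
    by (rule integral_nonneg_eq_0_iff_AE) (use sq_integrable_square[OF assms] in auto)
  finally show ?thesis by simp
qed

lemma ip_cong_AE:
  assumes "f \<in> borel_measurable M" "f' \<in> borel_measurable M" "g \<in> borel_measurable M" "g' \<in> borel_measurable M"
    and "AE x in M. f x = f' x" "AE x in M. g x = g' x"
  shows "ip M f g = ip M f' g'"
  unfolding ip_def by (rule integral_cong_AE) (use assms in auto)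

lemma ip_cong_right:
  "g \<in> SQ M \<Longrightarrow> u \<in> SQ M \<Longrightarrow> v \<in> SQ M \<Longrightarrow> AE x in M. u x = v x \<Longrightarrow> ip M g u = ip M g v"
  by (rule ip_cong_AE) (auto intro: sq_measurable)

lemma nrm_cong_AE:
  assumes "f \<in> borel_measurable M" "f' \<in> borel_measurable M" "AE x in M. f x = f' x"
  shows "nrm M f = nrm M f'"
  unfolding nrm_def by (rule arg_cong[of _ _ sqrt], rule integral_cong_AE) (use assms in auto)

lemma nrm_scale: "nrm M (\<lambda>x. c * f x) = cmod c * nrm M f"
  by (simp add: nrm_def norm_mult power_mult_distrib real_sqrt_mult)

lemma nrm_minus_commute: "nrm M (\<lambda>x. f x - g x) = nrm M (\<lambda>x. g x - f x)"
  by (simp add: nrm_def norm_minus_commute)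

lemma ip_zero_left: "ip M (\<lambda>x. 0) f = 0" and ip_zero_right: "ip M f (\<lambda>x. 0) = 0"
  by (simp_all add: ip_def)

text \<open>
  A weighted inequality between arithmetic and geometric mean, integrated with weights that make both
  terms on the right-hand side equal.
\<close>

lemma cauchy_schwarz:
  assumes f: "f \<in> SQ M" and g: "g \<in> SQ M"
  shows "cmod (ip M f g) \<le> nrm M f * nrm M g"
proof (cases "nrm M f = 0 \<or> nrm M g = 0")
  case True
  have [measurable]: "f \<in> borel_measurable M" "g \<in> borel_measurable M"
    using assms by (auto simp: sq_integrable_def)
  have "ip M f g = 0"
    using True
  proof
    assume "nrm M f = 0"
    then have "ip M f g = ip M (\<lambda>x. 0) g"
      by (intro ip_cong_AE) (use f in \<open>auto simp: nrm_eq_0_iff\<close>)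
    then show ?thesis by (simp add: ip_zero_left)
  next
    assume "nrm M g = 0"
    then have "ip M f g = ip M f (\<lambda>x. 0)"
      by (intro ip_cong_AE) (use g in \<open>auto simp: nrm_eq_0_iff\<close>)
    then show ?thesis by (simp add: ip_zero_right)
  qed
  then show ?thesis by (simp add: mult_nonneg_nonneg)
next
  case False
  define a b where "a = nrm M f" and "b = nrm M g"
  have pos: "a > 0" "b > 0" using False by (auto simp: a_def b_def less_le)
  have "cmod (ip M f g) \<le> (\<integral>x. cmod (f x * cnj (g x)) \<partial>M)"
    unfolding ip_def by (rule integral_norm_bound)
  also have "\<dots> \<le> (\<integral>x. b / (2 * a) * (cmod (f x))\<^sup>2 + a / (2 * b) * (cmod (g x))\<^sup>2 \<partial>M)"
  proof (rule integral_mono)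
    fix x
    have "0 \<le> (b * cmod (f x) - a * cmod (g x))\<^sup>2 / (2 * a * b)"
      using pos by (intro divide_nonneg_nonneg) auto
    also have "\<dots> = b / (2 * a) * (cmod (f x))\<^sup>2 + a / (2 * b) * (cmod (g x))\<^sup>2 - cmod (f x) * cmod (g x)"
      using pos by (simp add: field_simps power2_eq_square)
    finally show "cmod (f x * cnj (g x)) \<le> b / (2 * a) * (cmod (f x))\<^sup>2 + a / (2 * b) * (cmod (g x))\<^sup>2"
      by (simp add: norm_mult)
  next
    show "integrable M (\<lambda>x. b / (2 * a) * (cmod (f x))\<^sup>2 + a / (2 * b) * (cmod (g x))\<^sup>2)"
      using sq_integrable_square[OF f] sq_integrable_square[OF g]
      by (intro Bochner_Integration.integrable_add integrable_mult_right) auto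
  qed (use integrable_ip[OF f g] in \<open>auto intro: integrable_norm\<close>)
  also have "\<dots> = b / (2 * a) * a\<^sup>2 + a / (2 * b) * b\<^sup>2"
    using sq_integrable_square[OF f] sq_integrable_square[OF g]
    by (simp add: a_def b_def nrm_square)
  also have "\<dots> = a * b" using pos by (simp add: field_simps power2_eq_square)
  finally show ?thesis by (simp add: a_def b_def)
qed

lemma nrm_add_square:
  assumes "f \<in> SQ M" "g \<in> SQ M"
  shows "(nrm M (\<lambda>x. f x + g x))\<^sup>2 = (nrm M f)\<^sup>2 + 2 * Re (ip M f g) + (nrm M g)\<^sup>2"
proof -
  have "complex_of_real ((nrm M (\<lambda>x. f x + g x))\<^sup>2) = ip M (\<lambda>x. f x + g x) (\<lambda>x. f x + g x)"
    by (simp only: ip_self)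
  also have "\<dots> = ip M f f + (ip M f g + cnj (ip M f g)) + ip M g g"
    using assms by (simp add: ip_add_left ip_add_right sq_add ip_commute[of M g f])
  also have "\<dots> = of_real ((nrm M f)\<^sup>2 + 2 * Re (ip M f g) + (nrm M g)\<^sup>2)"
    by (simp add: ip_self complex_add_cnj)
  finally show ?thesis using of_real_eq_iff by blast
qed

lemma nrm_diff_square:
  assumes "f \<in> SQ M" "g \<in> SQ M"
  shows "(nrm M (\<lambda>x. f x - g x))\<^sup>2 = (nrm M f)\<^sup>2 - 2 * Re (ip M f g) + (nrm M g)\<^sup>2"
  using nrm_add_square[OF assms(1) sq_scale[OF assms(2), of "-1"]] nrm_scale[of M "-1" g]
    ip_scale_right[of M f "-1" g] by simp

lemma nrm_triangle:
  assumes "f \<in> SQ M" "g \<in> SQ M"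
  shows "nrm M (\<lambda>x. f x + g x) \<le> nrm M f + nrm M g"
proof (rule power2_le_imp_le)
  have "Re (ip M f g) \<le> nrm M f * nrm M g"
    using cauchy_schwarz[OF assms] complex_Re_le_cmod[of "ip M f g"] by linarith
  then show "(nrm M (\<lambda>x. f x + g x))\<^sup>2 \<le> (nrm M f + nrm M g)\<^sup>2"
    by (simp add: nrm_add_square[OF assms] power2_sum)
qed auto

lemma nrm_triangle_sub:
  assumes "f \<in> SQ M" "g \<in> SQ M" "h \<in> SQ M"
  shows "nrm M (\<lambda>x. f x - h x) \<le> nrm M (\<lambda>x. f x - g x) + nrm M (\<lambda>x. g x - h x)"
  using nrm_triangle[OF sq_diff[OF assms(1,2)] sq_diff[OF assms(2,3)]] by simp

lemma nrm_mono_AE: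
  assumes g: "g \<in> SQ M" and f: "f \<in> borel_measurable M"
    and le: "AE x in M. cmod (f x) \<le> C * cmod (g x)" and C: "0 \<le> C"
  shows "nrm M f \<le> C * nrm M g"
proof -
  have fS: "f \<in> SQ M" by (rule sq_bound[OF g f le])
  have "(nrm M f)\<^sup>2 \<le> (\<integral>x. C\<^sup>2 * (cmod (g x))\<^sup>2 \<partial>M)"
    unfolding nrm_square
  proof (rule integral_mono_AE)
    show "AE x in M. (cmod (f x))\<^sup>2 \<le> C\<^sup>2 * (cmod (g x))\<^sup>2"
      using le by eventually_elim (metis norm_ge_zero power_mono power_mult_distrib)
  qed (use sq_integrable_square[OF fS] sq_integrable_square[OF g] in auto)
  also have "\<dots> = (C * nrm M g)\<^sup>2" by (simp add: power_mult_distrib nrm_square)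
  finally show ?thesis using C by (auto intro: power2_le_imp_le)
qed

lemma nrm_cut_le: "f \<in> SQ M \<Longrightarrow> A \<in> sets M \<Longrightarrow> nrm M (\<lambda>x. indicator A x * f x) \<le> nrm M f"
  using nrm_mono_AE[of f M "\<lambda>x. indicator A x * f x" 1]
  by (auto simp: indicator_def sq_integrable_def)

lemma AE_eq_iff_nrm:
  assumes "f \<in> SQ M" "g \<in> SQ M"
  shows "(AE x in M. f x = g x) \<longleftrightarrow> nrm M (\<lambda>x. f x - g x) = 0"
  using nrm_eq_0_iff[OF sq_diff[OF assms]] by simp

lemma AE_eqI_ip:
  assumes "f \<in> SQ M" "g \<in> SQ M" "\<And>k. k \<in> SQ M \<Longrightarrow> ip M f k = ip M g k"
  shows "AE x in M. f x = g x"
proof -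
  have "ip M (\<lambda>x. f x - g x) (\<lambda>x. f x - g x) = 0"
    using assms sq_diff[OF assms(1,2)] by (simp add: ip_diff_left)
  then show ?thesis using AE_eq_iff_nrm[OF assms(1,2)] by (simp add: ip_self)
qed

lemma nrm_eq_nn_integral:
  assumes "f \<in> SQ M" shows "ennreal ((nrm M f)\<^sup>2) = (\<integral>\<^sup>+x. ennreal ((cmod (f x))\<^sup>2) \<partial>M)"
  unfolding nrm_square
  by (rule nn_integral_eq_integral[symmetric]) (use sq_integrable_square[OF assms] in auto)

lemma sq_iff_nn_integral:
  assumes [measurable]: "f \<in> borel_measurable M"
  shows "f \<in> SQ M \<longleftrightarrow> (\<integral>\<^sup>+x. ennreal ((cmod (f x))\<^sup>2) \<partial>M) < \<infinity>"
  by (auto simp: sq_integrable_def integrable_iff_bounded)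

section \<open>Completeness, orthogonal projections and adjoints\<close>

text \<open>
  A strictly positive square integrable \<open>h\<close> takes over the role of the constant function 1, which need
  not be square integrable: it is a cyclic vector for the multiplications, and \<open>h\<^sup>2\<close> is the density of a
  finite measure with the same null sets.
\<close>

lemma ex_weight:
  assumes "sigma_finite_measure M"
  obtains h :: "'a \<Rightarrow> real" where "h \<in> borel_measurable M" "\<And>x. x \<in> space M \<Longrightarrow> 0 < h x"
    "(\<lambda>x. complex_of_real (h x)) \<in> SQ M"
proof -
  interpret sigma_finite_measure M by fact
  obtain u :: "'a \<Rightarrow> ennreal" where u[measurable]: "u \<in> borel_measurable M" and fin: "integral\<^sup>N M u \<noteq> \<infinity>"
    and pos: "\<And>x. x \<in> space M \<Longrightarrow> 0 < u x \<and> u x < \<infinity>"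
    using Ex_finite_integrable_function by auto
  define h where "h x = sqrt (enn2real (u x))" for x
  have [measurable]: "h \<in> borel_measurable M" by (auto simp: h_def[abs_def])
  have "0 < h x" if "x \<in> space M" for x
    using pos[OF that] by (auto simp: h_def enn2real_positive_iff)
  moreover have "(\<lambda>x. complex_of_real (h x)) \<in> SQ M"
  proof (subst sq_iff_nn_integral)
    have "(\<integral>\<^sup>+x. ennreal ((cmod (complex_of_real (h x)))\<^sup>2) \<partial>M) = integral\<^sup>N M u"
    proof (rule nn_integral_cong)
      fix x assume "x \<in> space M"
      then show "ennreal ((cmod (complex_of_real (h x)))\<^sup>2) = u x"
        using pos[of x] by (simp add: h_def enn2real_nonneg)
    qed
    then show "(\<integral>\<^sup>+x. ennreal ((cmod (complex_of_real (h x)))\<^sup>2) \<partial>M) < \<infinity>"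
      using fin by (simp add: less_top)
  qed measurable
  ultimately show ?thesis using that[of h] by auto
qed

text \<open>
  Pairing with the weight \<open>h\<close> turns norm estimates into integral estimates, and \<open>h > 0\<close> allows to
  divide by it again afterwards.
\<close>

lemma rapid_AE_summable:
  assumes sf: "sigma_finite_measure M" and D: "\<And>k. D k \<in> SQ M" and le: "\<And>k. nrm M (D k) \<le> (1/2)^k"
  shows "AE x in M. summable (\<lambda>k. cmod (D k x))"
proof -
  obtain h :: "'a \<Rightarrow> real" where h: "h \<in> borel_measurable M" "\<And>x. x \<in> space M \<Longrightarrow> 0 < h x"
    and hS: "(\<lambda>x. complex_of_real (h x)) \<in> SQ M"
    using ex_weight[OF sf] by blast
  have [measurable]: "D k \<in> borel_measurable M" for k using D by (auto simp: sq_integrable_def)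
  note [measurable] = h(1)
  have absS: "(\<lambda>x. complex_of_real (cmod (D k x))) \<in> SQ M" for k
    by (rule sq_bound[OF D[of k], where C = 1]) auto
  have term_le: "(\<integral>\<^sup>+x. ennreal (h x * cmod (D k x)) \<partial>M) \<le> ennreal (nrm M (\<lambda>x. of_real (h x)) * (1/2)^k)" for k
  proof -
    have int: "integrable M (\<lambda>x. h x * cmod (D k x))"
      using integrable_Re[OF integrable_ip[OF hS absS[of k]]] by simp
    have "complex_of_real (\<integral>x. h x * cmod (D k x) \<partial>M) = ip M (\<lambda>x. of_real (h x)) (\<lambda>x. of_real (cmod (D k x)))"
      unfolding ip_def by (simp flip: of_real_mult)
    then have "\<bar>\<integral>x. h x * cmod (D k x) \<partial>M\<bar> \<le> nrm M (\<lambda>x. of_real (h x)) * nrm M (\<lambda>x. of_real (cmod (D k x)))"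
      using cauchy_schwarz[OF hS absS[of k]] by (metis norm_of_real)
    moreover have "nrm M (\<lambda>x. of_real (cmod (D k x))) = nrm M (D k)" by (simp add: nrm_def)
    ultimately have "(\<integral>x. h x * cmod (D k x) \<partial>M) \<le> nrm M (\<lambda>x. of_real (h x)) * (1/2)^k"
      using mult_left_mono[OF le[of k] nrm_nonneg[of M "\<lambda>x. of_real (h x)"]] by simp
    moreover have "(\<integral>\<^sup>+x. ennreal (h x * cmod (D k x)) \<partial>M) = ennreal (\<integral>x. h x * cmod (D k x) \<partial>M)"
      by (rule nn_integral_eq_integral[OF int]) (use h(2) in \<open>auto intro!: AE_I2 mult_nonneg_nonneg intro: less_imp_le\<close>)
    ultimately show ?thesis by (simp add: ennreal_leI)
  qed
  have "(\<integral>\<^sup>+x. (\<Sum>k. ennreal (h x * cmod (D k x))) \<partial>M) = (\<Sum>k. \<integral>\<^sup>+x. ennreal (h x * cmod (D k x)) \<partial>M)"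
    by (rule nn_integral_suminf) measurable
  also have "\<dots> \<le> (\<Sum>k. ennreal (nrm M (\<lambda>x. of_real (h x)) * (1/2)^k))"
    by (intro suminf_le term_le) auto
  also have "\<dots> = ennreal (\<Sum>k. nrm M (\<lambda>x. of_real (h x)) * (1/2)^k)"
    by (intro suminf_ennreal2 summable_mult summable_geometric) (auto intro: mult_nonneg_nonneg)
  also have "\<dots> < \<infinity>" by simp
  finally have "AE x in M. (\<Sum>k. ennreal (h x * cmod (D k x))) \<noteq> \<infinity>"
    by (intro nn_integral_PInf_AE) auto
  then show ?thesis
  proof (rule AE_mp, intro AE_I2 impI)
    fix x assume x: "x \<in> space M" and "(\<Sum>k. ennreal (h x * cmod (D k x))) \<noteq> \<infinity>"
    then have "summable (\<lambda>k. h x * cmod (D k x))"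
      using h(2)[OF x] by (intro summable_suminf_not_top) (auto intro!: mult_nonneg_nonneg)
    then show "summable (\<lambda>k. cmod (D k x))"
      using h(2)[OF x] by (simp add: summable_mult_D)
  qed
qed

text \<open>
  A rapidly converging subsequence converges almost everywhere; Fatou's lemma shows that its pointwise
  limit is also the limit in norm of the whole sequence.
\<close>

theorem riesz_fischer:
  assumes sf: "sigma_finite_measure M" and F: "\<And>n. F n \<in> SQ M"
    and cau: "\<And>e. e > 0 \<Longrightarrow> \<exists>K. \<forall>m\<ge>K. \<forall>n\<ge>K. nrm M (\<lambda>x. F m x - F n x) < e"
  shows "\<exists>f\<in>SQ M. (\<lambda>n. nrm M (\<lambda>x. F n x - f x)) \<longlonglongrightarrow> 0"
proof -
  have Fm[measurable]: "F n \<in> borel_measurable M" for n using F by (auto simp: sq_integrable_def)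
  have "\<exists>K. \<forall>k. K k < K (Suc k) \<and> (\<forall>m\<ge>K k. \<forall>n\<ge>K k. nrm M (\<lambda>x. F m x - F n x) < (1/2)^k)"
  proof -
    have ex: "\<exists>K>L. \<forall>m\<ge>K. \<forall>n\<ge>K. nrm M (\<lambda>x. F m x - F n x) < (1/2)^k" for k L
    proof -
      obtain K where "\<forall>m\<ge>K. \<forall>n\<ge>K. nrm M (\<lambda>x. F m x - F n x) < (1/2)^k"
        using cau[of "(1/2)^k"] by auto
      then show ?thesis by (intro exI[of _ "max K (Suc L)"]) auto
    qed
    have "\<exists>K. \<forall>k. (\<forall>m\<ge>K k. \<forall>n\<ge>K k. nrm M (\<lambda>x. F m x - F n x) < (1/2)^k) \<and> K k < K (Suc k)"
    proof (rule dependent_nat_choice)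
      show "\<exists>K. \<forall>m\<ge>K. \<forall>n\<ge>K. nrm M (\<lambda>x. F m x - F n x) < (1/2)^0" using ex[of 0 0] by blast
      show "\<exists>y. (\<forall>m\<ge>y. \<forall>n\<ge>y. nrm M (\<lambda>x. F m x - F n x) < (1/2)^(Suc k)) \<and> x < y" for x k
        using ex[of x "Suc k"] by blast
    qed
    then show ?thesis by blast
  qed
  then obtain r where r: "\<And>k. r k < r (Suc k)"
    and rc: "\<And>k m n. m \<ge> r k \<Longrightarrow> n \<ge> r k \<Longrightarrow> nrm M (\<lambda>x. F m x - F n x) < (1/2)^k"
    by blast
  have "strict_mono r" using r by (simp add: strict_mono_Suc_iff)
  then have rk: "k \<le> r k" for k by (rule seq_suble)
  define D where "D k x = F (r (Suc k)) x - F (r k) x" for k x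
  have "AE x in M. summable (\<lambda>k. cmod (D k x))"
  proof (rule rapid_AE_summable[OF sf])
    show "D k \<in> SQ M" for k unfolding D_def[abs_def] by (intro sq_diff F)
    show "nrm M (D k) \<le> (1/2)^k" for k
      using rc[of k "r (Suc k)" "r k"] r[of k] by (simp add: D_def[abs_def])
  qed
  then have conv: "AE x in M. convergent (\<lambda>k. F (r k) x)"
  proof eventually_elim
    case (elim x)
    then have "convergent (\<lambda>n. \<Sum>k<n. D k x)"
      using summable_norm_cancel[of "\<lambda>k. D k x"] by (simp add: summable_iff_convergent)
    moreover have "(\<Sum>k<n. D k x) = F (r n) x - F (r 0) x" for n
      unfolding D_def by (rule sum_lessThan_telescope)
    ultimately have "convergent (\<lambda>n. F (r n) x - F (r 0) x + F (r 0) x)"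
      by (intro convergent_add convergent_const) simp
    then show ?case by simp
  qed
  define f where "f x = lim (\<lambda>k. F (r k) x)" for x
  have [measurable]: "f \<in> borel_measurable M" unfolding f_def[abs_def] by measurable
  have lim: "AE x in M. (\<lambda>k. F (r k) x) \<longlonglongrightarrow> f x"
    using conv by eventually_elim (simp add: f_def convergent_LIMSEQ_iff)
  \<comment> \<open>One estimate serves twice: with e = 1 it puts the limit into the space, with small e it gives convergence.\<close>
  have tail: "(\<lambda>x. F n x - f x) \<in> SQ M \<and> nrm M (\<lambda>x. F n x - f x) \<le> e"
    if K: "\<forall>m\<ge>K. \<forall>n\<ge>K. nrm M (\<lambda>x. F m x - F n x) < e" and n: "n \<ge> K" for n K e
  proof -
    have e: "0 \<le> e" using K n by (metis nrm_nonneg less_imp_le order_trans)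
    have "(\<integral>\<^sup>+x. ennreal ((cmod (F n x - f x))\<^sup>2) \<partial>M)
        = (\<integral>\<^sup>+x. liminf (\<lambda>k. ennreal ((cmod (F n x - F (r k) x))\<^sup>2)) \<partial>M)"
    proof (rule nn_integral_cong_AE, use lim in eventually_elim)
      case (elim x)
      then have "(\<lambda>k. ennreal ((cmod (F n x - F (r k) x))\<^sup>2)) \<longlonglongrightarrow> ennreal ((cmod (F n x - f x))\<^sup>2)"
        by (intro tendsto_ennrealI tendsto_intros)
      from lim_imp_Liminf[OF _ this] show ?case by simp
    qed
    also have "\<dots> \<le> liminf (\<lambda>k. \<integral>\<^sup>+x. ennreal ((cmod (F n x - F (r k) x))\<^sup>2) \<partial>M)"
      by (rule nn_integral_liminf) measurable
    also have "\<dots> = liminf (\<lambda>k. ennreal ((nrm M (\<lambda>x. F n x - F (r k) x))\<^sup>2))"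
      by (simp add: nrm_eq_nn_integral sq_diff F)
    also have "\<dots> \<le> ennreal (e\<^sup>2)"
    proof (rule Liminf_le)
      have "\<forall>\<^sub>F k in sequentially. k \<ge> K" by (rule eventually_ge_at_top)
      then show "\<forall>\<^sub>F k in sequentially. ennreal ((nrm M (\<lambda>x. F n x - F (r k) x))\<^sup>2) \<le> ennreal (e\<^sup>2)"
      proof eventually_elim
        case (elim k)
        then have "nrm M (\<lambda>x. F n x - F (r k) x) < e" using K n rk[of k] by (meson order_trans)
        then show ?case by (intro ennreal_leI power_mono) auto
      qed
    qed auto
    finally have *: "(\<integral>\<^sup>+x. ennreal ((cmod (F n x - f x))\<^sup>2) \<partial>M) \<le> ennreal (e\<^sup>2)" .
    have S: "(\<lambda>x. F n x - f x) \<in> SQ M"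
      using * by (subst sq_iff_nn_integral) (auto intro: order.strict_trans1)
    have "(nrm M (\<lambda>x. F n x - f x))\<^sup>2 \<le> e\<^sup>2"
      using * by (simp flip: nrm_eq_nn_integral[OF S])
    then show ?thesis using S e power2_le_imp_le by blast
  qed
  obtain K1 where "\<forall>m\<ge>K1. \<forall>n\<ge>K1. nrm M (\<lambda>x. F m x - F n x) < 1" using cau[of 1] by auto
  from tail[OF this order_refl] have "(\<lambda>x. F K1 x - f x) \<in> SQ M" by simp
  from sq_diff[OF F[of K1] this] have "f \<in> SQ M" by simp
  moreover have "(\<lambda>n. nrm M (\<lambda>x. F n x - f x)) \<longlonglongrightarrow> 0"
  proof (rule LIMSEQ_I)
    fix e :: real assume "0 < e"
    then obtain K where K: "\<forall>m\<ge>K. \<forall>n\<ge>K. nrm M (\<lambda>x. F m x - F n x) < e/2" using cau[of "e/2"] by auto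
    show "\<exists>no. \<forall>n\<ge>no. norm (nrm M (\<lambda>x. F n x - f x) - 0) < e"
      using tail[OF K] \<open>0 < e\<close> by (intro exI[of _ K]) fastforce
  qed
  ultimately show ?thesis by blast
qed

definition lin_sub :: "'a measure \<Rightarrow> ('a \<Rightarrow> complex) set \<Rightarrow> bool" where
  "lin_sub M V \<longleftrightarrow> V \<subseteq> SQ M \<and> (\<lambda>x. 0) \<in> V \<and> (\<forall>f\<in>V. \<forall>g\<in>V. (\<lambda>x. f x + g x) \<in> V) \<and>
     (\<forall>c. \<forall>f\<in>V. (\<lambda>x. c * f x) \<in> V)"

text \<open>
  Closure by approximation also saturates \<open>V\<close> under equality almost everywhere, so subspaces may be
  given by arbitrary representatives.
\<close>

definition in_cl :: "'a measure \<Rightarrow> ('a \<Rightarrow> complex) set \<Rightarrow> ('a \<Rightarrow> complex) \<Rightarrow> bool" where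
  "in_cl M V p \<longleftrightarrow> p \<in> SQ M \<and> (\<forall>e>0. \<exists>v\<in>V. nrm M (\<lambda>x. p x - v x) < e)"

lemma lin_sub_SQ: "lin_sub M V \<Longrightarrow> v \<in> V \<Longrightarrow> v \<in> SQ M"
  by (auto simp: lin_sub_def)

lemma lin_sub_zero: "lin_sub M V \<Longrightarrow> (\<lambda>x. 0) \<in> V"
  and lin_sub_add: "lin_sub M V \<Longrightarrow> u \<in> V \<Longrightarrow> v \<in> V \<Longrightarrow> (\<lambda>x. u x + v x) \<in> V"
  and lin_sub_scale: "lin_sub M V \<Longrightarrow> u \<in> V \<Longrightarrow> (\<lambda>x. c * u x) \<in> V"
  by (auto simp: lin_sub_def)

lemma in_cl_subset: "V \<subseteq> SQ M \<Longrightarrow> v \<in> V \<Longrightarrow> in_cl M V v"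
  by (auto simp: in_cl_def intro!: bexI[of _ v])

lemma in_cl_cong:
  assumes p: "in_cl M V p" and V: "V \<subseteq> SQ M" and q: "q \<in> SQ M" and eq: "AE x in M. p x = q x"
  shows "in_cl M V q"
  unfolding in_cl_def
proof (intro conjI q allI impI)
  fix e :: real assume "0 < e"
  then obtain v where v: "v \<in> V" "nrm M (\<lambda>x. p x - v x) < e" using p unfolding in_cl_def by blast
  have "nrm M (\<lambda>x. q x - v x) = nrm M (\<lambda>x. p x - v x)"
  proof (rule nrm_cong_AE)
    show "AE x in M. q x - v x = p x - v x" using eq by eventually_elim simp
  qed (use p q v V in \<open>auto simp: in_cl_def intro!: sq_measurable sq_diff\<close>)
  then show "\<exists>v\<in>V. nrm M (\<lambda>x. q x - v x) < e" using v by metis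
qed

text \<open>
  Subtracting the component of \<open>g\<close> along \<open>v\<close> would shorten \<open>g\<close>.
\<close>

lemma orthogonal_of_minimal:
  assumes g: "g \<in> SQ M" and v: "v \<in> SQ M" and min: "\<And>c. nrm M g \<le> nrm M (\<lambda>x. g x - c * v x)"
  shows "ip M g v = 0"
proof (cases "nrm M v = 0")
  case True
  then show ?thesis using cauchy_schwarz[OF g v] by simp
next
  case False
  define c where "c = ip M g v / of_real ((nrm M v)\<^sup>2)"
  have "(nrm M g)\<^sup>2 \<le> (nrm M (\<lambda>x. g x - c * v x))\<^sup>2" using min by (intro power_mono) auto
  also have "\<dots> = (nrm M g)\<^sup>2 - 2 * Re (cnj c * ip M g v) + (cmod c * nrm M v)\<^sup>2"
    using nrm_diff_square[OF g sq_scale[OF v, of c]] by (simp add: ip_scale_right nrm_scale)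
  finally have *: "2 * Re (cnj c * ip M g v) \<le> (cmod c * nrm M v)\<^sup>2" by simp
  have c2: "ip M g v = c * of_real ((nrm M v)\<^sup>2)" using False by (simp add: c_def)
  have "cnj c * ip M g v = (c * cnj c) * of_real ((nrm M v)\<^sup>2)" by (simp add: c2)
  also have "\<dots> = of_real ((cmod c)\<^sup>2 * (nrm M v)\<^sup>2)" by (simp flip: complex_norm_square)
  finally have "Re (cnj c * ip M g v) = (cmod c * nrm M v)\<^sup>2" by (simp add: power_mult_distrib)
  then have "cmod c * nrm M v = 0" using * by simp
  then have "c = 0" using False by simp
  then show ?thesis by (simp add: c2)
qed

text \<open>
  A minimizing sequence is a Cauchy sequence by the parallelogram law, and its limit has minimal
  distance to \<open>f\<close>.
\<close>

theorem projection_exists: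
  assumes sf: "sigma_finite_measure M" and V: "lin_sub M V" and f: "f \<in> SQ M"
  shows "\<exists>p. in_cl M V p \<and> (\<forall>v\<in>V. ip M (\<lambda>x. f x - p x) v = 0)"
proof -
  have VS: "v \<in> SQ M" if "v \<in> V" for v using V that by (rule lin_sub_SQ)
  have V0: "(\<lambda>x. 0) \<in> V" and Vadd: "\<And>u v. u \<in> V \<Longrightarrow> v \<in> V \<Longrightarrow> (\<lambda>x. u x + v x) \<in> V"
    and Vsc: "\<And>c u. u \<in> V \<Longrightarrow> (\<lambda>x. c * u x) \<in> V"
    using V by (auto simp: lin_sub_def)
  define d where "d = (INF v\<in>V. nrm M (\<lambda>x. f x - v x))"
  have bdd: "bdd_below ((\<lambda>v. nrm M (\<lambda>x. f x - v x)) ` V)" by (auto intro!: bdd_belowI[of _ 0])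
  have d_le: "d \<le> nrm M (\<lambda>x. f x - v x)" if "v \<in> V" for v
    unfolding d_def using bdd that by (intro cINF_lower)
  have d0: "0 \<le> d" unfolding d_def using V0 by (intro cINF_greatest) auto
  have "\<exists>v\<in>V. nrm M (\<lambda>x. f x - v x) < d + 1 / Suc n" for n
  proof (rule ccontr)
    assume "\<not> ?thesis"
    then have "d + 1 / Suc n \<le> d" using V0 unfolding d_def by (intro cINF_greatest) (auto simp: not_less)
    then show False by simp
  qed
  then obtain v where v: "\<And>n. v n \<in> V" and vd: "\<And>n. nrm M (\<lambda>x. f x - v n x) < d + 1 / Suc n"
    by metis
  have par: "(nrm M (\<lambda>x. v m x - v n x))\<^sup>2 \<le> 4 * \<delta> * (2 * d + 1)"
    if \<delta>: "0 < \<delta>" "\<delta> \<le> 1" and m: "1 / Suc m \<le> \<delta>" and n: "1 / Suc n \<le> \<delta>" for m n \<delta>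
  proof -
    let ?a = "\<lambda>x. f x - v m x" and ?b = "\<lambda>x. f x - v n x"
    have S: "?a \<in> SQ M" "?b \<in> SQ M" using f VS v by (auto intro: sq_diff)
    have "(nrm M (\<lambda>x. ?a x - ?b x))\<^sup>2 = 2 * (nrm M ?a)\<^sup>2 + 2 * (nrm M ?b)\<^sup>2 - (nrm M (\<lambda>x. ?a x + ?b x))\<^sup>2"
      using nrm_add_square[OF S] nrm_diff_square[OF S] by simp
    moreover have "nrm M (\<lambda>x. ?a x - ?b x) = nrm M (\<lambda>x. v m x - v n x)"
      by simp (rule nrm_minus_commute)
    moreover have "2 * d \<le> nrm M (\<lambda>x. ?a x + ?b x)"
    proof -
      have "(\<lambda>x. 1/2 * (v m x + v n x)) \<in> V" using v by (intro Vsc Vadd)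
      from d_le[OF this] have "2 * d \<le> cmod 2 * nrm M (\<lambda>x. f x - 1/2 * (v m x + v n x))" by simp
      also have "\<dots> = nrm M (\<lambda>x. ?a x + ?b x)"
        by (subst nrm_scale[symmetric]) (simp add: algebra_simps)
      finally show ?thesis .
    qed
    then have "(2 * d)\<^sup>2 \<le> (nrm M (\<lambda>x. ?a x + ?b x))\<^sup>2" using d0 by (intro power_mono) auto
    moreover have "(nrm M ?a)\<^sup>2 \<le> (d + \<delta>)\<^sup>2" using vd[of m] m by (intro power_mono) auto
    moreover have "(nrm M ?b)\<^sup>2 \<le> (d + \<delta>)\<^sup>2" using vd[of n] n by (intro power_mono) auto
    ultimately have "(nrm M (\<lambda>x. v m x - v n x))\<^sup>2 \<le> 4 * (d + \<delta>)\<^sup>2 - (2 * d)\<^sup>2" by simp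
    also have "\<dots> = 4 * \<delta> * (2 * d + \<delta>)" by (simp add: power2_eq_square algebra_simps)
    also have "\<dots> \<le> 4 * \<delta> * (2 * d + 1)" using \<delta> by (intro mult_left_mono) auto
    finally show ?thesis .
  qed
  have "\<exists>p\<in>SQ M. (\<lambda>n. nrm M (\<lambda>x. v n x - p x)) \<longlonglongrightarrow> 0"
  proof (rule riesz_fischer[OF sf VS[OF v]])
    fix e :: real assume e: "0 < e"
    define \<delta> where "\<delta> = min 1 (e\<^sup>2 / (8 * (2 * d + 1)))"
    have \<delta>: "0 < \<delta>" "\<delta> \<le> 1" "\<delta> \<le> e\<^sup>2 / (8 * (2 * d + 1))" using e d0 by (auto simp: \<delta>_def)
    then have "4 * \<delta> * (2 * d + 1) \<le> e\<^sup>2 / 2" using d0 by (simp add: field_simps)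
    then have lt: "4 * \<delta> * (2 * d + 1) < e\<^sup>2"
      using zero_less_power[OF e, of 2] by linarith
    obtain K where K: "1 / Suc K < \<delta>" using \<delta>(1) by (metis nat_approx_posE)
    have K': "1 / Suc m \<le> \<delta>" if "m \<ge> K" for m
    proof -
      have "1 / Suc m \<le> 1 / Suc K" using that by (simp add: frac_le)
      then show ?thesis using K by simp
    qed
    have "nrm M (\<lambda>x. v m x - v n x) < e" if "m \<ge> K" "n \<ge> K" for m n
    proof (rule power2_less_imp_less)
      show "(nrm M (\<lambda>x. v m x - v n x))\<^sup>2 < e\<^sup>2"
        using par[OF \<delta>(1,2) K'[OF that(1)] K'[OF that(2)]] lt by simp
    qed (use e in simp)
    then show "\<exists>K. \<forall>m\<ge>K. \<forall>n\<ge>K. nrm M (\<lambda>x. v m x - v n x) < e" by blast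
  qed
  then obtain p where p: "p \<in> SQ M" and lim: "(\<lambda>n. nrm M (\<lambda>x. v n x - p x)) \<longlonglongrightarrow> 0" by blast
  have "in_cl M V p"
    unfolding in_cl_def
  proof (intro conjI p allI impI)
    fix e :: real assume "0 < e"
    then obtain n where "nrm M (\<lambda>x. v n x - p x) < e"
      using LIMSEQ_D[OF lim, of e] by auto
    then show "\<exists>v\<in>V. nrm M (\<lambda>x. p x - v x) < e"
      using v by (auto intro!: bexI[of _ "v n"] simp: nrm_minus_commute[of M p])
  qed
  moreover have "ip M (\<lambda>x. f x - p x) w = 0" if w: "w \<in> V" for w
  proof (rule orthogonal_of_minimal[OF sq_diff[OF f p] VS[OF w]])
    fix c
    have inv: "(\<lambda>n. 1 / real (Suc n)) \<longlonglongrightarrow> 0" by (rule LIMSEQ_Suc[OF lim_1_over_n])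
    have "nrm M (\<lambda>x. f x - p x) \<le> d"
    proof (rule LIMSEQ_le_const)
      show "(\<lambda>n. (d + 1 / Suc n) + nrm M (\<lambda>x. v n x - p x)) \<longlonglongrightarrow> d"
        using tendsto_add[OF tendsto_add[OF tendsto_const[of d] inv] lim] by simp
      show "\<exists>N. \<forall>n\<ge>N. nrm M (\<lambda>x. f x - p x) \<le> (d + 1 / Suc n) + nrm M (\<lambda>x. v n x - p x)"
        using nrm_triangle_sub[OF f VS[OF v] p] vd by (meson add_mono less_imp_le order_trans order_refl)
    qed
    moreover have "d \<le> nrm M (\<lambda>x. (f x - p x) - c * w x)"
    proof (rule LIMSEQ_le_const)
      show "(\<lambda>n. nrm M (\<lambda>x. (f x - p x) - c * w x) + nrm M (\<lambda>x. v n x - p x)) \<longlonglongrightarrow> nrm M (\<lambda>x. (f x - p x) - c * w x)"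
        using tendsto_add[OF tendsto_const lim] by simp
      have "d \<le> nrm M (\<lambda>x. (f x - p x) - c * w x) + nrm M (\<lambda>x. v n x - p x)" for n
      proof -
        have "d \<le> nrm M (\<lambda>x. f x - (v n x + c * w x))" using v w by (intro d_le Vadd Vsc)
        also have "\<dots> = nrm M (\<lambda>x. ((f x - p x) - c * w x) + (p x - v n x))" by (simp add: algebra_simps)
        also have "\<dots> \<le> nrm M (\<lambda>x. (f x - p x) - c * w x) + nrm M (\<lambda>x. p x - v n x)"
          using f p VS[OF w] VS[OF v] by (intro nrm_triangle sq_diff sq_scale)
        finally show ?thesis by (simp add: nrm_minus_commute[of M p])
      qed
      then show "\<exists>N. \<forall>n\<ge>N. d \<le> nrm M (\<lambda>x. (f x - p x) - c * w x) + nrm M (\<lambda>x. v n x - p x)" by blast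
    qed
    ultimately show "nrm M (\<lambda>x. f x - p x) \<le> nrm M (\<lambda>x. f x - p x - c * w x)" by simp
  qed
  ultimately show ?thesis by blast
qed


lemma in_cl_functional_zero:
  assumes p: "in_cl M V p" and V: "V \<subseteq> SQ M" and k: "k \<in> SQ M" and z: "\<And>v. v \<in> V \<Longrightarrow> ip M v k = 0"
  shows "ip M p k = 0"
proof -
  have pS: "p \<in> SQ M" using p by (simp add: in_cl_def)
  have "cmod (ip M p k) \<le> e" if e: "e > 0" for e
  proof -
    have "0 < e / (nrm M k + 1)" using e by (simp add: add_nonneg_pos)
    then obtain v where v: "v \<in> V" and lt: "nrm M (\<lambda>x. p x - v x) < e / (nrm M k + 1)"
      using p unfolding in_cl_def by blast
    have vS: "v \<in> SQ M" using v V by blast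
    have "ip M p k = ip M (\<lambda>x. p x - v x) k" using z[OF v] by (simp add: ip_diff_left pS vS k)
    then have "cmod (ip M p k) \<le> nrm M (\<lambda>x. p x - v x) * nrm M k"
      using cauchy_schwarz[OF sq_diff[OF pS vS] k] by simp
    also have "\<dots> \<le> e / (nrm M k + 1) * (nrm M k + 1)" using lt e by (intro mult_mono) auto
    also have "\<dots> = e" using nrm_nonneg[of M k] by (simp add: add_nonneg_eq_0_iff)
    finally show ?thesis .
  qed
  then have "cmod (ip M p k) \<le> 0" by (rule field_le_epsilon) simp
  then show ?thesis by simp
qed

text \<open>
  If the functional does not vanish, its kernel has a vector \<open>e\<close> orthogonal to it on which the
  functional is not zero, and the representing vector is a multiple of \<open>e\<close>.
\<close>

theorem riesz_representation:
  assumes sf: "sigma_finite_measure M"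
    and add: "\<And>f g. f \<in> SQ M \<Longrightarrow> g \<in> SQ M \<Longrightarrow> l (\<lambda>x. f x + g x) = l f + l g"
    and scale: "\<And>c f. f \<in> SQ M \<Longrightarrow> l (\<lambda>x. c * f x) = c * l f"
    and bound: "\<And>f. f \<in> SQ M \<Longrightarrow> cmod (l f) \<le> C * nrm M f"
  shows "\<exists>k\<in>SQ M. \<forall>f\<in>SQ M. l f = ip M f k"
proof -
  have diff: "l (\<lambda>x. f x - g x) = l f - l g" if "f \<in> SQ M" "g \<in> SQ M" for f g
    using add[OF that(1) sq_scale[OF that(2), of "-1"]] scale[OF that(2), of "-1"] by simp
  define V where "V = {f \<in> SQ M. l f = 0}"
  have l0: "l (\<lambda>x. 0) = 0" using scale[OF sq_zero, of 0] by simp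
  have V: "lin_sub M V"
    by (auto simp: lin_sub_def V_def sq_add sq_scale add scale l0)
  show ?thesis
  proof (cases "\<forall>f\<in>SQ M. l f = 0")
    case True
    then show ?thesis by (intro bexI[of _ "\<lambda>x. 0"]) (auto simp: ip_zero_right)
  next
    case False
    then obtain f0 where f0: "f0 \<in> SQ M" "l f0 \<noteq> 0" by blast
    obtain p where p: "in_cl M V p" and orth: "\<And>v. v \<in> V \<Longrightarrow> ip M (\<lambda>x. f0 x - p x) v = 0"
      using projection_exists[OF sf V f0(1)] by blast
    have pS: "p \<in> SQ M" using p by (simp add: in_cl_def)
    have "cmod (l p) \<le> e" if e: "e > 0" for e
    proof -
      have "0 < e / (\<bar>C\<bar> + 1)" using e by simp
      then obtain v where v: "v \<in> V" and lt: "nrm M (\<lambda>x. p x - v x) < e / (\<bar>C\<bar> + 1)"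
        using p unfolding in_cl_def by blast
      have vS: "v \<in> SQ M" using v by (simp add: V_def)
      have "l p = l (\<lambda>x. p x - v x)" using v by (simp add: diff pS vS V_def)
      then have "cmod (l p) \<le> C * nrm M (\<lambda>x. p x - v x)"
        using bound[OF sq_diff[OF pS vS]] by simp
      also have "\<dots> \<le> (\<bar>C\<bar> + 1) * (e / (\<bar>C\<bar> + 1))" using lt e by (intro mult_mono) auto
      also have "\<dots> = e" by (simp add: add_nonneg_eq_0_iff)
      finally show ?thesis .
    qed
    then have "cmod (l p) \<le> 0" by (rule field_le_epsilon) simp
    then have lp: "l p = 0" by simp
    define e where "e x = f0 x - p x" for x
    have eS: "e \<in> SQ M" using f0 pS by (simp add: e_def[abs_def] sq_diff)
    have le: "l e \<noteq> 0" using f0 lp by (simp add: e_def[abs_def] diff pS)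
    have ne: "nrm M e \<noteq> 0" using bound[OF eS] le by auto
    define k where "k x = cnj (l e) / of_real ((nrm M e)\<^sup>2) * e x" for x
    have "l f = ip M f k" if f: "f \<in> SQ M" for f
    proof -
      define w where "w x = f x - l f / l e * e x" for x
      have wS: "w \<in> SQ M" using f eS unfolding w_def[abs_def] by (intro sq_diff sq_scale)
      have "l w = l f - l f / l e * l e"
        unfolding w_def[abs_def] by (simp only: diff[OF f sq_scale[OF eS]] scale[OF eS])
      then have "w \<in> V" using wS le by (simp add: V_def)
      from orth[OF this] have "ip M w e = 0"
        using ip_commute[of M w e] by (simp add: e_def[abs_def])
      moreover have "ip M w e = ip M f e - l f / l e * of_real ((nrm M e)\<^sup>2)"
        using f eS unfolding w_def[abs_def] by (simp only: ip_diff_left[OF f sq_scale[OF eS] eS] ip_scale_left ip_self)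
      ultimately have "ip M f e = l f / l e * of_real ((nrm M e)\<^sup>2)" by simp
      moreover have "ip M f k = l e / of_real ((nrm M e)\<^sup>2) * ip M f e"
        unfolding k_def[abs_def] ip_scale_right by simp
      ultimately show ?thesis using le ne by simp
    qed
    moreover have "k \<in> SQ M" unfolding k_def[abs_def] by (rule sq_scale[OF eS])
    ultimately show ?thesis by blast
  qed
qed

text \<open>
  An operator acts on representatives, and linearity holds almost everywhere. Independence of the
  representative is a consequence of boundedness (\<open>aeop_cong\<close>).
\<close>

definition aeop :: "'a measure \<Rightarrow> 'b measure \<Rightarrow> (('a \<Rightarrow> complex) \<Rightarrow> 'b \<Rightarrow> complex) \<Rightarrow> bool" where
  "aeop M N R \<longleftrightarrow> (\<forall>f\<in>SQ M. R f \<in> SQ N) \<and>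
     (\<forall>f\<in>SQ M. \<forall>g\<in>SQ M. AE y in N. R (\<lambda>x. f x + g x) y = R f y + R g y) \<and>
     (\<forall>c. \<forall>f\<in>SQ M. AE y in N. R (\<lambda>x. c * f x) y = c * R f y) \<and>
     (\<exists>C. \<forall>f\<in>SQ M. nrm N (R f) \<le> C * nrm M f)"

lemma aeop_sq: "aeop M N R \<Longrightarrow> f \<in> SQ M \<Longrightarrow> R f \<in> SQ N"
  and aeop_add: "aeop M N R \<Longrightarrow> f \<in> SQ M \<Longrightarrow> g \<in> SQ M \<Longrightarrow> AE y in N. R (\<lambda>x. f x + g x) y = R f y + R g y"
  and aeop_scale: "aeop M N R \<Longrightarrow> f \<in> SQ M \<Longrightarrow> AE y in N. R (\<lambda>x. c * f x) y = c * R f y"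
  by (auto simp: aeop_def)

lemma aeop_meas: "aeop M N R \<Longrightarrow> f \<in> SQ M \<Longrightarrow> R f \<in> borel_measurable N"
  by (auto simp: aeop_def sq_integrable_def)

lemma aeop_bound:
  assumes "aeop M N R"
  obtains C where "C > 0" "\<And>f. f \<in> SQ M \<Longrightarrow> nrm N (R f) \<le> C * nrm M f"
proof -
  obtain C where C: "\<And>f. f \<in> SQ M \<Longrightarrow> nrm N (R f) \<le> C * nrm M f"
    using assms unfolding aeop_def by blast
  have "nrm N (R f) \<le> (\<bar>C\<bar> + 1) * nrm M f" if "f \<in> SQ M" for f
    using C[OF that] mult_right_mono[of C "\<bar>C\<bar> + 1" "nrm M f"] by force
  then show ?thesis using that[of "\<bar>C\<bar> + 1"] by auto
qed

lemma aeop_diff: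
  assumes R: "aeop M N R" and f: "f \<in> SQ M" and g: "g \<in> SQ M"
  shows "AE y in N. R (\<lambda>x. f x - g x) y = R f y - R g y"
  using aeop_add[OF R f sq_scale[OF g, of "-1"]] aeop_scale[OF R g, of "-1"]
  by eventually_elim simp

lemma aeop_zero: "aeop M N R \<Longrightarrow> AE y in N. R (\<lambda>x. 0) y = 0"
  using aeop_scale[of M N R "\<lambda>x. 0" 0] by simp

lemma aeop_cong:
  assumes R: "aeop M N R" and f: "f \<in> SQ M" and g: "g \<in> SQ M" and eq: "AE x in M. f x = g x"
  shows "AE y in N. R f y = R g y"
proof -
  obtain C where C: "C > 0" "\<And>f. f \<in> SQ M \<Longrightarrow> nrm N (R f) \<le> C * nrm M f" using aeop_bound[OF R] by blast
  have "nrm N (R (\<lambda>x. f x - g x)) \<le> C * nrm M (\<lambda>x. f x - g x)" by (intro C sq_diff f g)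
  also have "\<dots> = 0" using eq f g by (simp add: AE_eq_iff_nrm)
  finally have "nrm N (R (\<lambda>x. f x - g x)) = 0" using nrm_nonneg[of N] by (simp add: antisym)
  then have "AE y in N. R (\<lambda>x. f x - g x) y = 0" using aeop_sq[OF R sq_diff[OF f g]] by (simp add: nrm_eq_0_iff)
  then show ?thesis using aeop_diff[OF R f g] by eventually_elim simp
qed

lemma aeop_comp:
  assumes R: "aeop M N R" and S: "aeop N L S"
  shows "aeop M L (\<lambda>f. S (R f))"
  unfolding aeop_def
proof (intro conjI ballI allI)
  fix f assume f: "f \<in> SQ M"
  show "S (R f) \<in> SQ L" using R S f by (auto dest: aeop_sq)
  show "AE y in L. S (R (\<lambda>x. c * f x)) y = c * S (R f) y" for c
    using aeop_cong[OF S _ _ aeop_scale[OF R f, of c]] aeop_scale[OF S aeop_sq[OF R f], of c]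
    by (auto simp: aeop_sq[OF R] f sq_scale)
  fix g assume g: "g \<in> SQ M"
  show "AE y in L. S (R (\<lambda>x. f x + g x)) y = S (R f) y + S (R g) y"
    using aeop_cong[OF S _ _ aeop_add[OF R f g]] aeop_add[OF S aeop_sq[OF R f] aeop_sq[OF R g]]
    by (auto simp: aeop_sq[OF R] f g sq_add)
next
  obtain C where C: "C > 0" "\<And>f. f \<in> SQ M \<Longrightarrow> nrm N (R f) \<le> C * nrm M f" using aeop_bound[OF R] by blast
  obtain D where D: "D > 0" "\<And>f. f \<in> SQ N \<Longrightarrow> nrm L (S f) \<le> D * nrm N f" using aeop_bound[OF S] by blast
  have "nrm L (S (R f)) \<le> (D * C) * nrm M f" if f: "f \<in> SQ M" for f
    using D(2)[OF aeop_sq[OF R f]] mult_left_mono[OF C(2)[OF f], of D] D(1) unfolding mult.assoc by linarith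
  then show "\<exists>C. \<forall>f\<in>SQ M. nrm L (S (R f)) \<le> C * nrm M f" by blast
qed

lemma aeop_plus:
  assumes R: "aeop M N R" and S: "aeop M N S"
  shows "aeop M N (\<lambda>f y. R f y + S f y)"
  unfolding aeop_def
proof (intro conjI ballI allI)
  fix f assume f: "f \<in> SQ M"
  show "(\<lambda>y. R f y + S f y) \<in> SQ N" using R S f by (auto intro: sq_add dest: aeop_sq)
  show "AE y in N. R (\<lambda>x. c * f x) y + S (\<lambda>x. c * f x) y = c * (R f y + S f y)" for c
    using aeop_scale[OF R f, of c] aeop_scale[OF S f, of c] by eventually_elim (simp add: distrib_left)
  fix g assume g: "g \<in> SQ M"
  show "AE y in N. R (\<lambda>x. f x + g x) y + S (\<lambda>x. f x + g x) y = (R f y + S f y) + (R g y + S g y)"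
    using aeop_add[OF R f g] aeop_add[OF S f g] by eventually_elim simp
next
  obtain C where C: "C > 0" "\<And>f. f \<in> SQ M \<Longrightarrow> nrm N (R f) \<le> C * nrm M f" using aeop_bound[OF R] by blast
  obtain D where D: "D > 0" "\<And>f. f \<in> SQ M \<Longrightarrow> nrm N (S f) \<le> D * nrm M f" using aeop_bound[OF S] by blast
  have "nrm N (\<lambda>y. R f y + S f y) \<le> (C + D) * nrm M f" if f: "f \<in> SQ M" for f
    using nrm_triangle[OF aeop_sq[OF R f] aeop_sq[OF S f]] C(2)[OF f] D(2)[OF f] by (simp add: distrib_right)
  then show "\<exists>C. \<forall>f\<in>SQ M. nrm N (\<lambda>y. R f y + S f y) \<le> C * nrm M f" by blast
qed

lemma aeop_mult:
  assumes "\<phi> \<in> borel_measurable M" "AE x in M. cmod (\<phi> x) \<le> C"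
  shows "aeop M M (\<lambda>f x. \<phi> x * f x)"
  unfolding aeop_def
proof (intro conjI ballI allI)
  fix f assume f: "f \<in> SQ M"
  show "(\<lambda>x. \<phi> x * f x) \<in> SQ M" using f assms by (rule sq_mult)
next
  have "nrm M (\<lambda>x. \<phi> x * f x) \<le> max C 0 * nrm M f" if f: "f \<in> SQ M" for f
  proof (rule nrm_mono_AE[OF f])
    show "AE x in M. cmod (\<phi> x * f x) \<le> max C 0 * cmod (f x)"
      using assms(2) by eventually_elim (simp add: norm_mult mult_right_mono)
  qed (use assms f in \<open>auto simp: sq_integrable_def\<close>)
  then show "\<exists>C. \<forall>f\<in>SQ M. nrm M (\<lambda>x. \<phi> x * f x) \<le> C * nrm M f" by blast
qed (auto simp: algebra_simps)

lemma aeop_smult: "aeop M N R \<Longrightarrow> aeop M N (\<lambda>f y. c * R f y)"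
  using aeop_comp[of M N R N "\<lambda>f y. c * f y"] aeop_mult[of "\<lambda>_. c" N "cmod c"] by simp

lemma aeop_cut: "A \<in> sets M \<Longrightarrow> aeop M M (\<lambda>f x. indicator A x * f x)"
  by (rule aeop_mult[where C = 1]) (auto simp: indicator_def)

lemma aeop_const_zero: "aeop M N (\<lambda>f y. 0)"
  by (auto simp: aeop_def intro!: exI[of _ 0])

text \<open>
  Adjoints are handled as pairs, since an adjoint is determined only up to null sets.
\<close>

definition adjp :: "'a measure \<Rightarrow> 'b measure \<Rightarrow> (('a \<Rightarrow> complex) \<Rightarrow> 'b \<Rightarrow> complex) \<Rightarrow>
    (('b \<Rightarrow> complex) \<Rightarrow> 'a \<Rightarrow> complex) \<Rightarrow> bool" where
  "adjp M N R S \<longleftrightarrow> aeop M N R \<and> aeop N M S \<and> (\<forall>f\<in>SQ M. \<forall>g\<in>SQ N. ip N (R f) g = ip M f (S g))"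

lemma adjp_sym: "adjp M N R S \<Longrightarrow> adjp N M S R"
  unfolding adjp_def by (metis ip_commute)

lemma adjpD: "adjp M N R S \<Longrightarrow> f \<in> SQ M \<Longrightarrow> g \<in> SQ N \<Longrightarrow> ip N (R f) g = ip M f (S g)"
  and adjp_aeop: "adjp M N R S \<Longrightarrow> aeop M N R" and adjp_aeop': "adjp M N R S \<Longrightarrow> aeop N M S"
  by (auto simp: adjp_def)

lemma adjp_comp: "adjp M N R S \<Longrightarrow> adjp N L R' S' \<Longrightarrow> adjp M L (\<lambda>f. R' (R f)) (\<lambda>g. S (S' g))"
  unfolding adjp_def using aeop_comp[of M N R L R'] aeop_comp[of L N S' M S]
  by (auto simp: aeop_sq)

lemma adjp_mult:
  assumes "\<phi> \<in> borel_measurable M" "AE x in M. cmod (\<phi> x) \<le> C"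
  shows "adjp M M (\<lambda>f x. \<phi> x * f x) (\<lambda>f x. cnj (\<phi> x) * f x)"
  unfolding adjp_def using assms by (auto simp: ip_mult_move intro!: aeop_mult[where C = C])

lemma adjp_plus:
  assumes "adjp M N R S" "adjp M N R' S'"
  shows "adjp M N (\<lambda>f y. R f y + R' f y) (\<lambda>g x. S g x + S' g x)"
  using assms aeop_plus[of M N R R'] aeop_plus[of N M S S'] unfolding adjp_def
  by (auto simp: ip_add_left ip_add_right aeop_sq)

theorem adjoint_exists:
  assumes sf: "sigma_finite_measure M" and R: "aeop M N R"
  shows "\<exists>S. adjp M N R S"
proof -
  obtain C where C: "C > 0" "\<And>f. f \<in> SQ M \<Longrightarrow> nrm N (R f) \<le> C * nrm M f" using aeop_bound[OF R] by blast
  have "\<exists>k\<in>SQ M. \<forall>f\<in>SQ M. ip N (R f) g = ip M f k" if g: "g \<in> SQ N" for g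
  proof (rule riesz_representation[OF sf])
    fix f assume f: "f \<in> SQ M"
    have gm: "g \<in> borel_measurable N" using g by (simp add: sq_integrable_def)
    show "ip N (R (\<lambda>x. c * f x)) g = c * ip N (R f) g" for c
      unfolding ip_scale_left[symmetric]
      using aeop_scale[OF R f, of c] aeop_sq[OF R sq_scale[OF f, of c]] aeop_sq[OF R f] gm
      by (intro ip_cong_AE) (auto simp: sq_integrable_def)
    show "cmod (ip N (R f) g) \<le> (C * nrm N g) * nrm M f"
      using cauchy_schwarz[OF aeop_sq[OF R f] g] mult_right_mono[OF C(2)[OF f], of "nrm N g"]
      by (simp add: mult_ac)
    fix f' assume f': "f' \<in> SQ M"
    show "ip N (R (\<lambda>x. f x + f' x)) g = ip N (R f) g + ip N (R f') g"
      unfolding ip_add_left[OF aeop_sq[OF R f] aeop_sq[OF R f'] g, symmetric]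
      using aeop_add[OF R f f'] aeop_sq[OF R sq_add[OF f f']] aeop_sq[OF R f] aeop_sq[OF R f'] gm
      by (intro ip_cong_AE) (auto simp: sq_integrable_def)
  qed
  then obtain S where S: "\<And>g. g \<in> SQ N \<Longrightarrow> S g \<in> SQ M"
    and eq: "\<And>f g. g \<in> SQ N \<Longrightarrow> f \<in> SQ M \<Longrightarrow> ip N (R f) g = ip M f (S g)" by metis
  have eq': "ip M (S g) f = ip N g (R f)" if "g \<in> SQ N" "f \<in> SQ M" for f g
    using eq[OF that] by (metis ip_commute)
  have "aeop N M S"
    unfolding aeop_def
  proof (intro conjI ballI allI)
    fix g assume g: "g \<in> SQ N"
    show "S g \<in> SQ M" using g by (rule S)
    show "AE x in M. S (\<lambda>y. c * g y) x = c * S g x" for c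
      using g by (intro AE_eqI_ip S sq_scale) (auto simp: eq' ip_scale_left sq_scale)
    fix g' assume g': "g' \<in> SQ N"
    show "AE x in M. S (\<lambda>y. g y + g' y) x = S g x + S g' x"
      using g g' by (intro AE_eqI_ip S sq_add) (auto simp: eq' ip_add_left sq_add S aeop_sq[OF R])
  next
    have "nrm M (S g) \<le> C * nrm N g" if g: "g \<in> SQ N" for g
    proof (cases "nrm M (S g) = 0")
      case True then show ?thesis using C(1) by simp
    next
      case False
      have "(nrm M (S g))\<^sup>2 = cmod (ip M (S g) (S g))" unfolding ip_self norm_of_real by simp
      also have "\<dots> = cmod (ip N (R (S g)) g)" using eq[OF g S[OF g]] by simp
      also have "\<dots> \<le> nrm N (R (S g)) * nrm N g" by (intro cauchy_schwarz aeop_sq[OF R] S g)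
      also have "\<dots> \<le> C * nrm M (S g) * nrm N g" by (intro mult_right_mono C S g) auto
      finally have "nrm M (S g) * nrm M (S g) \<le> nrm M (S g) * (C * nrm N g)"
        by (simp add: power2_eq_square mult_ac)
      moreover have "0 < nrm M (S g)" using False nrm_nonneg[of M "S g"] by linarith
      ultimately show ?thesis by (simp only: mult_le_cancel_left_pos)
    qed
    then show "\<exists>C. \<forall>g\<in>SQ N. nrm M (S g) \<le> C * nrm N g" by blast
  qed
  then show ?thesis using R eq by (auto simp: adjp_def intro!: exI[of _ S])
qed

lemma in_cl_aeop:
  assumes R: "aeop M N R" and p: "in_cl M V p" and V: "V \<subseteq> SQ M"
    and im: "\<And>v. v \<in> V \<Longrightarrow> R v \<in> W"
  shows "in_cl N W (R p)"
  unfolding in_cl_def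
proof (intro conjI allI impI)
  have pS: "p \<in> SQ M" using p by (simp add: in_cl_def)
  then show "R p \<in> SQ N" by (rule aeop_sq[OF R])
  fix e :: real assume e: "0 < e"
  obtain C where C: "C > 0" "\<And>f. f \<in> SQ M \<Longrightarrow> nrm N (R f) \<le> C * nrm M f" using aeop_bound[OF R] by blast
  have "0 < e / C" using e C(1) by simp
  then obtain v where v: "v \<in> V" and lt: "nrm M (\<lambda>x. p x - v x) < e / C"
    using p unfolding in_cl_def by blast
  have vS: "v \<in> SQ M" using v V by blast
  have "nrm N (\<lambda>y. R p y - R v y) = nrm N (R (\<lambda>x. p x - v x))"
    using aeop_diff[OF R pS vS] aeop_sq[OF R sq_diff[OF pS vS]] aeop_sq[OF R pS] aeop_sq[OF R vS]
    by (intro nrm_cong_AE) (auto simp: sq_integrable_def)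
  also have "\<dots> \<le> C * nrm M (\<lambda>x. p x - v x)" by (intro C sq_diff pS vS)
  also have "\<dots> < e" using lt C(1) by (simp add: field_simps)
  finally show "\<exists>w\<in>W. nrm N (\<lambda>y. R p y - w y) < e" using im[OF v] by blast
qed

definition proj :: "'a measure \<Rightarrow> ('a \<Rightarrow> complex) set \<Rightarrow> ('a \<Rightarrow> complex) \<Rightarrow> 'a \<Rightarrow> complex" where
  "proj M V f = (SOME p. in_cl M V p \<and> (\<forall>v\<in>V. ip M (\<lambda>x. f x - p x) v = 0))"

context
  fixes M :: "'a measure" and V
  assumes sf: "sigma_finite_measure M" and V: "lin_sub M V"
begin

lemma proj_in_cl: "f \<in> SQ M \<Longrightarrow> in_cl M V (proj M V f)"
  and proj_orth: "f \<in> SQ M \<Longrightarrow> v \<in> V \<Longrightarrow> ip M (\<lambda>x. f x - proj M V f x) v = 0"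
  using someI_ex[OF projection_exists[OF sf V, of f]] by (auto simp: proj_def)

lemma proj_sq: "f \<in> SQ M \<Longrightarrow> proj M V f \<in> SQ M"
  using proj_in_cl by (auto simp: in_cl_def)

lemma V_sub: "V \<subseteq> SQ M" using V by (simp add: lin_sub_def)

lemma proj_orth_cl:
  assumes "f \<in> SQ M" "in_cl M V p" shows "ip M (\<lambda>x. f x - proj M V f x) p = 0"
proof -
  have "ip M p (\<lambda>x. f x - proj M V f x) = 0"
    by (rule in_cl_functional_zero[OF assms(2) V_sub])
      (use assms proj_orth proj_sq in \<open>auto intro: sq_diff simp: ip_commute[of M _ "\<lambda>x. f x - proj M V f x"]\<close>)
  then show ?thesis by (metis ip_commute complex_cnj_zero)
qed

lemma in_cl_diff:
  assumes p: "in_cl M V p" and q: "in_cl M V q" shows "in_cl M V (\<lambda>x. p x - q x)"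
  unfolding in_cl_def
proof (intro conjI allI impI)
  have S: "p \<in> SQ M" "q \<in> SQ M" using p q by (auto simp: in_cl_def)
  then show "(\<lambda>x. p x - q x) \<in> SQ M" by (rule sq_diff)
  fix e :: real assume "0 < e"
  then have e2: "0 < e/2" by simp
  obtain u where u: "u \<in> V" "nrm M (\<lambda>x. p x - u x) < e/2" using p e2 unfolding in_cl_def by blast
  obtain v where v: "v \<in> V" "nrm M (\<lambda>x. q x - v x) < e/2" using q e2 unfolding in_cl_def by blast
  have uvS: "u \<in> SQ M" "v \<in> SQ M" using u v V_sub by auto
  have "(\<lambda>x. u x + (-1) * v x) \<in> V" by (rule lin_sub_add[OF V u(1) lin_sub_scale[OF V v(1)]])
  moreover have "nrm M (\<lambda>x. p x - q x - (u x + (-1) * v x)) < e"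
  proof -
    have "nrm M (\<lambda>x. p x - q x - (u x + (-1) * v x)) = nrm M (\<lambda>x. (p x - u x) + (v x - q x))"
      by (simp add: algebra_simps)
    also have "\<dots> \<le> nrm M (\<lambda>x. p x - u x) + nrm M (\<lambda>x. v x - q x)"
      using S uvS by (intro nrm_triangle sq_diff)
    finally show ?thesis using u v by (simp add: nrm_minus_commute[of M v])
  qed
  ultimately show "\<exists>v\<in>V. nrm M (\<lambda>x. p x - q x - v x) < e"
    by (intro bexI[of _ "\<lambda>x. u x + (-1) * v x"])
qed

lemma proj_unique:
  assumes f: "f \<in> SQ M" and p: "in_cl M V p" and o: "\<And>v. v \<in> V \<Longrightarrow> ip M (\<lambda>x. f x - p x) v = 0"
  shows "AE x in M. proj M V f x = p x"
proof -
  let ?d = "\<lambda>x. proj M V f x - p x"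
  have pS: "p \<in> SQ M" using p by (simp add: in_cl_def)
  have d: "in_cl M V ?d" using proj_in_cl[OF f] p by (rule in_cl_diff)
  have dS: "?d \<in> SQ M" using d by (simp add: in_cl_def)
  have "ip M ?d v = 0" if v: "v \<in> V" for v
  proof -
    have "v \<in> SQ M" using v V_sub by auto
    then show ?thesis using o[OF v] proj_orth[OF f v] f pS proj_sq[OF f] by (simp add: ip_diff_left)
  qed
  then have "ip M ?d ?d = 0"
    using in_cl_functional_zero[OF d V_sub dS] by (metis ip_commute complex_cnj_zero)
  then have "nrm M ?d = 0" by (simp add: ip_self)
  then show ?thesis using AE_eq_iff_nrm[OF proj_sq[OF f] pS] by simp
qed

lemma proj_fix: "in_cl M V p \<Longrightarrow> AE x in M. proj M V p x = p x"
  by (rule proj_unique) (auto simp: in_cl_def ip_zero_left)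

lemma proj_commutes:
  assumes A: "adjp M M A A'" and inv: "\<And>v. v \<in> V \<Longrightarrow> A v \<in> V" and inv': "\<And>v. v \<in> V \<Longrightarrow> A' v \<in> V" and f: "f \<in> SQ M"
  shows "AE x in M. proj M V (A f) x = A (proj M V f) x"
proof (rule proj_unique)
  have op: "aeop M M A" using A by (rule adjp_aeop)
  show "A f \<in> SQ M" using op f by (rule aeop_sq)
  show "in_cl M V (A (proj M V f))" by (rule in_cl_aeop[OF op proj_in_cl[OF f] V_sub inv])
  fix v assume v: "v \<in> V"
  have vS: "v \<in> SQ M" using v V_sub by auto
  have "ip M (\<lambda>x. A f x - A (proj M V f) x) v = ip M (\<lambda>x. f x - proj M V f x) (A' v)"
    using A vS f proj_sq[OF f]
    by (simp add: ip_diff_left aeop_sq[OF op] aeop_sq[OF adjp_aeop'[OF A]] adjpD[OF A])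
  also have "\<dots> = 0" by (intro proj_orth f inv' v)
  finally show "ip M (\<lambda>x. A f x - A (proj M V f) x) v = 0" .
qed

lemma in_cl_add:
  assumes p: "in_cl M V p" and q: "in_cl M V q" shows "in_cl M V (\<lambda>x. p x + q x)"
proof -
  have "in_cl M V (\<lambda>x. 0 - q x)"
    by (rule in_cl_diff[OF in_cl_subset[OF V_sub lin_sub_zero[OF V]] q])
  from in_cl_diff[OF p this] show ?thesis by simp
qed

lemma in_cl_scale:
  assumes p: "in_cl M V p" shows "in_cl M V (\<lambda>x. c * p x)"
proof (rule in_cl_aeop[where R = "\<lambda>f x. c * f x", OF _ p V_sub])
  show "aeop M M (\<lambda>f x. c * f x)" by (rule aeop_mult[where C = "cmod c"]) auto
qed (rule lin_sub_scale[OF V])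

lemma proj_scale:
  assumes f: "f \<in> SQ M" shows "AE y in M. proj M V (\<lambda>x. c * f x) y = c * proj M V f y"
proof (rule proj_unique[OF sq_scale[OF f] in_cl_scale[OF proj_in_cl[OF f]]])
  fix v assume v: "v \<in> V"
  have "ip M (\<lambda>x. c * (f x - proj M V f x)) v = 0"
    using proj_orth[OF f v] by (simp only: ip_scale_left mult_zero_right)
  then show "ip M (\<lambda>x. c * f x - c * proj M V f x) v = 0" by (simp add: right_diff_distrib)
qed

lemma proj_add:
  assumes f: "f \<in> SQ M" and g: "g \<in> SQ M"
  shows "AE y in M. proj M V (\<lambda>x. f x + g x) y = proj M V f y + proj M V g y"
proof (rule proj_unique[OF sq_add[OF f g] in_cl_add[OF proj_in_cl[OF f] proj_in_cl[OF g]]])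
  fix v assume v: "v \<in> V"
  have vS: "v \<in> SQ M" using v V_sub by auto
  have "ip M (\<lambda>x. (f x - proj M V f x) + (g x - proj M V g x)) v = 0"
    by (simp only: ip_add_left[OF sq_diff[OF f proj_sq[OF f]] sq_diff[OF g proj_sq[OF g]] vS]
        proj_orth[OF f v] proj_orth[OF g v] add_0_left)
  then show "ip M (\<lambda>x. f x + g x - (proj M V f x + proj M V g x)) v = 0" by (simp add: algebra_simps)
qed

lemma proj_contraction:
  assumes f: "f \<in> SQ M" shows "nrm M (proj M V f) \<le> nrm M f"
proof (rule power2_le_imp_le)
  let ?p = "proj M V f"
  have "ip M (\<lambda>x. f x - ?p x) ?p = 0" by (rule proj_orth_cl[OF f proj_in_cl[OF f]])
  then have "(nrm M (\<lambda>x. (f x - ?p x) + ?p x))\<^sup>2 = (nrm M (\<lambda>x. f x - ?p x))\<^sup>2 + (nrm M ?p)\<^sup>2"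
    by (simp only: nrm_add_square[OF sq_diff[OF f proj_sq[OF f]] proj_sq[OF f]]) simp
  then have "(nrm M f)\<^sup>2 = (nrm M (\<lambda>x. f x - ?p x))\<^sup>2 + (nrm M ?p)\<^sup>2" by simp
  then show "(nrm M ?p)\<^sup>2 \<le> (nrm M f)\<^sup>2" by simp
qed simp

lemma aeop_proj: "aeop M M (proj M V)"
  unfolding aeop_def
proof (intro conjI ballI allI)
  show "\<exists>C. \<forall>f\<in>SQ M. nrm M (proj M V f) \<le> C * nrm M f"
    using proj_contraction by (intro exI[of _ 1]) simp
qed (rule proj_sq proj_scale proj_add; assumption)+

end

section \<open>Sequences of square integrable functions\<close>

text \<open>
  The space \<open>\<ell>\<^sup>2(L\<^sup>2(M))\<close> is realized as the \<open>L\<^sup>2\<close> space of a product measure, so that completeness,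
  projections and adjoints apply to it without change. The sequence index is the first
  component.
\<close>

definition seq_meas :: "'a measure \<Rightarrow> (nat \<times> 'a) measure" where
  "seq_meas M = count_space UNIV \<Otimes>\<^sub>M M"

definition slice :: "(nat \<times> 'a \<Rightarrow> complex) \<Rightarrow> nat \<Rightarrow> 'a \<Rightarrow> complex" where
  "slice F n = (\<lambda>x. F (n, x))"

definition amp :: "(('a \<Rightarrow> complex) \<Rightarrow> 'b \<Rightarrow> complex) \<Rightarrow> (nat \<times> 'a \<Rightarrow> complex) \<Rightarrow> nat \<times> 'b \<Rightarrow> complex" where
  "amp R F = (\<lambda>(n, y). R (slice F n) y)"

lemma slice_amp [simp]: "slice (amp R F) n = R (slice F n)"
  by (simp add: slice_def amp_def)

definition tens :: "('a \<Rightarrow> complex) \<Rightarrow> nat \<Rightarrow> nat \<times> 'a \<Rightarrow> complex" where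
  "tens f j = (\<lambda>(n, x). if n = j then f x else 0)"

lemma slice_tens: "slice (tens f j) n = (if n = j then f else (\<lambda>x. 0))"
  by (auto simp: slice_def tens_def)

lemma slice_add: "slice (\<lambda>z. F z + G z) n = (\<lambda>x. slice F n x + slice G n x)"
  and slice_diff: "slice (\<lambda>z. F z - G z) n = (\<lambda>x. slice F n x - slice G n x)"
  and slice_scale: "slice (\<lambda>z. c * F z) n = (\<lambda>x. c * slice F n x)"
  by (simp_all add: slice_def)

lemma slice_const [simp]: "slice (\<lambda>z. c) n = (\<lambda>x. c)"
  by (simp add: slice_def)

lemma amp_comp: "amp R (amp S F) = amp (\<lambda>f. R (S f)) F"
  by (simp add: amp_def slice_def)

lemma sigma_finite_seq_meas:
  assumes "sigma_finite_measure M" shows "sigma_finite_measure (seq_meas M)"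
  unfolding seq_meas_def
  by (rule sigma_finite_pair_measure[OF _ assms]) (auto intro: sigma_finite_measure_count_space_countable)

lemma measurable_seq_meas_iff:
  "F \<in> measurable (seq_meas M) L \<longleftrightarrow> (\<forall>n. (\<lambda>x. F (n, x)) \<in> measurable M L)"
proof
  assume F: "F \<in> measurable (seq_meas M) L"
  show "\<forall>n. (\<lambda>x. F (n, x)) \<in> measurable M L"
    using F unfolding seq_meas_def by (auto intro!: measurable_compose[OF _ F] simp: seq_meas_def)
next
  assume "\<forall>n. (\<lambda>x. F (n, x)) \<in> measurable M L"
  then show "F \<in> measurable (seq_meas M) L"
    unfolding seq_meas_def by (intro measurable_pair_measure_countable1) auto
qed

context
  fixes M :: "'a measure" assumes sf: "sigma_finite_measure M"
begin

lemma nn_integral_seq_meas: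
  assumes "F \<in> borel_measurable (seq_meas M)"
  shows "(\<integral>\<^sup>+z. F z \<partial>seq_meas M) = (\<Sum>n. \<integral>\<^sup>+x. F (n, x) \<partial>M)"
  using sigma_finite_measure.nn_integral_fst[OF sf, of F "count_space UNIV"] assms
  by (simp add: seq_meas_def nn_integral_count_space_nat)

lemma sq_seq_iff:
  "F \<in> SQ (seq_meas M) \<longleftrightarrow> (\<forall>n. slice F n \<in> SQ M) \<and> summable (\<lambda>n. (nrm M (slice F n))\<^sup>2)"
  (is "?l \<longleftrightarrow> ?r")
proof
  assume F: ?l
  then have m: "F \<in> borel_measurable (seq_meas M)" by (simp add: sq_integrable_def)
  then have ms: "slice F n \<in> borel_measurable M" for n by (simp add: measurable_seq_meas_iff slice_def)
  have "(\<integral>\<^sup>+z. ennreal ((cmod (F z))\<^sup>2) \<partial>seq_meas M) = (\<Sum>n. \<integral>\<^sup>+x. ennreal ((cmod (slice F n x))\<^sup>2) \<partial>M)"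
    unfolding slice_def by (rule nn_integral_seq_meas) (use m in measurable)
  then have fin: "(\<Sum>n. \<integral>\<^sup>+x. ennreal ((cmod (slice F n x))\<^sup>2) \<partial>M) < \<infinity>"
    using F by (simp add: sq_iff_nn_integral[OF m])
  have S: "slice F n \<in> SQ M" for n
    using fin ennreal_suminf_lessD[OF fin[unfolded infinity_ennreal_def], of n] by (simp add: sq_iff_nn_integral[OF ms])
  moreover have "summable (\<lambda>n. (nrm M (slice F n))\<^sup>2)"
    using fin by (intro summable_suminf_not_top) (auto simp: nrm_eq_nn_integral S)
  ultimately show ?r by simp
next
  assume r: ?r
  have m: "F \<in> borel_measurable (seq_meas M)"
    using r by (auto simp: measurable_seq_meas_iff slice_def sq_integrable_def)
  have "(\<integral>\<^sup>+z. ennreal ((cmod (F z))\<^sup>2) \<partial>seq_meas M) = (\<Sum>n. \<integral>\<^sup>+x. ennreal ((cmod (slice F n x))\<^sup>2) \<partial>M)"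
    unfolding slice_def by (rule nn_integral_seq_meas) (use m in measurable)
  also have "\<dots> = (\<Sum>n. ennreal ((nrm M (slice F n))\<^sup>2))" using r by (simp add: nrm_eq_nn_integral)
  also have "\<dots> = ennreal (\<Sum>n. (nrm M (slice F n))\<^sup>2)" using r by (intro suminf_ennreal2) auto
  finally show ?l by (simp add: sq_iff_nn_integral[OF m])
qed

lemma sq_slice: "F \<in> SQ (seq_meas M) \<Longrightarrow> slice F n \<in> SQ M"
  by (simp add: sq_seq_iff)

lemma ip_seq_sums:
  assumes F: "F \<in> SQ (seq_meas M)" and G: "G \<in> SQ (seq_meas M)"
  shows "(\<lambda>n. ip M (slice F n) (slice G n)) sums ip (seq_meas M) F G"
proof -
  interpret M: sigma_finite_measure M by fact
  interpret pair_sigma_finite "count_space (UNIV :: nat set)" M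
    by (intro pair_sigma_finite.intro sf sigma_finite_measure_count_space_countable) simp
  have int: "integrable (count_space UNIV \<Otimes>\<^sub>M M) (\<lambda>z. F z * cnj (G z))"
    using integrable_ip[OF F G] by (simp add: seq_meas_def)
  have "ip (seq_meas M) F G = (\<integral>n. ip M (slice F n) (slice G n) \<partial>count_space UNIV)"
    unfolding ip_def slice_def seq_meas_def using integral_fst'[OF int] by simp
  moreover have "integrable (count_space UNIV) (\<lambda>n. ip M (slice F n) (slice G n))"
    unfolding ip_def slice_def using integrable_fst'[OF int] by simp
  ultimately show ?thesis using sums_integral_count_space_nat by metis
qed

lemma nrm_seq_sums:
  assumes F: "F \<in> SQ (seq_meas M)"
  shows "(\<lambda>n. (nrm M (slice F n))\<^sup>2) sums (nrm (seq_meas M) F)\<^sup>2"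
  using ip_seq_sums[OF F F] unfolding ip_self by (simp only: sums_of_real_iff)

lemma AE_seq_eq_iff:
  assumes F: "F \<in> SQ (seq_meas M)" and G: "G \<in> SQ (seq_meas M)"
  shows "(AE z in seq_meas M. F z = G z) \<longleftrightarrow> (\<forall>n. AE x in M. slice F n x = slice G n x)"
proof -
  let ?D = "\<lambda>z. F z - G z"
  have D: "?D \<in> SQ (seq_meas M)" using F G by (rule sq_diff)
  have s: "(nrm M (slice ?D n))\<^sup>2 = 0 \<longleftrightarrow> (AE x in M. slice F n x = slice G n x)" for n
    using AE_eq_iff_nrm[OF sq_slice[OF F] sq_slice[OF G], of n] by (simp add: slice_diff)
  have "(AE z in seq_meas M. F z = G z) \<longleftrightarrow> (nrm (seq_meas M) ?D)\<^sup>2 = 0"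
    by (simp add: AE_eq_iff_nrm[OF F G])
  also have "\<dots> \<longleftrightarrow> (\<forall>n. (nrm M (slice ?D n))\<^sup>2 = 0)"
    using suminf_eq_zero_iff[OF sums_summable[OF nrm_seq_sums[OF D]]] sums_unique[OF nrm_seq_sums[OF D]] by simp
  finally show ?thesis using s by blast
qed

lemma tens_sums: "(\<lambda>n. (nrm M (slice (tens f j) n))\<^sup>2) sums (nrm M f)\<^sup>2"
proof -
  have "(nrm M (slice (tens f j) n))\<^sup>2 = (if n = j then (nrm M f)\<^sup>2 else 0)" for n
    by (simp add: slice_tens)
  then show ?thesis using sums_If_finite[of "\<lambda>n. n = j" "\<lambda>n. (nrm M f)\<^sup>2"] by simp
qed

lemma sq_tens: "f \<in> SQ M \<Longrightarrow> tens f j \<in> SQ (seq_meas M)"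
  using sums_summable[OF tens_sums] by (auto simp: sq_seq_iff slice_tens)

lemma nrm_tens: "f \<in> SQ M \<Longrightarrow> nrm (seq_meas M) (tens f j) = nrm M f"
  using sums_unique2[OF nrm_seq_sums[OF sq_tens] tens_sums, of f j] by simp

end

lemma aeop_amp:
  assumes sfM: "sigma_finite_measure M" and sfN: "sigma_finite_measure N" and R: "aeop M N R"
  shows "aeop (seq_meas M) (seq_meas N) (amp R)"
proof -
  obtain C where C: "C > 0" "\<And>f. f \<in> SQ M \<Longrightarrow> nrm N (R f) \<le> C * nrm M f" using aeop_bound[OF R] by blast
  have le: "(nrm N (slice (amp R F) n))\<^sup>2 \<le> C\<^sup>2 * (nrm M (slice F n))\<^sup>2" if "F \<in> SQ (seq_meas M)" for F n
    using power_mono[OF C(2)[OF sq_slice[OF sfM that, of n]], of 2] by (simp add: power_mult_distrib)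
  have S: "amp R F \<in> SQ (seq_meas N)" if F: "F \<in> SQ (seq_meas M)" for F
    unfolding sq_seq_iff[OF sfN]
  proof
    show "\<forall>n. slice (amp R F) n \<in> SQ N" using sq_slice[OF sfM F] aeop_sq[OF R] by simp
    show "summable (\<lambda>n. (nrm N (slice (amp R F) n))\<^sup>2)"
    proof (rule summable_comparison_test)
      show "summable (\<lambda>n. C\<^sup>2 * (nrm M (slice F n))\<^sup>2)"
        using sums_summable[OF nrm_seq_sums[OF sfM F]] by (rule summable_mult)
      show "\<exists>N0. \<forall>n\<ge>N0. norm ((nrm N (slice (amp R F) n))\<^sup>2) \<le> C\<^sup>2 * (nrm M (slice F n))\<^sup>2"
        using le[OF F] by simp
    qed
  qed
  show ?thesis
    unfolding aeop_def
  proof (intro conjI ballI allI)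
    fix F assume F: "F \<in> SQ (seq_meas M)"
    show "amp R F \<in> SQ (seq_meas N)" using F by (rule S)
    show "AE z in seq_meas N. amp R (\<lambda>x. c * F x) z = c * amp R F z" for c
      unfolding AE_seq_eq_iff[OF sfN S[OF sq_scale[OF F]] sq_scale[OF S[OF F]]]
      using aeop_scale[OF R sq_slice[OF sfM F]] by (simp add: slice_scale)
    fix G assume G: "G \<in> SQ (seq_meas M)"
    show "AE z in seq_meas N. amp R (\<lambda>x. F x + G x) z = amp R F z + amp R G z"
      unfolding AE_seq_eq_iff[OF sfN S[OF sq_add[OF F G]] sq_add[OF S[OF F] S[OF G]]]
      using aeop_add[OF R sq_slice[OF sfM F] sq_slice[OF sfM G]] by (simp add: slice_add)
  next
    have "nrm (seq_meas N) (amp R F) \<le> C * nrm (seq_meas M) F" if F: "F \<in> SQ (seq_meas M)" for F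
    proof (rule power2_le_imp_le)
      have "(nrm (seq_meas N) (amp R F))\<^sup>2 \<le> C\<^sup>2 * (nrm (seq_meas M) F)\<^sup>2"
        by (rule sums_le[OF le[OF F] nrm_seq_sums[OF sfN S[OF F]] sums_mult[OF nrm_seq_sums[OF sfM F]]])
      then show "(nrm (seq_meas N) (amp R F))\<^sup>2 \<le> (C * nrm (seq_meas M) F)\<^sup>2" by (simp add: power_mult_distrib)
    qed (use C(1) in simp)
    then show "\<exists>C. \<forall>F\<in>SQ (seq_meas M). nrm (seq_meas N) (amp R F) \<le> C * nrm (seq_meas M) F" by blast
  qed
qed

lemma adjp_amp:
  assumes sfM: "sigma_finite_measure M" and sfN: "sigma_finite_measure N" and R: "adjp M N R S"
  shows "adjp (seq_meas M) (seq_meas N) (amp R) (amp S)"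
  unfolding adjp_def
proof (intro conjI ballI)
  show opR: "aeop (seq_meas M) (seq_meas N) (amp R)" by (rule aeop_amp[OF sfM sfN adjp_aeop[OF R]])
  show opS: "aeop (seq_meas N) (seq_meas M) (amp S)" by (rule aeop_amp[OF sfN sfM adjp_aeop'[OF R]])
  fix F G assume F: "F \<in> SQ (seq_meas M)" and G: "G \<in> SQ (seq_meas N)"
  have "ip N (slice (amp R F) n) (slice G n) = ip M (slice F n) (slice (amp S G) n)" for n
    using adjpD[OF R sq_slice[OF sfM F] sq_slice[OF sfN G]] by simp
  then show "ip (seq_meas N) (amp R F) G = ip (seq_meas M) F (amp S G)"
    using ip_seq_sums[OF sfN aeop_sq[OF opR F] G] ip_seq_sums[OF sfM F aeop_sq[OF opS G]] sums_unique2
    by auto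
qed

text \<open>
  Sequences with finitely many nonzero entries are sums of such tensors, and they are dense.
\<close>

lemma aeop_eq_on_tensors:
  assumes sf: "sigma_finite_measure M" and R: "aeop (seq_meas M) L R" and S: "aeop (seq_meas M) L S"
    and eq: "\<And>f j. f \<in> SQ M \<Longrightarrow> AE y in L. R (tens f j) y = S (tens f j) y"
    and F: "F \<in> SQ (seq_meas M)"
  shows "AE y in L. R F y = S F y"
proof -
  define cut where "cut n = (\<lambda>(k, x). if k < n then F (k, x) else 0)" for n :: nat
  have slice_cut: "slice (cut n) k = (if k < n then slice F k else (\<lambda>x. 0))" for n k
    by (auto simp: cut_def slice_def)
  have cutS: "cut n \<in> SQ (seq_meas M)" for n
    unfolding sq_seq_iff[OF sf] slice_cut
  proof
    show "\<forall>k. (if k < n then slice F k else (\<lambda>x. 0)) \<in> SQ M" using sq_slice[OF sf F] by simp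
    show "summable (\<lambda>k. (nrm M (if k < n then slice F k else (\<lambda>x. 0)))\<^sup>2)"
      by (rule summable_finite[of "{..<n}"]) auto
  qed
  have cut_Suc: "cut (Suc n) = (\<lambda>z. cut n z + tens (slice F n) n z)" for n
    by (auto simp: cut_def tens_def slice_def fun_eq_iff less_Suc_eq)
  have eq_cut: "AE y in L. R (cut n) y = S (cut n) y" for n
  proof (induction n)
    case 0
    have "cut 0 = (\<lambda>z. 0)" by (auto simp: cut_def)
    then show ?case using aeop_zero[OF R] aeop_zero[OF S] by auto
  next
    case (Suc n)
    have T: "tens (slice F n) n \<in> SQ (seq_meas M)" by (intro sq_tens sf sq_slice F)
    show ?case
      unfolding cut_Suc using Suc aeop_add[OF R cutS[of n] T] aeop_add[OF S cutS[of n] T] eq[OF sq_slice[OF sf F, of n], of n]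
      by eventually_elim simp
  qed
  have lim: "(\<lambda>n. nrm (seq_meas M) (\<lambda>z. F z - cut n z)) \<longlonglongrightarrow> 0"
  proof -
    have "(nrm (seq_meas M) (\<lambda>z. F z - cut n z))\<^sup>2 = (\<Sum>k. (nrm M (slice F (k + n)))\<^sup>2)" for n
    proof -
      have "(\<lambda>k. (nrm M (slice (\<lambda>z. F z - cut n z) k))\<^sup>2) sums (nrm (seq_meas M) (\<lambda>z. F z - cut n z))\<^sup>2"
        by (intro nrm_seq_sums sf sq_diff F cutS)
      then have "(\<lambda>k. (nrm M (slice (\<lambda>z. F z - cut n z) (k + n)))\<^sup>2) sums (nrm (seq_meas M) (\<lambda>z. F z - cut n z))\<^sup>2"
        by (subst sums_iff_shift) (simp add: slice_diff slice_cut)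
      then show ?thesis by (simp add: slice_diff slice_cut sums_unique)
    qed
    moreover have "(\<lambda>n. \<Sum>k. (nrm M (slice F (k + n)))\<^sup>2) \<longlonglongrightarrow> 0"
      by (rule suminf_exist_split2[OF sums_summable[OF nrm_seq_sums[OF sf F]]])
    ultimately have "(\<lambda>n. (nrm (seq_meas M) (\<lambda>z. F z - cut n z))\<^sup>2) \<longlonglongrightarrow> 0" by simp
    from tendsto_real_sqrt[OF this] show ?thesis by simp
  qed
  obtain C where C: "C > 0" "\<And>f. f \<in> SQ (seq_meas M) \<Longrightarrow> nrm L (R f) \<le> C * nrm (seq_meas M) f"
    using aeop_bound[OF R] by blast
  obtain D where D: "D > 0" "\<And>f. f \<in> SQ (seq_meas M) \<Longrightarrow> nrm L (S f) \<le> D * nrm (seq_meas M) f"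
    using aeop_bound[OF S] by blast
  have "nrm L (\<lambda>y. R F y - S F y) \<le> (C + D) * nrm (seq_meas M) (\<lambda>z. F z - cut n z)" for n
  proof -
    let ?d = "\<lambda>z. F z - cut n z"
    have d: "?d \<in> SQ (seq_meas M)" by (intro sq_diff F cutS)
    have "nrm L (\<lambda>y. R F y - S F y) = nrm L (\<lambda>y. R ?d y - S ?d y)"
    proof (rule nrm_cong_AE)
      show "AE y in L. R F y - S F y = R ?d y - S ?d y"
        using aeop_diff[OF R F cutS[of n]] aeop_diff[OF S F cutS[of n]] eq_cut[of n] by eventually_elim simp
    qed (use aeop_meas[OF R F] aeop_meas[OF S F] aeop_meas[OF R d] aeop_meas[OF S d] in auto)
    also have "\<dots> \<le> nrm L (R ?d) + nrm L (S ?d)"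
    proof -
      have "nrm L (\<lambda>y. R ?d y + (-1) * S ?d y) \<le> nrm L (R ?d) + nrm L (\<lambda>y. (-1) * S ?d y)"
        by (intro nrm_triangle sq_scale aeop_sq[OF R] aeop_sq[OF S] d)
      then show ?thesis unfolding nrm_scale by simp
    qed
    also have "\<dots> \<le> (C + D) * nrm (seq_meas M) ?d"
      using C(2)[OF d] D(2)[OF d] by (simp add: distrib_right)
    finally show ?thesis .
  qed
  moreover have "(\<lambda>n. (C + D) * nrm (seq_meas M) (\<lambda>z. F z - cut n z)) \<longlonglongrightarrow> 0"
    using tendsto_mult_left[OF lim, of "C + D"] by simp
  ultimately have "nrm L (\<lambda>y. R F y - S F y) \<le> 0" by (intro LIMSEQ_le_const) auto
  then have "nrm L (\<lambda>y. R F y - S F y) = 0" using nrm_nonneg[of L] by (intro antisym) auto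
  then show ?thesis using AE_eq_iff_nrm[OF aeop_sq[OF R F] aeop_sq[OF S F]] by simp
qed

section \<open>Operators commuting with multiplications\<close>

definition commutes_mult :: "'a measure \<Rightarrow> (('a \<Rightarrow> complex) \<Rightarrow> 'a \<Rightarrow> complex) \<Rightarrow> ('a \<Rightarrow> complex) \<Rightarrow> bool" where
  "commutes_mult M A \<phi> \<longleftrightarrow> (\<forall>f\<in>SQ M. AE x in M. A (\<lambda>x. \<phi> x * f x) x = \<phi> x * A f x)"

definition bmult :: "'a measure \<Rightarrow> ('a \<Rightarrow> complex) \<Rightarrow> bool" where
  "bmult M \<phi> \<longleftrightarrow> \<phi> \<in> borel_measurable M \<and> (\<exists>C. \<forall>x. cmod (\<phi> x) \<le> C)"

lemma bmult_measurable: "bmult M \<phi> \<Longrightarrow> \<phi> \<in> borel_measurable M"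
  by (simp add: bmult_def)

lemma sq_bmult: "bmult M \<phi> \<Longrightarrow> f \<in> SQ M \<Longrightarrow> (\<lambda>x. \<phi> x * f x) \<in> SQ M"
  unfolding bmult_def by (elim conjE exE) (rule sq_mult, auto)

lemma adjp_bmult: "bmult M \<phi> \<Longrightarrow> adjp M M (\<lambda>f x. \<phi> x * f x) (\<lambda>f x. cnj (\<phi> x) * f x)"
  unfolding bmult_def by (elim conjE exE) (rule adjp_mult, auto)

lemma aeop_bmult: "bmult M \<phi> \<Longrightarrow> aeop M M (\<lambda>f x. \<phi> x * f x)"
  using adjp_bmult adjp_aeop by blast

lemma bmult_cnj: "bmult M \<phi> \<Longrightarrow> bmult M (\<lambda>x. cnj (\<phi> x))"
  by (auto simp: bmult_def)

lemma bmult_const [simp]: "bmult M (\<lambda>x. c)"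
  by (auto simp: bmult_def)

lemma bmult_indicator: "A \<in> sets M \<Longrightarrow> bmult M (indicator A)"
  by (auto simp: bmult_def indicator_def intro!: exI[of _ 1])

lemma bmult_mult:
  assumes "bmult M \<phi>" "bmult M \<psi>" shows "bmult M (\<lambda>x. \<phi> x * \<psi> x)"
proof -
  obtain C D where "\<forall>x. cmod (\<phi> x) \<le> C" "\<forall>x. cmod (\<psi> x) \<le> D" using assms by (auto simp: bmult_def)
  then have "cmod (\<phi> x * \<psi> x) \<le> C * D" for x
    by (simp add: norm_mult) (meson mult_mono norm_ge_zero order_trans)
  then show ?thesis using assms by (auto simp: bmult_def)
qed

lemma bmult_add:
  assumes "bmult M \<phi>" "bmult M \<psi>" shows "bmult M (\<lambda>x. \<phi> x + \<psi> x)"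
proof -
  obtain C D where "\<forall>x. cmod (\<phi> x) \<le> C" "\<forall>x. cmod (\<psi> x) \<le> D" using assms by (auto simp: bmult_def)
  then have "cmod (\<phi> x + \<psi> x) \<le> C + D" for x by (meson norm_triangle_mono)
  then show ?thesis using assms by (auto simp: bmult_def)
qed

lemma commutes_multD: "commutes_mult M A \<phi> \<Longrightarrow> f \<in> SQ M \<Longrightarrow> AE x in M. A (\<lambda>x. \<phi> x * f x) x = \<phi> x * A f x"
  by (simp add: commutes_mult_def)

lemma commutes_const: "aeop M M A \<Longrightarrow> commutes_mult M A (\<lambda>x. c)"
  by (auto simp: commutes_mult_def intro: aeop_scale)

lemma commutes_mult_mult:
  assumes A: "aeop M M A" and p: "bmult M \<phi>" "commutes_mult M A \<phi>" and q: "bmult M \<psi>" "commutes_mult M A \<psi>"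
  shows "commutes_mult M A (\<lambda>x. \<phi> x * \<psi> x)"
  unfolding commutes_mult_def
proof
  fix f assume f: "f \<in> SQ M"
  show "AE x in M. A (\<lambda>x. \<phi> x * \<psi> x * f x) x = \<phi> x * \<psi> x * A f x"
    using commutes_multD[OF p(2) sq_bmult[OF q(1) f]] commutes_multD[OF q(2) f]
    by eventually_elim (simp add: mult.assoc)
qed

lemma commutes_add:
  assumes A: "aeop M M A" and p: "bmult M \<phi>" "commutes_mult M A \<phi>" and q: "bmult M \<psi>" "commutes_mult M A \<psi>"
  shows "commutes_mult M A (\<lambda>x. \<phi> x + \<psi> x)"
  unfolding commutes_mult_def
proof
  fix f assume f: "f \<in> SQ M"
  show "AE x in M. A (\<lambda>x. (\<phi> x + \<psi> x) * f x) x = (\<phi> x + \<psi> x) * A f x"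
    unfolding distrib_right
    using aeop_add[OF A sq_bmult[OF p(1) f] sq_bmult[OF q(1) f]] commutes_multD[OF p(2) f] commutes_multD[OF q(2) f]
    by eventually_elim simp
qed

lemma commutes_scale:
  assumes A: "aeop M M A" and p: "bmult M \<phi>" "commutes_mult M A \<phi>"
  shows "commutes_mult M A (\<lambda>x. c * \<phi> x)"
  by (rule commutes_mult_mult[OF A _ _ p]) (auto intro: commutes_const A)

lemma commutes_sum:
  assumes A: "aeop M M A" and p: "\<And>i. i \<in> I \<Longrightarrow> bmult M (\<phi> i) \<and> commutes_mult M A (\<phi> i)"
  shows "bmult M (\<lambda>x. \<Sum>i\<in>I. \<phi> i x) \<and> commutes_mult M A (\<lambda>x. \<Sum>i\<in>I. \<phi> i x)"
  using p
proof (induction I rule: infinite_finite_induct)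
  case (insert i I)
  then show ?case by (auto intro!: bmult_add commutes_add A)
qed (auto intro!: commutes_const A)

lemma commutes_adjoint:
  assumes A: "adjp M M A A'" and p: "bmult M \<phi>" "commutes_mult M A \<phi>"
  shows "commutes_mult M A' (\<lambda>x. cnj (\<phi> x))"
  unfolding commutes_mult_def
proof
  fix f assume f: "f \<in> SQ M"
  note [simp] = aeop_sq[OF adjp_aeop[OF A]] aeop_sq[OF adjp_aeop'[OF A]] sq_bmult[OF p(1)] sq_bmult[OF bmult_cnj[OF p(1)]]
  show "AE x in M. A' (\<lambda>x. cnj (\<phi> x) * f x) x = cnj (\<phi> x) * A' f x"
  proof (rule AE_eqI_ip)
    fix k assume k: "k \<in> SQ M"
    note A' = adjp_sym[OF A]
    have "ip M (A' (\<lambda>x. cnj (\<phi> x) * f x)) k = ip M (\<lambda>x. cnj (\<phi> x) * f x) (A k)"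
      using f k by (simp add: adjpD[OF A'])
    also have "\<dots> = ip M f (\<lambda>x. \<phi> x * A k x)" by (simp add: ip_mult_move)
    also have "\<dots> = ip M f (A (\<lambda>x. \<phi> x * k x))"
      using commutes_multD[OF p(2) k] f k
      by (intro ip_cong_AE) (auto intro!: sq_measurable)
    also have "\<dots> = ip M (\<lambda>x. cnj (\<phi> x) * A' f x) k"
      using f k by (simp add: adjpD[OF A'] ip_mult_move)
    finally show "ip M (A' (\<lambda>x. cnj (\<phi> x) * f x)) k = ip M (\<lambda>x. cnj (\<phi> x) * A' f x) k" .
  qed (use f in auto)
qed

text \<open>
  The multiplication algebra is maximal abelian. The symbol is \<open>Q h / h\<close> for the weight \<open>h\<close>: where
  \<open>\<bar>f\<bar> \<le> n h\<close>, the function \<open>f\<close> is \<open>(f / h) h\<close> with bounded \<open>f / h\<close>, so \<open>Q f\<close> is known there, and these sets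
  exhaust the space. The symbol is bounded by the norm of \<open>Q\<close>, as one sees by testing \<open>Q\<close> on the set
  where it is larger.
\<close>

theorem commuting_with_mult_is_mult:
  assumes sf: "sigma_finite_measure M" and Q: "aeop M M Q"
    and comm: "\<And>\<phi>. bmult M \<phi> \<Longrightarrow> commutes_mult M Q \<phi>"
  shows "\<exists>q. bmult M q \<and> (\<forall>f\<in>SQ M. AE x in M. Q f x = q x * f x)"
proof -
  obtain h :: "'a \<Rightarrow> real" where hm: "h \<in> borel_measurable M" and hp: "\<And>x. x \<in> space M \<Longrightarrow> 0 < h x"
    and hS: "(\<lambda>x. complex_of_real (h x)) \<in> SQ M"
    using ex_weight[OF sf] by blast
  let ?h = "\<lambda>x. complex_of_real (h x)"
  obtain C where C: "C > 0" "\<And>f. f \<in> SQ M \<Longrightarrow> nrm M (Q f) \<le> C * nrm M f" using aeop_bound[OF Q] by blast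
  define q0 where "q0 x = Q ?h x / h x" for x
  note [measurable] = hm aeop_meas[OF Q hS]
  have [measurable]: "q0 \<in> borel_measurable M" unfolding q0_def[abs_def] by measurable
  have Qh: "Q ?h x = q0 x * h x" if "x \<in> space M" for x using hp[OF that] by (simp add: q0_def)
  have rep: "AE x in M. Q f x = q0 x * f x" if f: "f \<in> SQ M" for f
  proof -
    have [measurable]: "f \<in> borel_measurable M" using f by (simp add: sq_integrable_def)
    define B where "B n = {x \<in> space M. cmod (f x) \<le> real n * h x}" for n
    have [measurable]: "B n \<in> sets M" for n unfolding B_def by measurable
    have "AE x in M. indicator (B n) x * Q f x = indicator (B n) x * (q0 x * f x)" for n
    proof -
      define \<phi> where "\<phi> x = indicator (B n) x * (f x / h x)" for x
      have "cmod (\<phi> x) \<le> n" for x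
        using hp[of x] by (auto simp: \<phi>_def indicator_def B_def norm_divide divide_le_eq)
      then have \<phi>: "bmult M \<phi>" unfolding bmult_def \<phi>_def[abs_def] by (auto intro!: exI[of _ "real n"])
      have cut: "AE x in M. \<phi> x * h x = indicator (B n) x * f x"
        using hp by (intro AE_I2) (force simp: \<phi>_def)
      have "AE x in M. Q (\<lambda>x. indicator (B n) x * f x) x = indicator (B n) x * Q f x"
        by (rule commutes_multD[OF comm[OF bmult_indicator] f]) simp
      moreover have "AE x in M. Q (\<lambda>x. \<phi> x * h x) x = Q (\<lambda>x. indicator (B n) x * f x) x"
        by (rule aeop_cong[OF Q sq_bmult[OF \<phi> hS] sq_cut[OF f] cut]) simp
      moreover have "AE x in M. Q (\<lambda>x. \<phi> x * h x) x = \<phi> x * Q ?h x"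
        using commutes_multD[OF comm[OF \<phi>] hS] .
      ultimately show ?thesis
        using cut AE_space
      proof eventually_elim
        case (elim x)
        have "indicator (B n) x * Q f x = \<phi> x * (q0 x * h x)" using elim Qh[of x] by simp
        also have "\<dots> = q0 x * (\<phi> x * h x)" by simp
        also have "\<dots> = indicator (B n) x * (q0 x * f x)" using elim by simp
        finally show ?case .
      qed
    qed
    then have "AE x in M. \<forall>n. indicator (B n) x * Q f x = indicator (B n) x * (q0 x * f x)"
      unfolding AE_all_countable by simp
    then show ?thesis using AE_space
    proof eventually_elim
      case (elim x)
      obtain n where "cmod (f x) / h x \<le> real n" using real_arch_simple by blast
      then have "x \<in> B n" using hp[OF elim(2)] elim(2) by (simp add: B_def divide_le_eq)
      then show ?case using elim(1)[rule_format, of n] by simp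
    qed
  qed
  have "AE x in M. cmod (q0 x) \<le> C"
  proof -
    define B where "B = {x \<in> space M. C < cmod (q0 x)}"
    have B[measurable]: "B \<in> sets M" unfolding B_def by measurable
    let ?f = "\<lambda>x. indicator B x * ?h x"
    have f: "?f \<in> SQ M" by (rule sq_cut[OF hS B])
    have Qf: "AE x in M. Q ?f x = q0 x * ?f x" by (rule rep[OF f])
    have qfS: "(\<lambda>x. q0 x * ?f x) \<in> SQ M"
    proof (rule sq_bound[OF aeop_sq[OF Q f], of _ 1])
      show "AE x in M. cmod (q0 x * ?f x) \<le> 1 * cmod (Q ?f x)" using Qf by eventually_elim simp
    qed simp
    have "nrm M (\<lambda>x. q0 x * ?f x) = nrm M (Q ?f)"
      using Qf aeop_meas[OF Q f] by (intro nrm_cong_AE) auto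
    then have "(nrm M (\<lambda>x. q0 x * ?f x))\<^sup>2 \<le> (C * nrm M ?f)\<^sup>2" using C(2)[OF f] by (intro power_mono) auto
    then have le: "(\<integral>x. (cmod (q0 x * ?f x))\<^sup>2 - C\<^sup>2 * (cmod (?f x))\<^sup>2 \<partial>M) \<le> 0"
      using sq_integrable_square[OF qfS] sq_integrable_square[OF f] by (simp add: nrm_square power_mult_distrib)
    have nn: "0 \<le> (cmod (q0 x * ?f x))\<^sup>2 - C\<^sup>2 * (cmod (?f x))\<^sup>2" for x
    proof (cases "x \<in> B")
      case True
      then have "C\<^sup>2 \<le> (cmod (q0 x))\<^sup>2" using C(1) by (intro power_mono) (auto simp: B_def)
      then show ?thesis by (simp add: norm_mult power_mult_distrib mult_right_mono)
    qed simp
    have "(\<integral>x. (cmod (q0 x * ?f x))\<^sup>2 - C\<^sup>2 * (cmod (?f x))\<^sup>2 \<partial>M) = 0"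
      using le nn by (intro antisym integral_nonneg_AE) auto
    then have "AE x in M. (cmod (q0 x * ?f x))\<^sup>2 - C\<^sup>2 * (cmod (?f x))\<^sup>2 = 0"
      using sq_integrable_square[OF qfS] sq_integrable_square[OF f] nn
      by (subst (asm) integral_nonneg_eq_0_iff_AE) auto
    then show ?thesis using AE_space
    proof eventually_elim
      case (elim x)
      show ?case
      proof (rule ccontr)
        assume "\<not> ?case"
        then have x: "x \<in> B" using elim by (simp add: B_def)
        have "C\<^sup>2 * (h x)\<^sup>2 < (cmod (q0 x))\<^sup>2 * (h x)\<^sup>2"
          using x C(1) hp[OF elim(2)] by (intro mult_strict_right_mono power_strict_mono) (auto simp: B_def)
        then show False using elim x by (auto simp: norm_mult power_mult_distrib)
      qed
    qed
  qed
  note bd = this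
  define q where "q x = (if cmod (q0 x) \<le> C then q0 x else 0)" for x
  have "bmult M q" using C(1) unfolding bmult_def q_def[abs_def] by (auto intro!: exI[of _ C])
  moreover have "AE x in M. Q f x = q x * f x" if "f \<in> SQ M" for f
    using rep[OF that] bd by eventually_elim (simp add: q_def)
  ultimately show ?thesis by blast
qed

text \<open>
  An operator that commutes with \<open>r\<close> cannot move mass from low levels of \<open>r\<close> to high ones: after
  adding a constant that makes \<open>r\<close> positive, the part of \<open>A f\<close> living on \<open>t \<le> r\<close> is enlarged by the factor
  \<open>(t + K)\<^sup>n\<close> under multiplication with \<open>(r + K)\<^sup>n\<close>, while \<open>f\<close> is enlarged at most by \<open>(s + K)\<^sup>n\<close>. The ratio
  tends to zero.
\<close>

lemma level_separation:
  fixes r :: "'a \<Rightarrow> real"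
  assumes A: "aeop M M A" and r: "bmult M (\<lambda>x. of_real (r x))" and c: "commutes_mult M A (\<lambda>x. of_real (r x))"
    and st: "s < t" and f: "f \<in> SQ M" and fs: "\<And>x. f x \<noteq> 0 \<Longrightarrow> r x \<le> s"
  shows "AE x in M. t \<le> r x \<longrightarrow> A f x = 0"
proof -
  obtain K0 where K0: "\<And>x. \<bar>r x\<bar> \<le> K0" using r by (auto simp: bmult_def)
  define K where "K = \<bar>K0\<bar> + \<bar>s\<bar> + 1"
  have K: "0 < r x + K" "0 < s + K" for x using K0[of x] by (auto simp: K_def)
  have K': "0 < t + K" using K(2) st by simp
  let ?\<rho> = "\<lambda>x. complex_of_real (r x) + of_real K"
  have rho: "bmult M ?\<rho>" "commutes_mult M A ?\<rho>"
    using r c by (auto intro!: bmult_add commutes_add commutes_const A)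
  have pow: "bmult M (\<lambda>x. ?\<rho> x ^ n) \<and> commutes_mult M A (\<lambda>x. ?\<rho> x ^ n)" for n
    by (induction n) (auto intro!: bmult_mult commutes_mult_mult rho commutes_const A)
  have [measurable]: "r \<in> borel_measurable M"
    using r unfolding bmult_def by (simp add: borel_measurable_complex_iff)
  define G where "G = {x \<in> space M. t \<le> r x}"
  have [measurable]: "G \<in> sets M" unfolding G_def by measurable
  obtain C where C: "C > 0" "\<And>f. f \<in> SQ M \<Longrightarrow> nrm M (A f) \<le> C * nrm M f" using aeop_bound[OF A] by blast
  have [measurable]: "f \<in> borel_measurable M" "A f \<in> borel_measurable M"
    using f aeop_meas[OF A f] by (auto simp: sq_integrable_def)
  let ?u = "\<lambda>x. indicator G x * A f x"
  have uS: "?u \<in> SQ M" by (intro sq_cut aeop_sq[OF A] f) simp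
  have est: "(t + K) ^ n * nrm M ?u \<le> C * (s + K) ^ n * nrm M f" for n
  proof -
    have gS: "(\<lambda>x. ?\<rho> x ^ n * f x) \<in> SQ M" using pow[of n] f by (auto intro: sq_bmult)
    have "(t + K) ^ n * nrm M ?u = nrm M (\<lambda>x. of_real ((t + K) ^ n) * ?u x)"
      unfolding nrm_scale norm_of_real using K' by simp
    also have "\<dots> \<le> 1 * nrm M (A (\<lambda>x. ?\<rho> x ^ n * f x))"
    proof (rule nrm_mono_AE[OF aeop_sq[OF A gS]])
      show "AE x in M. cmod (of_real ((t + K) ^ n) * ?u x) \<le> 1 * cmod (A (\<lambda>x. ?\<rho> x ^ n * f x) x)"
        using commutes_multD[OF conjunct2[OF pow[of n]] f]
      proof eventually_elim
        case (elim x)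
        show ?case
        proof (cases "x \<in> G")
          case True
          have "\<bar>t + K\<bar> ^ n \<le> \<bar>r x + K\<bar> ^ n"
            using True K' K(1)[of x] by (intro power_mono) (auto simp: G_def)
          moreover have "cmod (?\<rho> x ^ n) = \<bar>r x + K\<bar> ^ n"
            by (simp add: norm_power flip: of_real_add)
          ultimately have "\<bar>t + K\<bar> ^ n * cmod (A f x) \<le> cmod (?\<rho> x ^ n * A f x)"
            unfolding norm_mult by (simp only: mult_right_mono norm_ge_zero)
          moreover have "cmod (A (\<lambda>x. ?\<rho> x ^ n * f x) x) = cmod (?\<rho> x ^ n * A f x)"
            by (simp only: elim)
          ultimately show ?thesis
            using True unfolding norm_mult norm_of_real power_abs by simp
        qed simp
      qed
    qed auto
    also have "\<dots> \<le> C * nrm M (\<lambda>x. ?\<rho> x ^ n * f x)" using C(2)[OF gS] by simp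
    also have "nrm M (\<lambda>x. ?\<rho> x ^ n * f x) \<le> (s + K) ^ n * nrm M f"
    proof (rule nrm_mono_AE[OF f])
      have "cmod (?\<rho> x ^ n * f x) \<le> (s + K) ^ n * cmod (f x)" for x
      proof (cases "f x = 0")
        case False
        have "\<bar>r x + K\<bar> ^ n \<le> (s + K) ^ n"
          using fs[OF False] K(1)[of x] by (intro power_mono) auto
        moreover have "cmod (?\<rho> x ^ n) = \<bar>r x + K\<bar> ^ n"
          by (simp add: norm_power flip: of_real_add)
        ultimately show ?thesis by (simp add: norm_mult mult_right_mono)
      qed simp
      then show "AE x in M. cmod (?\<rho> x ^ n * f x) \<le> (s + K) ^ n * cmod (f x)" by simp
    qed (use K in auto)
    finally show ?thesis using C(1) by (simp add: mult_ac)
  qed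
  have "nrm M ?u \<le> C * nrm M f * ((s + K) / (t + K)) ^ n" for n
    using est[of n] K' by (simp add: power_divide field_simps)
  moreover have "(\<lambda>n. C * nrm M f * ((s + K) / (t + K)) ^ n) \<longlonglongrightarrow> C * nrm M f * 0"
    using K(2) K' st by (intro tendsto_mult tendsto_const LIMSEQ_realpow_zero) auto
  ultimately have "nrm M ?u \<le> C * nrm M f * 0" by (intro LIMSEQ_le_const) auto
  then have "nrm M ?u = 0" using nrm_nonneg[of M ?u] by simp
  then have "AE x in M. ?u x = 0" by (simp add: nrm_eq_0_iff[OF uS])
  then show ?thesis using AE_space by eventually_elim (auto simp: G_def indicator_def)
qed


text \<open>
  The strict separation of levels closes up to \<open>r < t\<close> against \<open>t \<le> r\<close> when the low level is on the
  output side, where countably many null sets can be united; the other side follows by passing to the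
  adjoint.
\<close>

theorem level_set_commutes:
  fixes r :: "'a \<Rightarrow> real"
  assumes A: "adjp M M A A'" and r: "bmult M (\<lambda>x. of_real (r x))" and c: "commutes_mult M A (\<lambda>x. of_real (r x))"
  shows "commutes_mult M A (indicator {x \<in> space M. r x < t})"
proof -
  have [measurable]: "r \<in> borel_measurable M"
    using r unfolding bmult_def by (simp add: borel_measurable_complex_iff)
  define L H where "L = {x \<in> space M. r x < t}" and "H = {x \<in> space M. t \<le> r x}"
  have [measurable]: "L \<in> sets M" "H \<in> sets M" unfolding L_def H_def by measurable
  have upper: "AE x in M. x \<in> L \<longrightarrow> B (\<lambda>x. indicator H x * f x) x = 0"
    if B: "aeop M M B" and cB: "commutes_mult M B (\<lambda>x. of_real (r x))" and f: "f \<in> SQ M" for B f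
  proof -
    have "AE x in M. - t + 1 / real (Suc n) \<le> - r x \<longrightarrow> B (\<lambda>x. indicator H x * f x) x = 0" for n
    proof (rule level_separation[OF B, where s = "- t"])
      show "bmult M (\<lambda>x. of_real (- r x))" using bmult_mult[OF bmult_const[of M "-1"] r] by simp
      show "commutes_mult M B (\<lambda>x. of_real (- r x))" using commutes_scale[OF B r cB, of "-1"] by simp
      show "(\<lambda>x. indicator H x * f x) \<in> SQ M" by (rule sq_cut[OF f]) simp
    qed (auto simp: H_def indicator_def split: if_splits)
    then have "AE x in M. \<forall>n. - t + 1 / real (Suc n) \<le> - r x \<longrightarrow> B (\<lambda>x. indicator H x * f x) x = 0"
      unfolding AE_all_countable by simp
    then show ?thesis
    proof eventually_elim
      case (elim x)
      show ?case
      proof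
        assume "x \<in> L"
        then obtain n where "inverse (real (Suc n)) < t - r x"
          using reals_Archimedean[of "t - r x"] by (auto simp: L_def)
        then have "- t + 1 / real (Suc n) \<le> - r x" unfolding inverse_eq_divide by linarith
        then show "B (\<lambda>x. indicator H x * f x) x = 0" using elim by blast
      qed
    qed
  qed
  note A1 = adjp_aeop[OF A] and A2 = adjp_aeop'[OF A]
  have c': "commutes_mult M A' (\<lambda>x. of_real (r x))" using commutes_adjoint[OF A r c] by simp
  show ?thesis
    unfolding commutes_mult_def L_def[symmetric]
  proof
    fix f assume f: "f \<in> SQ M"
    let ?fL = "\<lambda>x. indicator L x * f x" and ?fH = "\<lambda>x. indicator H x * f x"
    have S: "?fL \<in> SQ M" "?fH \<in> SQ M" using f by (auto intro: sq_cut)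
    have "AE x in M. A f x = A (\<lambda>x. ?fL x + ?fH x) x"
      by (rule aeop_cong[OF A1 f sq_add[OF S]]) (auto simp: L_def H_def indicator_def intro!: AE_I2)
    moreover note aeop_add[OF A1 S] upper[OF A1 c f]
    moreover have "AE x in M. indicator H x * A ?fL x = 0"
    proof (rule AE_eqI_ip)
      show "(\<lambda>x. indicator H x * A ?fL x) \<in> SQ M" by (intro sq_cut aeop_sq[OF A1] S) simp
      fix k assume k: "k \<in> SQ M"
      let ?kH = "\<lambda>x. indicator H x * k x"
      have kH: "?kH \<in> SQ M" by (rule sq_cut[OF k]) simp
      have "ip M (\<lambda>x. indicator H x * A ?fL x) k = ip M (A ?fL) ?kH"
        by (simp add: ip_mult_move)
      also have "\<dots> = ip M f (\<lambda>x. indicator L x * A' ?kH x)"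
        by (simp add: adjpD[OF A S(1) kH] ip_mult_move)
      also have "\<dots> = ip M f (\<lambda>x. 0)"
      proof (rule ip_cong_AE)
        show "AE x in M. indicator L x * A' ?kH x = 0"
          using upper[OF A2 c' k] by eventually_elim (auto simp: indicator_def)
      qed (use f aeop_meas[OF A2 kH] in \<open>auto simp: sq_integrable_def\<close>)
      finally show "ip M (\<lambda>x. indicator H x * A ?fL x) k = ip M (\<lambda>x. 0) k"
        by (simp add: ip_zero_left ip_zero_right)
    qed simp
    ultimately show "AE x in M. A ?fL x = indicator L x * A f x"
      using AE_space
    proof eventually_elim
      case (elim x)
      then show ?case by (cases "x \<in> L") (auto simp: L_def H_def)
    qed
  qed
qed

text \<open>
  A bounded function is a uniform limit of combinations of indicators of its level sets.
\<close>

lemma commutes_if_level_sets_commute: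
  fixes r :: "'a \<Rightarrow> real"
  assumes A: "aeop M M A" and r: "bmult M (\<lambda>x. of_real (r x))"
    and c: "\<And>t. commutes_mult M A (indicator {x \<in> space M. r x < t})"
  shows "commutes_mult M A (\<lambda>x. of_real (r x))"
proof -
  have [measurable]: "r \<in> borel_measurable M"
    using r unfolding bmult_def by (simp add: borel_measurable_complex_iff)
  obtain K where K: "\<And>x. \<bar>r x\<bar> \<le> K" using r by (auto simp: bmult_def)
  obtain C where C: "C > 0" "\<And>f. f \<in> SQ M \<Longrightarrow> nrm M (A f) \<le> C * nrm M f" using aeop_bound[OF A] by blast
  have approx: "\<exists>\<phi>. bmult M \<phi> \<and> commutes_mult M A \<phi> \<and> (\<forall>x\<in>space M. cmod (of_real (r x) - \<phi> x) \<le> 1 / Suc m)" for m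
  proof -
    let ?m = "real (Suc m)"
    define L where "L = nat \<lfloor>?m * (K + K)\<rfloor>"
    define \<psi> where "\<psi> k x = (1::complex) + (-1) * indicator {x \<in> space M. r x < real k / ?m - K} x" for k x
    have psi: "bmult M (\<psi> k) \<and> commutes_mult M A (\<psi> k)" for k
    proof -
      have "bmult M (indicator {x \<in> space M. r x < real k / ?m - K})" by (rule bmult_indicator) measurable
      then show ?thesis unfolding \<psi>_def[abs_def]
        by (intro conjI bmult_add bmult_mult bmult_const commutes_add commutes_scale commutes_const A c)
    qed
    define \<phi> where "\<phi> x = - of_real K + of_real (1 / ?m) * (\<Sum>k\<in>{1..L}. \<psi> k x)" for x
    have sum: "bmult M (\<lambda>x. \<Sum>k\<in>{1..L}. \<psi> k x) \<and> commutes_mult M A (\<lambda>x. \<Sum>k\<in>{1..L}. \<psi> k x)"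
      by (rule commutes_sum[OF A]) (rule psi)
    have "bmult M \<phi>" "commutes_mult M A \<phi>"
      unfolding \<phi>_def[abs_def] by (intro bmult_add bmult_mult bmult_const commutes_add commutes_scale commutes_const A sum[THEN conjunct1] sum[THEN conjunct2])+
    moreover have "cmod (of_real (r x) - \<phi> x) \<le> 1 / ?m" if x: "x \<in> space M" for x
    proof -
      define u where "u = ?m * (r x + K)"
      have u: "0 \<le> u" using K[of x] by (auto simp: u_def intro!: mult_nonneg_nonneg)
      \<comment> \<open>The sum of the indicators counts the integers from 1 up to the floor of u.\<close>
      have psi_eq: "\<psi> k x = (if k \<le> nat \<lfloor>u\<rfloor> then 1 else 0)" for k
      proof -
        have "r x < real k / ?m - K \<longleftrightarrow> u < real k" by (simp add: u_def field_simps)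
        moreover have "k \<le> nat \<lfloor>u\<rfloor> \<longleftrightarrow> real k \<le> u" using u by (simp add: le_nat_floor le_nat_iff le_floor_iff)
        ultimately show ?thesis using x by (auto simp: \<psi>_def indicator_def)
      qed
      have "nat \<lfloor>u\<rfloor> \<le> L"
        unfolding L_def u_def using K[of x] by (intro nat_mono floor_mono mult_left_mono) auto
      then have "{k \<in> {1..L}. k \<le> nat \<lfloor>u\<rfloor>} = {1..nat \<lfloor>u\<rfloor>}" by auto
      then have "(\<Sum>k\<in>{1..L}. \<psi> k x) = of_nat (nat \<lfloor>u\<rfloor>)"
        by (simp add: psi_eq sum.If_cases Int_def conj_commute)
      then have "of_real (r x) - \<phi> x = complex_of_real ((r x + K) - real (nat \<lfloor>u\<rfloor>) / ?m)"
        by (simp add: \<phi>_def)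
      also have "(r x + K) - real (nat \<lfloor>u\<rfloor>) / ?m = (u - real (nat \<lfloor>u\<rfloor>)) / ?m"
        by (simp add: u_def field_simps)
      finally have "cmod (of_real (r x) - \<phi> x) = \<bar>(u - real (nat \<lfloor>u\<rfloor>)) / ?m\<bar>"
        by (simp only: norm_of_real)
      also have "\<dots> \<le> 1 / ?m"
      proof -
        have "\<bar>u - real (nat \<lfloor>u\<rfloor>)\<bar> \<le> 1" using u by (simp add: abs_le_iff) linarith
        then show ?thesis by (simp add: divide_right_mono)
      qed
      finally show ?thesis .
    qed
    ultimately show ?thesis by blast
  qed
  show ?thesis
    unfolding commutes_mult_def
  proof
    fix f assume f: "f \<in> SQ M"
    let ?r = "\<lambda>x. complex_of_real (r x)"
    note Af = aeop_sq[OF A f]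
    have rf: "(\<lambda>x. ?r x * f x) \<in> SQ M" and rAf: "(\<lambda>x. ?r x * A f x) \<in> SQ M"
      using r f Af by (auto intro: sq_bmult)
    have "nrm M (\<lambda>x. A (\<lambda>x. ?r x * f x) x - ?r x * A f x) \<le> 2 * C * nrm M f * (1 / Suc m)" for m
    proof -
      obtain \<phi> where p: "bmult M \<phi>" "commutes_mult M A \<phi>" and d: "\<And>x. x \<in> space M \<Longrightarrow> cmod (?r x - \<phi> x) \<le> 1 / Suc m"
        using approx by blast
      have pf: "(\<lambda>x. \<phi> x * f x) \<in> SQ M" and pAf: "(\<lambda>x. \<phi> x * A f x) \<in> SQ M"
        using p f Af by (auto intro: sq_bmult)
      have small: "nrm M (\<lambda>x. ?r x * g x - \<phi> x * g x) \<le> 1 / Suc m * nrm M g" if g: "g \<in> SQ M" for g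
      proof (rule nrm_mono_AE[OF g])
        show "AE x in M. cmod (?r x * g x - \<phi> x * g x) \<le> 1 / Suc m * cmod (g x)"
        proof (rule AE_I2)
          fix x assume "x \<in> space M"
          from d[OF this] have "cmod (?r x - \<phi> x) * cmod (g x) \<le> 1 / Suc m * cmod (g x)"
            by (rule mult_right_mono) simp
          then show "cmod (?r x * g x - \<phi> x * g x) \<le> 1 / Suc m * cmod (g x)"
            by (simp only: left_diff_distrib[symmetric] norm_mult)
        qed
        show "(\<lambda>x. ?r x * g x - \<phi> x * g x) \<in> borel_measurable M"
          using g bmult_measurable[OF p(1)] by (auto simp: sq_integrable_def)
      qed simp
      let ?d = "\<lambda>x. ?r x * f x - \<phi> x * f x" and ?e = "\<lambda>x. ?r x * A f x - \<phi> x * A f x"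
      have dS: "?d \<in> SQ M" and eS: "?e \<in> SQ M" using rf pf rAf pAf by (auto intro: sq_diff)
      have "nrm M (\<lambda>x. A (\<lambda>x. ?r x * f x) x - ?r x * A f x) = nrm M (\<lambda>x. A ?d x + (-1) * ?e x)"
      proof (rule nrm_cong_AE)
        show "AE x in M. A (\<lambda>x. ?r x * f x) x - ?r x * A f x = A ?d x + (-1) * ?e x"
          using aeop_diff[OF A rf pf] commutes_multD[OF p(2) f] by eventually_elim simp
      qed (intro sq_measurable sq_diff sq_add sq_scale aeop_sq[OF A] rf rAf dS eS)+
      also have "\<dots> \<le> nrm M (A ?d) + nrm M ?e"
        using nrm_triangle[OF aeop_sq[OF A dS] sq_scale[OF eS, of "-1"]] nrm_scale[of M "-1" ?e] by simp
      also have "\<dots> \<le> C * (1 / Suc m * nrm M f) + 1 / Suc m * (C * nrm M f)"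
      proof -
        have "0 \<le> 1 / real (Suc m)" by simp
        from mult_left_mono[OF C(2)[OF f] this] mult_left_mono[OF small[OF f] less_imp_le[OF C(1)]]
        show ?thesis using C(2)[OF dS] small[OF Af] by linarith
      qed
      finally show ?thesis by (simp add: mult_ac)
    qed
    moreover have "(\<lambda>m. 2 * C * nrm M f * (1 / Suc m)) \<longlonglongrightarrow> 2 * C * nrm M f * 0"
      by (intro tendsto_mult tendsto_const LIMSEQ_Suc[OF lim_1_over_n])
    ultimately have "nrm M (\<lambda>x. A (\<lambda>x. ?r x * f x) x - ?r x * A f x) \<le> 2 * C * nrm M f * 0"
      by (intro LIMSEQ_le_const) auto
    then have "nrm M (\<lambda>x. A (\<lambda>x. ?r x * f x) x - ?r x * A f x) = 0" using nrm_nonneg[of M] by (intro antisym) auto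
    then show "AE x in M. A (\<lambda>x. ?r x * f x) x = ?r x * A f x"
      by (simp add: AE_eq_iff_nrm[OF aeop_sq[OF A rf] rAf])
  qed
qed

text \<open>
  A self-adjoint family that commutes with \<open>q\<close> also commutes with the conjugate of \<open>q\<close>, hence with its
  real and imaginary parts and with their level sets. So an operator in the commutant of the
  projections that commute with \<open>\<A>\<close> also commutes with \<open>q\<close>.
\<close>

theorem commutes_via_projections:
  assumes star: "\<And>A. A \<in> \<A> \<Longrightarrow> \<exists>A'\<in>\<A>. adjp M M A A'"
    and q: "bmult M q" and cq: "\<And>A. A \<in> \<A> \<Longrightarrow> commutes_mult M A q"
    and R: "aeop M M R"
    and cR: "\<And>\<alpha>. \<alpha> \<in> sets M \<Longrightarrow> (\<And>A. A \<in> \<A> \<Longrightarrow> commutes_mult M A (indicator \<alpha>)) \<Longrightarrow> commutes_mult M R (indicator \<alpha>)"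
  shows "commutes_mult M R q"
proof -
  have cq': "commutes_mult M A (\<lambda>x. cnj (q x))" if A: "A \<in> \<A>" for A
  proof -
    obtain A' where "A' \<in> \<A>" "adjp M M A A'" using star[OF A] by blast
    then show ?thesis using commutes_adjoint[OF adjp_sym q cq] by blast
  qed
  have part: "commutes_mult M R (\<lambda>x. of_real (r x))"
    if r: "bmult M (\<lambda>x. of_real (r x))" and cr: "\<And>A. A \<in> \<A> \<Longrightarrow> commutes_mult M A (\<lambda>x. of_real (r x))" for r :: "'a \<Rightarrow> real"
  proof (rule commutes_if_level_sets_commute[OF R r])
    fix t
    have [measurable]: "r \<in> borel_measurable M"
      using r unfolding bmult_def by (simp add: borel_measurable_complex_iff)
    show "commutes_mult M R (indicator {x \<in> space M. r x < t})"
    proof (rule cR)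
      fix A assume A: "A \<in> \<A>"
      then obtain A' where "adjp M M A A'" using star by blast
      then show "commutes_mult M A (indicator {x \<in> space M. r x < t})" by (rule level_set_commutes[OF _ r cr[OF A]])
    qed measurable
  qed
  have Re_eq: "(\<lambda>x. complex_of_real (Re (q x))) = (\<lambda>x. 1/2 * (q x + cnj (q x)))"
    by (simp add: complex_add_cnj fun_eq_iff)
  have Im_eq: "(\<lambda>x. complex_of_real (Im (q x))) = (\<lambda>x. - \<i> / 2 * (q x + (-1) * cnj (q x)))"
    by (simp add: complex_eq_iff fun_eq_iff)
  have op: "aeop M M A" if "A \<in> \<A>" for A using star[OF that] adjp_aeop by blast
  have Re: "bmult M (\<lambda>x. of_real (Re (q x)))" and cRe: "commutes_mult M R (\<lambda>x. of_real (Re (q x)))"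
  proof -
    show *: "bmult M (\<lambda>x. of_real (Re (q x)))"
      unfolding Re_eq by (intro bmult_mult bmult_add bmult_const bmult_cnj q)
    show "commutes_mult M R (\<lambda>x. of_real (Re (q x)))"
      by (rule part[OF *], unfold Re_eq) (intro commutes_scale commutes_add op cq cq' bmult_add bmult_cnj q; assumption)
  qed
  have Im: "bmult M (\<lambda>x. of_real (Im (q x)))" and cIm: "commutes_mult M R (\<lambda>x. of_real (Im (q x)))"
  proof -
    show *: "bmult M (\<lambda>x. of_real (Im (q x)))"
      unfolding Im_eq by (intro bmult_mult bmult_add bmult_const bmult_cnj q)
    show "commutes_mult M R (\<lambda>x. of_real (Im (q x)))"
      by (rule part[OF *], unfold Im_eq)
        (intro commutes_scale commutes_add op cq cq' bmult_add bmult_mult bmult_const bmult_cnj q; assumption)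
  qed
  have "q = (\<lambda>x. of_real (Re (q x)) + \<i> * of_real (Im (q x)))"
    by (simp add: complex_eq_iff fun_eq_iff)
  moreover have "commutes_mult M R (\<lambda>x. of_real (Re (q x)) + \<i> * of_real (Im (q x)))"
    using Re Im cRe cIm R by (intro commutes_add commutes_scale bmult_mult bmult_const)
  ultimately show ?thesis by simp
qed

section \<open>Finite weights, essential supports and separability\<close>

definition weighted :: "'a measure \<Rightarrow> ('a \<Rightarrow> real) \<Rightarrow> 'a measure" where
  "weighted M h = density M (\<lambda>x. ennreal ((h x)\<^sup>2))"

locale weight =
  fixes M :: "'a measure" and h :: "'a \<Rightarrow> real"
  assumes h_meas [measurable]: "h \<in> borel_measurable M"
    and h_pos: "\<And>x. x \<in> space M \<Longrightarrow> 0 < h x"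
    and h_sq: "(\<lambda>x. complex_of_real (h x)) \<in> SQ M"
begin

lemma emeasure_weighted:
  assumes [measurable]: "A \<in> sets M"
  shows "emeasure (weighted M h) A = ennreal ((nrm M (\<lambda>x. indicator A x * of_real (h x)))\<^sup>2)"
proof -
  have "emeasure (weighted M h) A = (\<integral>\<^sup>+x. ennreal ((h x)\<^sup>2) * indicator A x \<partial>M)"
    unfolding weighted_def by (rule emeasure_density) measurable
  also have "\<dots> = (\<integral>\<^sup>+x. ennreal ((cmod (indicator A x * of_real (h x)))\<^sup>2) \<partial>M)"
    by (intro nn_integral_cong) (auto simp: indicator_def)
  also have "\<dots> = ennreal ((nrm M (\<lambda>x. indicator A x * of_real (h x)))\<^sup>2)"
    by (rule nrm_eq_nn_integral[symmetric]) (rule sq_cut[OF h_sq assms])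
  finally show ?thesis .
qed

lemma sets_weighted [simp]: "sets (weighted M h) = sets M"
  and space_weighted [simp]: "space (weighted M h) = space M"
  by (simp_all add: weighted_def)

lemma finite_weighted: "finite_measure (weighted M h)"
  by (rule finite_measureI) (simp add: emeasure_weighted)

lemma measure_weighted:
  "A \<in> sets M \<Longrightarrow> measure (weighted M h) A = (nrm M (\<lambda>x. indicator A x * of_real (h x)))\<^sup>2"
  by (simp add: measure_def emeasure_weighted)

lemma null_weighted: "A \<in> sets M \<Longrightarrow> measure (weighted M h) A = 0 \<Longrightarrow> AE x in M. x \<notin> A"
  using nrm_eq_0_iff[OF sq_cut[OF h_sq, of A]] AE_space[of M] h_pos
  by (auto simp: measure_weighted indicator_def elim!: eventually_elim2) force

text \<open>
  Absolute continuity: cut \<open>u\<close> off where it exceeds a large multiple of the weight; the rest is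
  controlled by the weight.
\<close>

lemma small_weight_small_norm:
  assumes u: "u \<in> SQ M" and e: "0 < e"
  shows "\<exists>\<delta>>0. \<forall>A\<in>sets M. measure (weighted M h) A < \<delta> \<longrightarrow> nrm M (\<lambda>x. indicator A x * u x) < e"
proof -
  have [measurable]: "u \<in> borel_measurable M" using u by (simp add: sq_integrable_def)
  define B where "B n = {x \<in> space M. real n * h x < cmod (u x)}" for n
  have [measurable]: "B n \<in> sets M" for n unfolding B_def by measurable
  have "(\<lambda>n. \<integral>x. (cmod (indicator (B n) x * u x))\<^sup>2 \<partial>M) \<longlonglongrightarrow> (\<integral>x. 0 \<partial>M)"
  proof (rule integral_dominated_convergence)
    show "integrable M (\<lambda>x. (cmod (u x))\<^sup>2)" by (rule sq_integrable_square[OF u])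
    show "AE x in M. norm ((cmod (indicator (B n) x * u x))\<^sup>2) \<le> (cmod (u x))\<^sup>2" for n
      by (auto simp: indicator_def)
    show "AE x in M. (\<lambda>n. (cmod (indicator (B n) x * u x))\<^sup>2) \<longlonglongrightarrow> 0"
    proof (rule AE_I2)
      fix x assume x: "x \<in> space M"
      obtain K where K: "cmod (u x) / h x \<le> real K" using real_arch_simple by blast
      have "x \<notin> B n" if "n \<ge> K" for n
      proof -
        have "cmod (u x) / h x \<le> real n" using K that by linarith
        then show ?thesis using h_pos[OF x] by (auto simp: B_def divide_le_eq)
      qed
      then have "\<forall>\<^sub>F n in sequentially. (cmod (indicator (B n) x * u x))\<^sup>2 = 0"
        by (intro eventually_sequentiallyI[of K]) simp
      then show "(\<lambda>n. (cmod (indicator (B n) x * u x))\<^sup>2) \<longlonglongrightarrow> 0" by (rule tendsto_eventually)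
    qed
  qed measurable
  then have "(\<lambda>n. (nrm M (\<lambda>x. indicator (B n) x * u x))\<^sup>2) \<longlonglongrightarrow> 0" by (simp add: nrm_square)
  from tendsto_real_sqrt[OF this] have "(\<lambda>n. nrm M (\<lambda>x. indicator (B n) x * u x)) \<longlonglongrightarrow> 0" by simp
  moreover have "0 < e / 2" using e by simp
  ultimately have "\<forall>\<^sub>F n in sequentially. nrm M (\<lambda>x. indicator (B n) x * u x) < e / 2" by (rule order_tendstoD(2))
  from eventually_happens'[OF sequentially_bot this]
  obtain K where K: "nrm M (\<lambda>x. indicator (B K) x * u x) < e / 2" by (rule exE)
  define \<delta> where "\<delta> = (e / (2 * (real K + 1)))\<^sup>2"
  have "nrm M (\<lambda>x. indicator A x * u x) < e" if A[measurable]: "A \<in> sets M" and small: "measure (weighted M h) A < \<delta>" for A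
  proof -
    have "nrm M (\<lambda>x. indicator A x * of_real (h x)) < e / (2 * (real K + 1))"
    proof (rule power2_less_imp_less)
      show "(nrm M (\<lambda>x. indicator A x * of_real (h x)))\<^sup>2 < (e / (2 * (real K + 1)))\<^sup>2"
        using small by (simp only: measure_weighted[OF A] \<delta>_def)
      show "0 \<le> e / (2 * (real K + 1))" using e by simp
    qed
    then have "(real K + 1) * nrm M (\<lambda>x. indicator A x * of_real (h x)) < (real K + 1) * (e / (2 * (real K + 1)))"
      by (rule mult_strict_left_mono) simp
    moreover have "(real K + 1) * (e / (2 * (real K + 1))) = e / 2" by (simp add: field_simps)
    ultimately have *: "(real K + 1) * nrm M (\<lambda>x. indicator A x * of_real (h x)) < e / 2"
      by linarith
    let ?v = "\<lambda>x. indicator (A - B K) x * u x"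
    have "nrm M ?v \<le> (real K + 1) * nrm M (\<lambda>x. indicator A x * of_real (h x))"
    proof (rule nrm_mono_AE[OF sq_cut[OF h_sq A]])
      show "AE x in M. cmod (?v x) \<le> (real K + 1) * cmod (indicator A x * of_real (h x))"
      proof (rule AE_I2)
        fix x assume x: "x \<in> space M"
        have "cmod (u x) \<le> (real K + 1) * h x" if "x \<notin> B K"
          using that x h_pos[OF x] by (simp add: B_def distrib_right)
        then show "cmod (?v x) \<le> (real K + 1) * cmod (indicator A x * of_real (h x))"
          using x h_pos[OF x] by (auto simp: indicator_def)
      qed
    qed auto
    moreover have "nrm M (\<lambda>x. indicator (A \<inter> B K) x * u x) \<le> 1 * nrm M (\<lambda>x. indicator (B K) x * u x)"
      by (rule nrm_mono_AE[OF sq_cut[OF u]]) (auto simp: indicator_def)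
    moreover have "nrm M (\<lambda>x. indicator A x * u x) \<le> nrm M ?v + nrm M (\<lambda>x. indicator (A \<inter> B K) x * u x)"
    proof -
      have "(\<lambda>x. indicator A x * u x) = (\<lambda>x. ?v x + indicator (A \<inter> B K) x * u x)"
        by (auto simp: indicator_def)
      then show ?thesis using nrm_triangle[of ?v M "\<lambda>x. indicator (A \<inter> B K) x * u x"] sq_cut[OF u] by simp
    qed
    ultimately show ?thesis using * K by linarith
  qed
  moreover have "0 < \<delta>" using e by (simp add: \<delta>_def)
  ultimately show ?thesis by blast
qed

end

lemma ex_weight_locale:
  assumes "sigma_finite_measure M" obtains h where "weight M h"
  using ex_weight[OF assms] unfolding weight_def by metis

text \<open>
  Choose countably many members of the family whose joint support has maximal weight; a further member
  cannot add anything to it.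
\<close>

lemma essential_support:
  fixes G :: "('a \<Rightarrow> complex) set"
  assumes sf: "sigma_finite_measure M" and G: "G \<subseteq> borel_measurable M" and ne: "G \<noteq> {}"
  shows "\<exists>s :: nat \<Rightarrow> 'a \<Rightarrow> complex. range s \<subseteq> G \<and> (\<forall>g\<in>G. AE x in M. g x \<noteq> 0 \<longrightarrow> (\<exists>n. s n x \<noteq> 0))"
proof -
  obtain h where "weight M h" using ex_weight_locale[OF sf] .
  then interpret weight M h .
  interpret D: finite_measure "weighted M h" by (rule finite_weighted)
  let ?D = "weighted M h"
  define U where "U s = (\<Union>n. {x \<in> space M. s n x \<noteq> 0})" for s :: "nat \<Rightarrow> 'a \<Rightarrow> complex"
  have Us: "U s \<in> sets M" if "range s \<subseteq> G" for s
  proof -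
    have [measurable]: "s n \<in> borel_measurable M" for n using that G by auto
    show ?thesis unfolding U_def by measurable
  qed
  define X where "X = {s :: nat \<Rightarrow> 'a \<Rightarrow> complex. range s \<subseteq> G}"
  define L where "L = (SUP s\<in>X. measure ?D (U s))"
  have Xne: "X \<noteq> {}" using ne by (auto simp: X_def intro!: exI[of _ "\<lambda>_. SOME g. g \<in> G"] some_in_eq[THEN iffD2])
  have bdd: "bdd_above ((\<lambda>s. measure ?D (U s)) ` X)"
    using D.bounded_measure by (intro bdd_aboveI[of _ "measure ?D (space ?D)"]) auto
  have le_L: "measure ?D (U s) \<le> L" if "s \<in> X" for s
    unfolding L_def using bdd that by (intro cSUP_upper)
  have "\<exists>s\<in>X. L - 1 / Suc k < measure ?D (U s)" for k
  proof -
    have "L - 1 / Suc k < L" by simp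
    then show ?thesis unfolding L_def by (subst (asm) less_cSUP_iff[OF Xne bdd]) auto
  qed
  then obtain S where S: "\<And>k. S k \<in> X" and SL: "\<And>k. L - 1 / Suc k < measure ?D (U (S k))" by metis
  \<comment> \<open>The supremum is attained by merging countably many nearly optimal sequences into one.\<close>
  define s where "s n = S (fst (prod_decode n)) (snd (prod_decode n))" for n
  have sX: "s \<in> X" using S unfolding X_def s_def by blast
  have sub: "U (S k) \<subseteq> U s" for k
  proof
    fix x assume "x \<in> U (S k)"
    then obtain n where "x \<in> space M" "S k n x \<noteq> 0" by (auto simp: U_def)
    then have "s (prod_encode (k, n)) x \<noteq> 0" by (simp add: s_def)
    then show "x \<in> U s" using \<open>x \<in> space M\<close> unfolding U_def by blast
  qed
  have "L \<le> measure ?D (U s)"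
  proof (rule LIMSEQ_le_const2)
    show "(\<lambda>k. L - 1 / Suc k) \<longlonglongrightarrow> L"
      using tendsto_diff[OF tendsto_const LIMSEQ_Suc[OF lim_1_over_n], of L] by simp
    have "L - 1 / Suc k \<le> measure ?D (U s)" for k
      using SL[of k] D.finite_measure_mono[OF sub[of k]] Us[of s] sX by (force simp: X_def)
    then show "\<exists>N. \<forall>n\<ge>N. L - 1 / Suc n \<le> measure ?D (U s)" by blast
  qed
  have "AE x in M. g x \<noteq> 0 \<longrightarrow> (\<exists>n. s n x \<noteq> 0)" if g: "g \<in> G" for g
  proof -
    define s' where "s' = case_nat g s"
    have s'X: "s' \<in> X" using sX g by (simp add: X_def s'_def image_subset_iff split: nat.splits)
    have U': "U s \<subseteq> U s'"
    proof
      fix x assume "x \<in> U s"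
      then obtain n where "x \<in> space M" "s n x \<noteq> 0" by (auto simp: U_def)
      then have "s' (Suc n) x \<noteq> 0" by (simp add: s'_def)
      then show "x \<in> U s'" using \<open>x \<in> space M\<close> unfolding U_def by blast
    qed
    have sets: "U s \<in> sets M" "U s' \<in> sets M" using sX s'X Us by (auto simp: X_def)
    have "measure ?D (U s' - U s) = measure ?D (U s') - measure ?D (U s)"
      using sets U' by (intro D.finite_measure_Diff) auto
    also have "\<dots> \<le> 0" using le_L[OF s'X] \<open>L \<le> _\<close> by simp
    finally have "measure ?D (U s' - U s) = 0" by (simp add: measure_le_0_iff)
    from null_weighted[OF _ this] have "AE x in M. x \<notin> U s' - U s" using sets by auto
    then show ?thesis using AE_space
    proof eventually_elim
      case (elim x)
      show ?case
      proof
        assume "g x \<noteq> 0"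
        then have "s' 0 x \<noteq> 0" by (simp add: s'_def)
        then have "x \<in> U s'" using elim unfolding U_def by blast
        then show "\<exists>n. s n x \<noteq> 0" using elim by (auto simp: U_def)
      qed
    qed
  qed
  then show ?thesis using sX by (auto simp: X_def)
qed

text \<open>
  Testing with the phase of \<open>u\<close> times the conjugate of \<open>v\<close> makes the integrand equal to the absolute
  value of this product.
\<close>

lemma disjoint_supports:
  assumes u: "u \<in> SQ M" and v: "v \<in> SQ M" and z: "\<And>\<psi>. bmult M \<psi> \<Longrightarrow> ip M u (\<lambda>x. \<psi> x * v x) = 0"
  shows "AE x in M. u x = 0 \<or> v x = 0"
proof -
  have [measurable]: "u \<in> borel_measurable M" "v \<in> borel_measurable M" using u v by (auto simp: sq_integrable_def)
  define \<psi> where "\<psi> x = sgn (u x * cnj (v x))" for x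
  have sgn_alt: "sgn z = z / of_real (cmod z)" for z :: complex by (simp add: sgn_eq)
  have "bmult M \<psi>" unfolding bmult_def \<psi>_def[abs_def] sgn_alt
    by (auto simp: norm_divide intro!: exI[of _ 1])
  from z[OF this] have "(\<integral>x. u x * cnj (\<psi> x * v x) \<partial>M) = 0" by (simp add: ip_def)
  moreover have "u x * cnj (\<psi> x * v x) = complex_of_real (cmod (u x * cnj (v x)))" for x
  proof -
    let ?w = "u x * cnj (v x)"
    have "u x * cnj (\<psi> x * v x) = ?w * cnj (sgn ?w)" by (simp add: \<psi>_def)
    also have "\<dots> = complex_of_real (cmod ?w)"
      by (cases "?w = 0") (simp_all add: sgn_alt complex_norm_square[symmetric] power2_eq_square field_simps del: complex_cnj_mult)
    finally show ?thesis .
  qed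
  ultimately have "complex_of_real (\<integral>x. cmod (u x * cnj (v x)) \<partial>M) = 0"
    by (simp only: integral_complex_of_real)
  then have "(\<integral>x. cmod (u x * cnj (v x)) \<partial>M) = 0" by (simp only: of_real_eq_0_iff)
  then have "AE x in M. cmod (u x * cnj (v x)) = 0"
    using integral_nonneg_eq_0_iff_AE[OF integrable_norm[OF integrable_ip[OF u v]]] by simp
  then show ?thesis by eventually_elim auto
qed

text \<open>
  The sets in the finite algebra generated by \<open>B 0, \<dots>, B (n - 1)\<close>, each given by the membership patterns
  which it admits.
\<close>

definition cyl :: "'a set \<Rightarrow> (nat \<Rightarrow> 'a set) \<Rightarrow> nat \<Rightarrow> nat set set \<Rightarrow> 'a set" where
  "cyl \<Omega> B n S = {x \<in> \<Omega>. {i. i < n \<and> x \<in> B i} \<in> S}"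

lemma cyl_raise: "n \<le> m \<Longrightarrow> cyl \<Omega> B n S = cyl \<Omega> B m {t. t \<inter> {..<n} \<in> S}"
proof -
  assume "n \<le> m"
  then have "{i. i < m \<and> x \<in> B i} \<inter> {..<n} = {i. i < n \<and> x \<in> B i}" for x by auto
  then show ?thesis by (simp add: cyl_def)
qed

lemma cyl_in_sets:
  assumes "\<And>i. B i \<in> sets M" shows "cyl (space M) B n S \<in> sets M"
proof -
  have "cyl (space M) B n S = (\<Union>t\<in>S \<inter> Pow {..<n}. {x \<in> space M. \<forall>i<n. (x \<in> B i) = (i \<in> t)})"
  proof (intro equalityI subsetI)
    fix x assume "x \<in> cyl (space M) B n S"
    then show "x \<in> (\<Union>t\<in>S \<inter> Pow {..<n}. {x \<in> space M. \<forall>i<n. (x \<in> B i) = (i \<in> t)})"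
      by (intro UN_I[of "{i. i < n \<and> x \<in> B i}"]) (auto simp: cyl_def)
  next
    fix x assume "x \<in> (\<Union>t\<in>S \<inter> Pow {..<n}. {x \<in> space M. \<forall>i<n. (x \<in> B i) = (i \<in> t)})"
    then obtain t where t: "t \<in> S" "t \<subseteq> {..<n}" "x \<in> space M" "\<forall>i<n. (x \<in> B i) = (i \<in> t)" by auto
    then have "{i. i < n \<and> x \<in> B i} = t" by auto
    then show "x \<in> cyl (space M) B n S" using t by (simp add: cyl_def)
  qed
  moreover have "finite (S \<inter> Pow {..<n})" by (rule finite_subset[of _ "Pow {..<n}"]) auto
  ultimately show ?thesis using assms by auto
qed

text \<open>
  The sets that can be approximated by cylinders form a \<open>\<sigma>\<close>-algebra.
\<close>

lemma (in finite_measure) cylinders_dense: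
  fixes B :: "nat \<Rightarrow> 'a set"
  assumes gen: "sets M = sigma_sets (space M) (range B)" and e: "0 < e" and A: "A \<in> sets M"
  shows "\<exists>n S. measure M (sym_diff A (cyl (space M) B n S)) < e"
proof -
  let ?cyl = "cyl (space M) B"
  have Bs: "B i \<in> sets M" for i using gen by (auto intro: sigma_sets.Basic)
  note cyl_sets = cyl_in_sets[OF Bs]
  have union: "\<exists>n S. ?cyl n1 S1 \<union> ?cyl n2 S2 = ?cyl n S" for n1 S1 n2 S2
  proof -
    have "?cyl n1 S1 \<union> ?cyl n2 S2 = ?cyl (max n1 n2) ({t. t \<inter> {..<n1} \<in> S1} \<union> {t. t \<inter> {..<n2} \<in> S2})"
      unfolding cyl_raise[of n1 "max n1 n2", OF max.cobounded1] cyl_raise[of n2 "max n1 n2", OF max.cobounded2]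
      by (auto simp: cyl_def)
    then show ?thesis by blast
  qed
  have "A \<in> sigma_sets (space M) (range B)" using A gen by simp
  then show ?thesis using e
  proof (induction arbitrary: e)
    case (Basic a)
    then obtain i where a: "a = B i" by blast
    then have "a = ?cyl (Suc i) {t. i \<in> t}" using sets.sets_into_space[OF Bs] by (auto simp: cyl_def)
    then have "sym_diff a (?cyl (Suc i) {t. i \<in> t}) = {}" by blast
    then show ?case using Basic by (metis measure_empty)
  next
    case Empty
    have "sym_diff {} (?cyl 0 {}) = {}" by (simp add: cyl_def)
    then show ?case using Empty by (metis measure_empty)
  next
    case (Compl a)
    then obtain n S where nS: "measure M (sym_diff a (?cyl n S)) < e" by blast
    have "a \<subseteq> space M" using Compl.hyps gen sets.sets_into_space by blast
    then have "sym_diff (space M - a) (?cyl n (- S)) = sym_diff a (?cyl n S)"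
      by (auto simp: cyl_def)
    then show ?case using nS by metis
  next
    case (Union a)
    have as: "a i \<in> sets M" for i using Union.hyps gen by simp
    define U where "U k = (\<Union>i<k. a i)" for k
    have Us: "U k \<in> sets M" for k using as by (auto simp: U_def)
    have inc: "incseq U" unfolding incseq_def U_def by (auto intro: less_le_trans)
    have UN: "(\<Union>k. U k) = (\<Union>i. a i)" unfolding U_def by auto
    have "(\<lambda>k. measure M (U k)) \<longlonglongrightarrow> measure M (\<Union>i. a i)"
      using finite_Lim_measure_incseq[OF _ inc] Us UN by auto
    from LIMSEQ_D[OF this, of "e/2"] obtain k where k: "\<bar>measure M (U k) - measure M (\<Union>i. a i)\<bar> < e / 2"
      using Union.prems by auto
    have "\<exists>n S. measure M (sym_diff (U k) (?cyl n S)) < d" if "0 < d" for d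
      using that
    proof (induction k arbitrary: d)
      case 0
      have "sym_diff (U 0) (?cyl 0 {}) = {}" by (simp add: U_def cyl_def)
      then show ?case using 0 by (metis measure_empty)
    next
      case (Suc k)
      obtain n1 S1 where 1: "measure M (sym_diff (U k) (?cyl n1 S1)) < d / 2" using Suc by (meson half_gt_zero)
      obtain n2 S2 where 2: "measure M (sym_diff (a k) (?cyl n2 S2)) < d / 2"
        using Union.IH Suc.prems by (meson half_gt_zero)
      obtain n S where 3: "?cyl n1 S1 \<union> ?cyl n2 S2 = ?cyl n S" using union by blast
      have "U (Suc k) = U k \<union> a k" by (auto simp: U_def lessThan_Suc)
      then have "sym_diff (U (Suc k)) (?cyl n S) \<subseteq> sym_diff (U k) (?cyl n1 S1) \<union> sym_diff (a k) (?cyl n2 S2)"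
        unfolding 3[symmetric] by blast
      then have "measure M (sym_diff (U (Suc k)) (?cyl n S))
          \<le> measure M (sym_diff (U k) (?cyl n1 S1) \<union> sym_diff (a k) (?cyl n2 S2))"
        using Us as cyl_sets by (intro finite_measure_mono) auto
      also have "\<dots> \<le> measure M (sym_diff (U k) (?cyl n1 S1)) + measure M (sym_diff (a k) (?cyl n2 S2))"
        using Us as cyl_sets by (intro measure_Un_le) auto
      finally have "measure M (sym_diff (U (Suc k)) (?cyl n S)) < d" using 1 2 by linarith
      then show ?case by blast
    qed
    from this[of "e/2"] obtain n S where nS: "measure M (sym_diff (U k) (?cyl n S)) < e / 2"
      using Union.prems by auto
    have sub: "U k \<subseteq> (\<Union>i. a i)" using UN by blast
    have "sym_diff (\<Union>i. a i) (?cyl n S) \<subseteq> ((\<Union>i. a i) - U k) \<union> sym_diff (U k) (?cyl n S)"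
      using sub by blast
    then have "measure M (sym_diff (\<Union>i. a i) (?cyl n S)) \<le> measure M (((\<Union>i. a i) - U k) \<union> sym_diff (U k) (?cyl n S))"
      using Us as cyl_sets by (intro finite_measure_mono) auto
    also have "\<dots> \<le> measure M ((\<Union>i. a i) - U k) + measure M (sym_diff (U k) (?cyl n S))"
      using Us as cyl_sets by (intro measure_Un_le) auto
    also have "measure M ((\<Union>i. a i) - U k) = measure M (\<Union>i. a i) - measure M (U k)"
      using Us as sub by (intro finite_measure_Diff) auto
    finally have "measure M (sym_diff (\<Union>i. a i) (?cyl n S)) < e" using nS k by linarith
    then show ?case by blast
  qed
qed

text \<open>
  A subfamily of a separable family is separable: for every cylinder and every precision pick a member
  of the subfamily close to the cylinder, if there is one.
\<close>

lemma (in finite_measure) countable_dense_subfamily: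
  fixes B :: "nat \<Rightarrow> 'a set"
  assumes gen: "sets M = sigma_sets (space M) (range B)" and L: "L \<subseteq> sets M" "L \<noteq> {}"
  shows "\<exists>\<alpha> :: nat \<Rightarrow> 'a set. range \<alpha> \<subseteq> L \<and> (\<forall>A\<in>L. \<forall>e>0. \<exists>n. measure M (sym_diff A (\<alpha> n)) < e)"
proof -
  let ?cyl = "cyl (space M) B"
  define \<C> where "\<C> = (\<lambda>(n, S). ?cyl n S) ` (SIGMA n:UNIV. Pow (Pow {..<n}))"
  have "countable \<C>" unfolding \<C>_def by (intro countable_image countable_SIGMA) (auto intro: countable_finite)
  moreover have cylC: "?cyl n S \<in> \<C>" for n S
  proof -
    have "?cyl n S = ?cyl n (S \<inter> Pow {..<n})" by (auto simp: cyl_def)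
    then show ?thesis unfolding \<C>_def by (force intro!: image_eqI[of _ _ "(n, S \<inter> Pow {..<n})"])
  qed
  ultimately obtain c :: "nat \<Rightarrow> 'a set" where c: "range c = \<C>"
    using uncountable_def by (metis empty_iff)
  have "B i \<in> sets M" for i using gen by (auto intro: sigma_sets.Basic)
  then have Cs: "C \<in> sets M" if "C \<in> \<C>" for C
    using that cyl_in_sets[of B M] by (auto simp: \<C>_def)
  define \<alpha> where "\<alpha> m = (let i = fst (prod_decode m); k = snd (prod_decode m) in
      if \<exists>A\<in>L. measure M (sym_diff A (c i)) < 1 / Suc k
      then SOME A. A \<in> L \<and> measure M (sym_diff A (c i)) < 1 / Suc k else SOME A. A \<in> L)" for m
  have aL: "\<alpha> m \<in> L" for m
  proof (cases "\<exists>A\<in>L. measure M (sym_diff A (c (fst (prod_decode m)))) < 1 / Suc (snd (prod_decode m))")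
    case True
    then have "\<exists>A. A \<in> L \<and> measure M (sym_diff A (c (fst (prod_decode m)))) < 1 / Suc (snd (prod_decode m))" by blast
    from someI_ex[OF this] show ?thesis using True by (simp add: \<alpha>_def Let_def)
  next
    case False
    then show ?thesis using L(2) by (simp add: \<alpha>_def Let_def some_in_eq)
  qed
  have "\<exists>n. measure M (sym_diff A (\<alpha> n)) < e" if A: "A \<in> L" and e: "0 < e" for A e
  proof -
    obtain k where k: "1 / Suc k < e / 2" using e by (metis half_gt_zero nat_approx_posE)
    obtain n S where "measure M (sym_diff A (?cyl n S)) < 1 / Suc k"
      using cylinders_dense[OF gen, of "1 / Suc k" A] A L(1) by auto
    then obtain i where i: "measure M (sym_diff A (c i)) < 1 / Suc k" using cylC[of n S] c by (metis imageE)
    let ?m = "prod_encode (i, k)"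
    have ex: "\<exists>A. A \<in> L \<and> measure M (sym_diff A (c i)) < 1 / Suc k" using A i by blast
    then have "\<alpha> ?m = (SOME A. A \<in> L \<and> measure M (sym_diff A (c i)) < 1 / Suc k)"
      by (auto simp: \<alpha>_def Let_def)
    with someI_ex[OF ex] have am: "measure M (sym_diff (\<alpha> ?m) (c i)) < 1 / Suc k" by simp
    have "sym_diff A (\<alpha> ?m) \<subseteq> sym_diff A (c i) \<union> sym_diff (\<alpha> ?m) (c i)" by blast
    moreover have "A \<in> sets M" "\<alpha> ?m \<in> sets M" "c i \<in> sets M" using A L(1) aL Cs c by auto
    ultimately have "measure M (sym_diff A (\<alpha> ?m)) \<le> measure M (sym_diff A (c i)) + measure M (sym_diff (\<alpha> ?m) (c i))"
      by (intro order_trans[OF finite_measure_mono measure_Un_le]) auto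
    then show ?thesis using i am k by (intro exI[of _ ?m]) linarith
  qed
  then show ?thesis using aL by blast
qed

context weight
begin

text \<open>
  The projections that commute with a fixed operator are closed under approximation of sets in
  weight, by absolute continuity of the norms of \<open>f\<close> and \<open>R f\<close>.
\<close>

lemma commutes_indicator_approx:
  assumes R: "aeop M M R" and A: "A \<in> sets M"
    and \<alpha>: "\<And>n. \<alpha> n \<in> sets M" "\<And>n. commutes_mult M R (indicator (\<alpha> n))"
    and dense: "\<And>e. 0 < e \<Longrightarrow> \<exists>n. measure (weighted M h) (sym_diff A (\<alpha> n)) < e"
  shows "commutes_mult M R (indicator A)"
  unfolding commutes_mult_def
proof
  fix f assume f: "f \<in> SQ M"
  obtain C where C: "C > 0" "\<And>f. f \<in> SQ M \<Longrightarrow> nrm M (R f) \<le> C * nrm M f" using aeop_bound[OF R] by blast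
  note Rf = aeop_sq[OF R f]
  let ?Af = "\<lambda>x. indicator A x * f x" and ?ARf = "\<lambda>x. indicator A x * R f x"
  have S: "?Af \<in> SQ M" "?ARf \<in> SQ M" using f Rf A by (auto intro: sq_cut)
  have "nrm M (\<lambda>x. R ?Af x - ?ARf x) \<le> (C + 1) * e" if e: "0 < e" for e
  proof -
    obtain \<delta>1 where d1: "0 < \<delta>1" "\<And>A. A \<in> sets M \<Longrightarrow> measure (weighted M h) A < \<delta>1 \<Longrightarrow> nrm M (\<lambda>x. indicator A x * f x) < e"
      using small_weight_small_norm[OF f e] by blast
    obtain \<delta>2 where d2: "0 < \<delta>2" "\<And>A. A \<in> sets M \<Longrightarrow> measure (weighted M h) A < \<delta>2 \<Longrightarrow> nrm M (\<lambda>x. indicator A x * R f x) < e"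
      using small_weight_small_norm[OF Rf e] by blast
    obtain n where n: "measure (weighted M h) (sym_diff A (\<alpha> n)) < min \<delta>1 \<delta>2"
      using dense[of "min \<delta>1 \<delta>2"] d1 d2 by auto
    have D: "sym_diff A (\<alpha> n) \<in> sets M" using A \<alpha> by auto
    let ?Bf = "\<lambda>x. indicator (\<alpha> n) x * f x" and ?BRf = "\<lambda>x. indicator (\<alpha> n) x * R f x"
    have SB: "?Bf \<in> SQ M" "?BRf \<in> SQ M" using f Rf \<alpha> by (auto intro: sq_cut)
    have dn: "nrm M (\<lambda>x. indicator A x * g x - indicator (\<alpha> n) x * g x) \<le> 1 * nrm M (\<lambda>x. indicator (sym_diff A (\<alpha> n)) x * g x)"
      if g: "g \<in> SQ M" for g
      by (rule nrm_mono_AE[OF sq_cut[OF g D]])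
        (use sq_measurable[OF sq_diff[OF sq_cut[OF g A] sq_cut[OF g \<alpha>(1)[of n]]]] in \<open>auto simp: indicator_def\<close>)
    let ?d = "\<lambda>x. ?Af x - ?Bf x" and ?e = "\<lambda>x. ?ARf x - ?BRf x"
    have dS: "?d \<in> SQ M" and eS: "?e \<in> SQ M" using S SB by (auto intro: sq_diff)
    have "nrm M (\<lambda>x. R ?Af x - ?ARf x) = nrm M (\<lambda>x. R ?d x + (-1) * ?e x)"
    proof (rule nrm_cong_AE)
      show "AE x in M. R ?Af x - ?ARf x = R ?d x + (-1) * ?e x"
        using aeop_diff[OF R S(1) SB(1)] commutes_multD[OF \<alpha>(2)[of n] f] by eventually_elim simp
    qed (intro sq_measurable sq_diff sq_add sq_scale aeop_sq[OF R] S dS eS)+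
    also have "\<dots> \<le> nrm M (R ?d) + nrm M ?e"
      using nrm_triangle[OF aeop_sq[OF R dS] sq_scale[OF eS, of "-1"]] nrm_scale[of M "-1" ?e] by simp
    also have "\<dots> \<le> C * e + e"
    proof (rule add_mono)
      have "nrm M ?d \<le> e" using dn[OF f] d1(2)[OF D] n by simp
      then show "nrm M (R ?d) \<le> C * e" using C(2)[OF dS] mult_left_mono[of "nrm M ?d" e C] C(1) by linarith
      show "nrm M ?e \<le> e" using dn[OF Rf] d2(2)[OF D] n by simp
    qed
    finally show ?thesis by (simp add: distrib_right)
  qed
  note est = this
  have "nrm M (\<lambda>x. R ?Af x - ?ARf x) \<le> 0 + e" if "0 < e" for e
  proof -
    have "0 < e / (C + 1)" using that C(1) by simp
    from est[OF this] show ?thesis using C(1) by simp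
  qed
  then have "nrm M (\<lambda>x. R ?Af x - ?ARf x) \<le> 0" by (rule field_le_epsilon)
  then have "nrm M (\<lambda>x. R ?Af x - ?ARf x) = 0" using nrm_nonneg[of M] by (intro antisym) auto
  then show "AE x in M. R ?Af x = ?ARf x" by (simp add: AE_eq_iff_nrm[OF aeop_sq[OF R S(1)] S(2)])
qed

end

section \<open>Matrix entries and intertwining of projections\<close>

lemma aeop_tens: assumes sf: "sigma_finite_measure M" shows "aeop M (seq_meas M) (\<lambda>f. tens f j)"
proof -
  have "tens (\<lambda>x. f x + g x) j = (\<lambda>z. tens f j z + tens g j z)" for f g :: "'a \<Rightarrow> complex"
    by (auto simp: tens_def fun_eq_iff)
  moreover have "tens (\<lambda>x. c * f x) j = (\<lambda>z. c * tens f j z)" for c and f :: "'a \<Rightarrow> complex"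
    by (auto simp: tens_def fun_eq_iff)
  moreover have "\<exists>C. \<forall>f\<in>SQ M. nrm (seq_meas M) (tens f j) \<le> C * nrm M f"
    by (intro exI[of _ 1]) (simp add: nrm_tens[OF sf])
  ultimately show ?thesis using sq_tens[OF sf] by (simp add: aeop_def)
qed

lemma aeop_slice: assumes sf: "sigma_finite_measure M" shows "aeop (seq_meas M) M (\<lambda>F. slice F i)"
proof -
  have "nrm M (slice F i) \<le> nrm (seq_meas M) F" if F: "F \<in> SQ (seq_meas M)" for F
  proof (rule power2_le_imp_le)
    have "(\<Sum>n\<in>{i}. (nrm M (slice F n))\<^sup>2) \<le> (\<Sum>n. (nrm M (slice F n))\<^sup>2)"
      using nrm_seq_sums[OF sf F] by (intro sum_le_suminf) (auto simp: sums_iff)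
    then show "(nrm M (slice F i))\<^sup>2 \<le> (nrm (seq_meas M) F)\<^sup>2"
      using nrm_seq_sums[OF sf F] by (simp add: sums_iff)
  qed simp
  then have "\<exists>C. \<forall>F\<in>SQ (seq_meas M). nrm M (slice F i) \<le> C * nrm (seq_meas M) F"
    by (intro exI[of _ 1]) simp
  then show ?thesis using sq_slice[OF sf] by (simp add: aeop_def slice_add slice_scale)
qed

lemma AE_slice:
  assumes sf: "sigma_finite_measure M" and F: "F \<in> SQ (seq_meas M)" and G: "G \<in> SQ (seq_meas M)"
    and "AE z in seq_meas M. F z = G z"
  shows "AE x in M. slice F n x = slice G n x"
  using assms AE_seq_eq_iff by blast

lemma amp_tens:
  assumes sf: "sigma_finite_measure M" and R: "aeop M M R" and f: "f \<in> SQ M"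
  shows "AE z in seq_meas M. amp R (tens f j) z = tens (R f) j z"
proof -
  have S: "amp R (tens f j) \<in> SQ (seq_meas M)" "tens (R f) j \<in> SQ (seq_meas M)"
    using aeop_sq[OF aeop_amp[OF sf sf R] sq_tens[OF sf f]] sq_tens[OF sf aeop_sq[OF R f]] by auto
  show ?thesis
    unfolding AE_seq_eq_iff[OF sf S] slice_amp slice_tens using aeop_zero[OF R] by auto
qed

lemma lin_sub_orbit:
  fixes \<R> :: "(('a \<Rightarrow> complex) \<Rightarrow> 'b \<Rightarrow> complex) set"
  assumes sfM: "sigma_finite_measure M" and sfN: "sigma_finite_measure N"
    and op: "\<And>R. R \<in> \<R> \<Longrightarrow> aeop M N R" and zero: "(\<lambda>f y. 0) \<in> \<R>"
    and add: "\<And>R S. R \<in> \<R> \<Longrightarrow> S \<in> \<R> \<Longrightarrow> (\<lambda>f y. R f y + S f y) \<in> \<R>"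
    and scale: "\<And>R c. R \<in> \<R> \<Longrightarrow> (\<lambda>f y. c * R f y) \<in> \<R>"
    and \<xi>: "\<xi> \<in> SQ (seq_meas M)"
  shows "lin_sub (seq_meas N) ((\<lambda>R. amp R \<xi>) ` \<R>)" (is "lin_sub ?N ?V")
  unfolding lin_sub_def
proof (intro conjI ballI allI)
  show "?V \<subseteq> SQ ?N" using aeop_sq[OF aeop_amp[OF sfM sfN op] \<xi>] by blast
  have "amp (\<lambda>f x. 0) \<xi> = (\<lambda>z :: nat \<times> 'b. 0)" by (auto simp: amp_def)
  with imageI[OF zero, of "\<lambda>R. amp R \<xi>"] show "(\<lambda>z. 0) \<in> ?V" by (simp only:)
  fix F assume "F \<in> ?V"
  then obtain A where A: "A \<in> \<R>" "F = amp A \<xi>" by blast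
  have "(\<lambda>z. c * F z) = amp (\<lambda>f x. c * A f x) \<xi>" for c unfolding A(2) by (auto simp: amp_def)
  then show "(\<lambda>z. c * F z) \<in> ?V" for c using scale[OF A(1)] by blast
  fix G assume "G \<in> ?V"
  then obtain B where B: "B \<in> \<R>" "G = amp B \<xi>" by blast
  have "(\<lambda>z. F z + G z) = amp (\<lambda>f x. A f x + B f x) \<xi>" unfolding A(2) B(2) by (auto simp: amp_def)
  then show "(\<lambda>z. F z + G z) \<in> ?V" using add[OF A(1) B(1)] by blast
qed

definition intertwines ::
  "'a measure \<Rightarrow> 'b measure \<Rightarrow> (('a \<Rightarrow> complex) \<Rightarrow> 'b \<Rightarrow> complex) \<Rightarrow> 'a set \<Rightarrow> 'b set \<Rightarrow> bool" where
  "intertwines M N R \<alpha> \<beta> \<longleftrightarrow>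
     (\<forall>f\<in>SQ M. AE y in N. R (\<lambda>x. indicator \<alpha> x * f x) y = indicator \<beta> y * R f y)"

lemma intertwines_adjoint:
  assumes R: "adjp M N R S" and i: "intertwines M N R \<alpha> \<beta>" and s: "\<alpha> \<in> sets M" "\<beta> \<in> sets N"
  shows "intertwines N M S \<beta> \<alpha>"
  unfolding intertwines_def
proof
  fix g assume g: "g \<in> SQ N"
  note S = adjp_sym[OF R] and opR = adjp_aeop[OF R] and opS = adjp_aeop'[OF R]
  show "AE x in M. S (\<lambda>y. indicator \<beta> y * g y) x = indicator \<alpha> x * S g x"
  proof (rule AE_eqI_ip)
    fix k assume k: "k \<in> SQ M"
    have "ip M (S (\<lambda>y. indicator \<beta> y * g y)) k = ip N g (\<lambda>y. indicator \<beta> y * R k y)"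
      by (simp only: adjpD[OF S sq_cut[OF g s(2)] k] ip_cut_move)
    also have "\<dots> = ip N g (R (\<lambda>x. indicator \<alpha> x * k x))"
      using i k by (intro ip_cong_AE sq_measurable g sq_cut aeop_sq[OF opR] s) (auto simp: intertwines_def elim: eventually_mono)
    also have "\<dots> = ip M (\<lambda>x. indicator \<alpha> x * S g x) k"
      by (simp only: adjpD[OF S g sq_cut[OF k s(1)], symmetric] ip_cut_move)
    finally show "ip M (S (\<lambda>y. indicator \<beta> y * g y)) k = ip M (\<lambda>x. indicator \<alpha> x * S g x) k" .
  qed (intro sq_cut aeop_sq[OF opS] g s)+
qed

lemma intertwines_commutes: "intertwines M M R \<alpha> \<alpha> \<longleftrightarrow> commutes_mult M R (indicator \<alpha>)"
  by (simp add: intertwines_def commutes_mult_def)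

lemma intertwines_comp:
  assumes R: "aeop M N R" and S: "aeop N L S" and i: "intertwines M N R \<alpha> \<beta>" "intertwines N L S \<beta> \<gamma>"
    and s: "\<alpha> \<in> sets M" "\<beta> \<in> sets N"
  shows "intertwines M L (\<lambda>f. S (R f)) \<alpha> \<gamma>"
  unfolding intertwines_def
proof
  fix f assume f: "f \<in> SQ M"
  have "AE y in L. S (R (\<lambda>x. indicator \<alpha> x * f x)) y = S (\<lambda>y. indicator \<beta> y * R f y) y"
    by (rule aeop_cong[OF S]) (use i(1) f in \<open>auto simp: intertwines_def intro: sq_cut s aeop_sq[OF R]\<close>)
  moreover have "AE y in L. S (\<lambda>y. indicator \<beta> y * R f y) y = indicator \<gamma> y * S (R f) y"
    using i(2) aeop_sq[OF R f] by (simp add: intertwines_def)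
  ultimately show "AE y in L. S (R (\<lambda>x. indicator \<alpha> x * f x)) y = indicator \<gamma> y * S (R f) y"
    by eventually_elim simp
qed

section \<open>The density theorem\<close>

text \<open>
  A normalizing bimodule over the multiplication algebras, seen as a set of operators on functions that
  is saturated under equality almost everywhere.
\<close>

locale masa_tro =
  fixes M :: "'a measure" and N :: "'b measure" and \<U> :: "(('a \<Rightarrow> complex) \<Rightarrow> 'b \<Rightarrow> complex) set"
  assumes sfM: "sigma_finite_measure M" and sfN: "sigma_finite_measure N"
    and op: "\<And>R. R \<in> \<U> \<Longrightarrow> aeop M N R"
    and cong: "\<And>R R'. R \<in> \<U> \<Longrightarrow> aeop M N R' \<Longrightarrow> (\<And>f. f \<in> SQ M \<Longrightarrow> AE y in N. R' f y = R f y) \<Longrightarrow> R' \<in> \<U>"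
    and zero: "(\<lambda>f y. 0) \<in> \<U>"
    and add: "\<And>R S. R \<in> \<U> \<Longrightarrow> S \<in> \<U> \<Longrightarrow> (\<lambda>f y. R f y + S f y) \<in> \<U>"
    and scale: "\<And>c R. R \<in> \<U> \<Longrightarrow> (\<lambda>f y. c * R f y) \<in> \<U>"
    and left: "\<And>R \<psi>. R \<in> \<U> \<Longrightarrow> bmult N \<psi> \<Longrightarrow> (\<lambda>f y. \<psi> y * R f y) \<in> \<U>"
    and right: "\<And>R \<phi>. R \<in> \<U> \<Longrightarrow> bmult M \<phi> \<Longrightarrow> (\<lambda>f. R (\<lambda>x. \<phi> x * f x)) \<in> \<U>"
    and tro: "\<And>A B B' C. A \<in> \<U> \<Longrightarrow> B \<in> \<U> \<Longrightarrow> adjp M N B B' \<Longrightarrow> C \<in> \<U> \<Longrightarrow> (\<lambda>f. A (B' (C f))) \<in> \<U>"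
begin

text \<open>
  This algebra is larger than the span of the products \<open>S\<^sup>* T\<close>. The gain is that it contains the
  identity and all multiplications, so that a vector lies in its own cyclic subspace even if \<open>U\<close> is
  degenerate; still it is small enough that \<open>U \<A> \<subseteq> U\<close>.
\<close>

definition \<A> :: "(('a \<Rightarrow> complex) \<Rightarrow> 'a \<Rightarrow> complex) set" where
  "\<A> = {A. \<exists>A'. adjp M M A A' \<and> (\<forall>S\<in>\<U>. (\<lambda>f. S (A f)) \<in> \<U> \<and> (\<lambda>f. S (A' f)) \<in> \<U>)}"

lemma A_intro: "adjp M M A A' \<Longrightarrow> (\<And>S. S \<in> \<U> \<Longrightarrow> (\<lambda>f. S (A f)) \<in> \<U>) \<Longrightarrow> (\<And>S. S \<in> \<U> \<Longrightarrow> (\<lambda>f. S (A' f)) \<in> \<U>) \<Longrightarrow> A \<in> \<A>"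
  by (auto simp: \<A>_def)

lemma A_star: "A \<in> \<A> \<Longrightarrow> \<exists>A'\<in>\<A>. adjp M M A A'"
  unfolding \<A>_def using adjp_sym by blast

lemma A_op: "A \<in> \<A> \<Longrightarrow> aeop M M A"
  unfolding \<A>_def using adjp_aeop by blast

lemma U_A: "S \<in> \<U> \<Longrightarrow> A \<in> \<A> \<Longrightarrow> (\<lambda>f. S (A f)) \<in> \<U>"
  by (auto simp: \<A>_def)

lemma A_comp: assumes A: "A \<in> \<A>" and B: "B \<in> \<A>" shows "(\<lambda>f. A (B f)) \<in> \<A>"
proof -
  obtain A' B' where A': "A' \<in> \<A>" "adjp M M A A'" and B': "B' \<in> \<A>" "adjp M M B B'" using A_star A B by blast
  show ?thesis
    by (rule A_intro[OF adjp_comp[OF B'(2) A'(2)]]) (rule U_A[OF U_A], assumption, (rule A B A' B')+)+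
qed

lemma A_mult: "bmult M \<phi> \<Longrightarrow> (\<lambda>f x. \<phi> x * f x) \<in> \<A>"
  by (rule A_intro[OF adjp_bmult]) (auto intro: right bmult_cnj)

lemma A_id: "(\<lambda>f. f) \<in> \<A>"
  using A_mult[of "\<lambda>x. 1"] by simp

lemma A_zero: "(\<lambda>f x. 0) \<in> \<A>"
  using A_mult[of "\<lambda>x. 0"] by simp

lemma A_scale: assumes A: "A \<in> \<A>" shows "(\<lambda>f x. c * A f x) \<in> \<A>"
  using A_comp[OF A_mult[OF bmult_const[of M c]] A] .

lemma A_add: assumes A: "A \<in> \<A>" and B: "B \<in> \<A>" shows "(\<lambda>f x. A f x + B f x) \<in> \<A>"
proof -
  have plus: "(\<lambda>f. S (\<lambda>x. A f x + B f x)) \<in> \<U>" if A: "A \<in> \<A>" and B: "B \<in> \<A>" and S: "S \<in> \<U>" for A B S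
  proof (rule cong[OF add[OF U_A[OF S A] U_A[OF S B]]])
    show "aeop M N (\<lambda>f. S (\<lambda>x. A f x + B f x))"
      by (rule aeop_comp[OF aeop_plus[OF A_op[OF A] A_op[OF B]] op[OF S]])
    fix f assume f: "f \<in> SQ M"
    show "AE y in N. S (\<lambda>x. A f x + B f x) y = S (A f) y + S (B f) y"
      by (rule aeop_add[OF op[OF S] aeop_sq[OF A_op[OF A] f] aeop_sq[OF A_op[OF B] f]])
  qed
  obtain A' B' where A': "A' \<in> \<A>" "adjp M M A A'" and B': "B' \<in> \<A>" "adjp M M B B'" using A_star A B by blast
  show ?thesis
    by (rule A_intro[OF adjp_plus[OF A'(2) B'(2)]]) (rule plus, (rule A B A' B' | assumption)+)+
qed

lemma A_product:
  assumes S: "S \<in> \<U>" and T: "T \<in> \<U>" and S': "adjp M N S S'" and p: "bmult N \<psi>"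
  shows "(\<lambda>f. S' (\<lambda>y. \<psi> y * T f y)) \<in> \<A>"
proof -
  obtain T' where T': "adjp M N T T'" using adjoint_exists[OF sfM op[OF T]] by blast
  note pT = adjp_comp[OF T' adjp_bmult[OF p]]
  show ?thesis
  proof (rule A_intro[OF adjp_comp[OF pT adjp_sym[OF S']]])
    fix R assume R: "R \<in> \<U>"
    show "(\<lambda>f. R (S' (\<lambda>y. \<psi> y * T f y))) \<in> \<U>" by (rule tro[OF R S S' left[OF T p]])
    have "(\<lambda>f. R (T' ((\<lambda>g y. cnj (\<psi> y) * g y) (S f)))) \<in> \<U>"
      by (rule tro[OF R T T' left[OF S bmult_cnj[OF p]]])
    then show "(\<lambda>f. R (T' (\<lambda>y. cnj (\<psi> y) * S f y))) \<in> \<U>" .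
  qed
qed

definition comm_sets :: "'a set set" where
  "comm_sets = {\<alpha> \<in> sets M. \<forall>A\<in>\<A>. commutes_mult M A (indicator \<alpha>)}"

text \<open>
  For \<open>S1\<close>, \<open>S \<in> U\<close> the functions \<open>S1 1\<^bsub>\<alpha>\<^esub> g\<close> and \<open>\<psi> S 1\<^bsub>X - \<alpha>\<^esub> f\<close> are orthogonal because \<open>S1\<^sup>* \<psi> S\<close> lies in
  \<open>\<A>\<close> and commutes with \<open>1\<^bsub>\<alpha>\<^esub>\<close>. So the union of the supports of all functions \<open>S1 1\<^bsub>\<alpha>\<^esub> g\<close> is
  disjoint from the supports of all \<open>S 1\<^bsub>X - \<alpha>\<^esub> f\<close>.
\<close>

lemma partner:
  assumes \<alpha>: "\<alpha> \<in> comm_sets"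
  shows "\<exists>\<beta>\<in>sets N. \<forall>S\<in>\<U>. intertwines M N S \<alpha> \<beta>"
proof -
  have as: "\<alpha> \<in> sets M" using \<alpha> by (simp add: comm_sets_def)
  define G where "G = {S (\<lambda>x. indicator \<alpha> x * f x) | S f. S \<in> \<U> \<and> f \<in> SQ M}"
  have cutS: "(\<lambda>x. indicator \<alpha> x * f x) \<in> SQ M" if "f \<in> SQ M" for f using that as by (rule sq_cut)
  have "G \<subseteq> borel_measurable N"
  proof
    fix g assume "g \<in> G"
    then obtain S f where "S \<in> \<U>" "f \<in> SQ M" "g = S (\<lambda>x. indicator \<alpha> x * f x)" unfolding G_def by blast
    then show "g \<in> borel_measurable N" using aeop_meas[OF op cutS] by simp
  qed
  moreover have "G \<noteq> {}" unfolding G_def using zero sq_zero by blast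
  ultimately obtain s :: "nat \<Rightarrow> 'b \<Rightarrow> complex" where s: "range s \<subseteq> G"
    and sG: "\<And>g. g \<in> G \<Longrightarrow> AE y in N. g y \<noteq> 0 \<longrightarrow> (\<exists>n. s n y \<noteq> 0)"
    using essential_support[OF sfN, of G] by blast
  have [measurable]: "s n \<in> borel_measurable N" for n using s \<open>G \<subseteq> _\<close> by auto
  define \<beta> where "\<beta> = {y \<in> space N. \<exists>n. s n y \<noteq> 0}"
  have bs: "\<beta> \<in> sets N" unfolding \<beta>_def by measurable
  have "intertwines M N S \<alpha> \<beta>" if S: "S \<in> \<U>" for S
    unfolding intertwines_def
  proof
    fix f assume f: "f \<in> SQ M"
    let ?f1 = "\<lambda>x. indicator \<alpha> x * f x" and ?f2 = "\<lambda>x. indicator (- \<alpha>) x * f x :: complex"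
    have f1: "?f1 \<in> SQ M" using f by (rule cutS)
    have f2: "?f2 \<in> SQ M"
    proof -
      have "?f2 = (\<lambda>x. f x - ?f1 x)" by (auto simp: indicator_def)
      then show ?thesis using sq_diff[OF f f1] by simp
    qed
    have "f = (\<lambda>x. ?f1 x + ?f2 x)" by (auto simp: indicator_def)
    then have split: "AE y in N. S f y = S ?f1 y + S ?f2 y" using aeop_add[OF op[OF S] f1 f2] by simp
    have in1: "AE y in N. S ?f1 y \<noteq> 0 \<longrightarrow> (\<exists>n. s n y \<noteq> 0)"
      by (rule sG) (use S f in \<open>auto simp: G_def\<close>)
    have "AE y in N. s n y = 0 \<or> S ?f2 y = 0" for n
    proof -
      have "s n \<in> G" using s by blast
      then obtain S1 g where S1: "S1 \<in> \<U>" and g: "g \<in> SQ M" and sn: "s n = S1 (\<lambda>x. indicator \<alpha> x * g x)"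
        unfolding G_def by blast
      let ?g1 = "\<lambda>x. indicator \<alpha> x * g x"
      obtain S' where S': "adjp M N S1 S'" using adjoint_exists[OF sfM op[OF S1]] by blast
      have "AE y in N. S1 ?g1 y = 0 \<or> S ?f2 y = 0"
      proof (rule disjoint_supports)
        show "S1 ?g1 \<in> SQ N" "S ?f2 \<in> SQ N" using aeop_sq op S1 S cutS[OF g] f2 by blast+
        fix \<psi> :: "'b \<Rightarrow> complex" assume p: "bmult N \<psi>"
        let ?A = "\<lambda>f. S' (\<lambda>y. \<psi> y * S f y)"
        have A: "?A \<in> \<A>" by (rule A_product[OF S1 S S' p])
        have "ip N (S1 ?g1) (\<lambda>y. \<psi> y * S ?f2 y) = ip M ?g1 (?A ?f2)"
          by (rule adjpD[OF S' cutS[OF g] sq_bmult[OF p aeop_sq[OF op[OF S] f2]]])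
        also have "\<dots> = ip M g (\<lambda>x. indicator \<alpha> x * ?A ?f2 x)" by (rule ip_cut_move)
        also have "\<dots> = ip M g (?A (\<lambda>x. indicator \<alpha> x * ?f2 x))"
        proof (rule ip_cong_right[OF g])
          show "AE x in M. indicator \<alpha> x * ?A ?f2 x = ?A (\<lambda>x. indicator \<alpha> x * ?f2 x) x"
            using commutes_multD[OF _ f2, of ?A "indicator \<alpha>"] \<alpha> A by (auto simp: comm_sets_def elim: eventually_mono)
        qed (intro sq_cut aeop_sq[OF A_op[OF A]] f2 as)+
        also have "(\<lambda>x. indicator \<alpha> x * ?f2 x) = (\<lambda>x. 0)" by (auto simp: indicator_def)
        also have "ip M g (?A (\<lambda>x. 0)) = ip M g (\<lambda>x. 0)"
          by (rule ip_cong_right[OF g aeop_sq[OF A_op[OF A] sq_zero] sq_zero aeop_zero[OF A_op[OF A]]])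
        finally show "ip N (S1 ?g1) (\<lambda>y. \<psi> y * S ?f2 y) = 0" by (simp add: ip_zero_right)
      qed
      then show ?thesis by (simp add: sn)
    qed
    then have out: "AE y in N. \<forall>n. s n y = 0 \<or> S ?f2 y = 0" unfolding AE_all_countable by blast
    show "AE y in N. S ?f1 y = indicator \<beta> y * S f y"
      using split in1 out AE_space
    proof eventually_elim
      case (elim y)
      then show ?case by (cases "y \<in> \<beta>") (auto simp: \<beta>_def)
    qed
  qed
  then show ?thesis using bs by blast
qed

text \<open>
  The partner of the whole space has to be chosen minimal, as the support of the joint range of \<open>U\<close>:
  only then does a function on it that is disjoint from this range vanish.
\<close>

lemma range_support:
  "\<exists>b\<in>sets N. (\<forall>S\<in>\<U>. intertwines M N S (space M) b) \<and>
     (\<forall>u. (\<forall>S\<in>\<U>. \<forall>f\<in>SQ M. AE y in N. S f y = 0 \<or> u y = (0::complex)) \<longrightarrow> (AE y in N. y \<in> b \<longrightarrow> u y = 0))"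
proof -
  define G where "G = {S f | S f. S \<in> \<U> \<and> f \<in> SQ M}"
  have "G \<subseteq> borel_measurable N"
  proof
    fix g assume "g \<in> G"
    then obtain S f where "S \<in> \<U>" "f \<in> SQ M" "g = S f" unfolding G_def by blast
    then show "g \<in> borel_measurable N" using aeop_meas[OF op] by simp
  qed
  moreover have "G \<noteq> {}" unfolding G_def using zero sq_zero by blast
  ultimately obtain s :: "nat \<Rightarrow> 'b \<Rightarrow> complex" where s: "range s \<subseteq> G"
    and sG: "\<And>g. g \<in> G \<Longrightarrow> AE y in N. g y \<noteq> 0 \<longrightarrow> (\<exists>n. s n y \<noteq> 0)"
    using essential_support[OF sfN, of G] by blast
  have [measurable]: "s n \<in> borel_measurable N" for n using s \<open>G \<subseteq> _\<close> by auto
  define b where "b = {y \<in> space N. \<exists>n. s n y \<noteq> 0}"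
  have bs: "b \<in> sets N" unfolding b_def by measurable
  have "intertwines M N S (space M) b" if S: "S \<in> \<U>" for S
    unfolding intertwines_def
  proof
    fix f assume f: "f \<in> SQ M"
    have "AE y in N. S (\<lambda>x. indicator (space M) x * f x) y = S f y"
      by (rule aeop_cong[OF op[OF S] sq_cut[OF f] f]) (auto intro!: AE_I2)
    moreover have "AE y in N. S f y \<noteq> 0 \<longrightarrow> (\<exists>n. s n y \<noteq> 0)"
      by (rule sG) (use S f in \<open>auto simp: G_def\<close>)
    ultimately show "AE y in N. S (\<lambda>x. indicator (space M) x * f x) y = indicator b y * S f y"
      using AE_space by eventually_elim (auto simp: b_def indicator_def)
  qed
  moreover have "AE y in N. y \<in> b \<longrightarrow> u y = 0"
    if u: "\<forall>S\<in>\<U>. \<forall>f\<in>SQ M. AE y in N. S f y = 0 \<or> u y = (0::complex)" for u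
  proof -
    have "AE y in N. s n y = 0 \<or> u y = 0" for n
    proof -
      have "s n \<in> G" using s by blast
      then obtain S f where "S \<in> \<U>" "f \<in> SQ M" "s n = S f" unfolding G_def by blast
      then show ?thesis using u by simp
    qed
    then have "AE y in N. \<forall>n. s n y = 0 \<or> u y = 0" unfolding AE_all_countable by blast
    then show ?thesis by eventually_elim (auto simp: b_def)
  qed
  ultimately show ?thesis using bs by blast
qed


context
  fixes \<alpha> :: "nat \<Rightarrow> 'a set" and \<beta> :: "nat \<Rightarrow> 'b set" and h :: "'a \<Rightarrow> real" and T
  assumes w: "weight M h"
    and \<alpha>: "\<And>n. \<alpha> n \<in> comm_sets" and \<beta>: "\<And>n. \<beta> n \<in> sets N"
    and \<U>_int: "\<And>S n. S \<in> \<U> \<Longrightarrow> intertwines M N S (\<alpha> n) (\<beta> n)"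
    and dense: "\<And>A e. A \<in> comm_sets \<Longrightarrow> 0 < e \<Longrightarrow> \<exists>n. measure (weighted M h) (sym_diff A (\<alpha> n)) < e"
    and T: "aeop M N T" and T_int: "\<And>n. intertwines M N T (\<alpha> n) (\<beta> n)"
begin

text \<open>
  For the members of the sequence this follows from \<open>T 1\<^bsub>\<alpha> n\<^esub> = 1\<^bsub>\<beta> n\<^esub> T\<close> and \<open>S\<^sup>* 1\<^bsub>\<beta> n\<^esub> = 1\<^bsub>\<alpha> n\<^esub> S\<^sup>*\<close>, and the
  general case by density. So \<open>T\<close> is only required to intertwine countably many pairs.
\<close>

lemma adjoint_product_commutes:
  assumes S: "S \<in> \<U>" and S': "adjp M N S S'" and A: "A \<in> comm_sets"
  shows "commutes_mult M (\<lambda>f. S' (T f)) (indicator A)"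
proof -
  have as: "\<alpha> n \<in> sets M" for n using \<alpha>[of n] by (simp add: comm_sets_def)
  have "commutes_mult M (\<lambda>f. S' (T f)) (indicator (\<alpha> n))" for n
    unfolding intertwines_commutes[symmetric]
    by (rule intertwines_comp[OF T adjp_aeop'[OF S'] T_int intertwines_adjoint[OF S' \<U>_int[OF S] as \<beta>] as \<beta>])
  moreover have "A \<in> sets M" using A by (simp add: comm_sets_def)
  ultimately show ?thesis
    using weight.commutes_indicator_approx[OF w aeop_comp[OF T adjp_aeop'[OF S']] _ as _ dense[OF A]] by blast
qed

text \<open>
  The double commutant argument. The matrix entries of the projection \<open>Q\<close> onto the closure of \<open>\<A>\<^sup>\<infinity> \<xi>\<close>
  commute with \<open>\<A>\<close>, in particular with multiplications, and so with \<open>R = S\<^sup>* T\<close>. Since \<open>\<xi>\<close> itself is in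
  the range of \<open>Q\<close>, one gets \<open>R\<^sup>\<infinity> \<xi> = R\<^sup>\<infinity> Q \<xi> = Q R\<^sup>\<infinity> \<xi>\<close>.
\<close>

lemma adjoint_product_in_closure:
  assumes S: "S \<in> \<U>" and S': "adjp M N S S'" and \<xi>: "\<xi> \<in> SQ (seq_meas M)"
  shows "in_cl (seq_meas M) ((\<lambda>A. amp A \<xi>) ` \<A>) (amp (\<lambda>f. S' (T f)) \<xi>)"
proof -
  let ?W = "(\<lambda>A. amp A \<xi>) ` \<A>" and ?R = "\<lambda>f. S' (T f)"
  let ?M = "seq_meas M"
  note sf = sfM and sfs = sigma_finite_seq_meas[OF sfM]
  have R: "aeop M M ?R" by (rule aeop_comp[OF T adjp_aeop'[OF S']])
  have ampS: "amp A F \<in> SQ ?M" if "aeop M M A" "F \<in> SQ ?M" for A F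
    using aeop_sq[OF aeop_amp[OF sf sf that(1)] that(2)] .
  have W: "lin_sub ?M ?W" by (rule lin_sub_orbit[OF sfM sfM A_op A_zero A_add A_scale \<xi>])
  have inv: "amp A F \<in> ?W" if "A \<in> \<A>" "F \<in> ?W" for A F
    using that A_comp by (auto simp: amp_comp)
  let ?Q = "proj ?M ?W"
  have Q: "aeop ?M ?M ?Q" by (rule aeop_proj[OF sfs W])
  have Qcomm: "AE z in ?M. ?Q (amp A F) z = amp A (?Q F) z" if A: "A \<in> \<A>" and F: "F \<in> SQ ?M" for A F
  proof -
    obtain A' where A': "A' \<in> \<A>" "adjp M M A A'" using A_star[OF A] by blast
    show ?thesis by (rule proj_commutes[OF sfs W adjp_amp[OF sf sf A'(2)] inv[OF A] inv[OF A'(1)] F])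
  qed
  \<comment> \<open>The entries of the operator matrix of Q.\<close>
  define q where "q i j f = slice (?Q (tens f j)) i" for i j f
  have qop: "aeop M M (q i j)" for i j
    unfolding q_def[abs_def]
    by (rule aeop_comp[OF aeop_comp[OF aeop_tens[OF sf] Q] aeop_slice[OF sf]])
  have qcomm: "AE x in M. q i j (A f) x = A (q i j f) x" if A: "A \<in> \<A>" and f: "f \<in> SQ M" for A f i j
  proof -
    note opA = A_op[OF A]
    note tS = sq_tens[OF sf f, of j] and tAS = sq_tens[OF sf aeop_sq[OF opA f], of j]
    have "AE z in ?M. ?Q (amp A (tens f j)) z = ?Q (tens (A f) j) z"
      by (rule aeop_cong[OF Q ampS[OF opA tS] tAS amp_tens[OF sf opA f]])
    with Qcomm[OF A tS] have "AE z in ?M. ?Q (tens (A f) j) z = amp A (?Q (tens f j)) z"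
      by eventually_elim simp
    from AE_slice[OF sf _ _ this, of i] show ?thesis
      using aeop_sq[OF Q tAS] ampS[OF opA aeop_sq[OF Q tS]] by (simp add: q_def)
  qed
  have Rcomm: "AE x in M. q i j (?R f) x = ?R (q i j f) x" if f: "f \<in> SQ M" for i j f
  proof -
    have "commutes_mult M (q i j) \<phi>" if p: "bmult M \<phi>" for \<phi>
      unfolding commutes_mult_def using qcomm[OF A_mult[OF p]] by blast
    then obtain k where k: "bmult M k" and kq: "\<And>f. f \<in> SQ M \<Longrightarrow> AE x in M. q i j f x = k x * f x"
      using commuting_with_mult_is_mult[OF sf qop] by blast
    have kS: "(\<lambda>x. k x * f x) \<in> SQ M" if "f \<in> SQ M" for f using k that by (rule sq_bmult)
    have through: "AE x in M. B (q i j f) x = B (\<lambda>x. k x * f x) x" if B: "aeop M M B" and f: "f \<in> SQ M" for B f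
      by (rule aeop_cong[OF B aeop_sq[OF qop f] kS[OF f] kq[OF f]])
    have "commutes_mult M ?R k"
    proof (rule commutes_via_projections[OF A_star k _ R])
      fix A assume A: "A \<in> \<A>"
      show "commutes_mult M A k"
        unfolding commutes_mult_def
      proof
        fix f assume f: "f \<in> SQ M"
        show "AE x in M. A (\<lambda>x. k x * f x) x = k x * A f x"
          using through[OF A_op[OF A] f] qcomm[OF A f, of i j] kq[OF aeop_sq[OF A_op[OF A] f]]
          by eventually_elim simp
      qed
    next
      fix a assume "a \<in> sets M" "\<And>A. A \<in> \<A> \<Longrightarrow> commutes_mult M A (indicator a)"
      then show "commutes_mult M ?R (indicator a)"
        by (intro adjoint_product_commutes[OF S S']) (simp add: comm_sets_def)
    qed
    from commutes_multD[OF this f] through[OF R f] kq[OF aeop_sq[OF R f]] show ?thesis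
      by eventually_elim simp
  qed
  have "AE z in ?M. ?Q (amp ?R \<xi>) z = amp ?R (?Q \<xi>) z"
  proof (rule aeop_eq_on_tensors[OF sf aeop_comp[OF aeop_amp[OF sf sf R] Q] aeop_comp[OF Q aeop_amp[OF sf sf R]] _ \<xi>])
    fix f :: "'a \<Rightarrow> complex" and j assume f: "f \<in> SQ M"
    note tS = sq_tens[OF sf f, of j] and tRS = sq_tens[OF sf aeop_sq[OF R f], of j]
    have "AE z in ?M. ?Q (tens (?R f) j) z = amp ?R (?Q (tens f j)) z"
      unfolding AE_seq_eq_iff[OF sf aeop_sq[OF Q tRS] ampS[OF R aeop_sq[OF Q tS]]]
      using Rcomm[OF f, of _ j] by (simp add: q_def)
    moreover have "AE z in ?M. ?Q (amp ?R (tens f j)) z = ?Q (tens (?R f) j) z"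
      by (rule aeop_cong[OF Q ampS[OF R tS] tRS amp_tens[OF sf R f]])
    ultimately show "AE z in ?M. ?Q (amp ?R (tens f j)) z = amp ?R (?Q (tens f j)) z"
      by eventually_elim simp
  qed
  moreover have "AE z in ?M. amp ?R (?Q \<xi>) z = amp ?R \<xi> z"
  proof (rule aeop_cong[OF aeop_amp[OF sf sf R] aeop_sq[OF Q \<xi>] \<xi> proj_fix[OF sfs W]])
    have "\<xi> = amp (\<lambda>f. f) \<xi>" by (auto simp: amp_def slice_def)
    then have "\<xi> \<in> ?W" using A_id by blast
    then show "in_cl ?M ?W \<xi>" using W by (intro in_cl_subset) (auto simp: lin_sub_def)
  qed
  ultimately have "AE z in ?M. ?Q (amp ?R \<xi>) z = amp ?R \<xi> z" by eventually_elim simp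
  then show ?thesis using in_cl_cong[OF proj_in_cl[OF sfs W ampS[OF R \<xi>]] V_sub[OF sfs W] ampS[OF R \<xi>]] by blast
qed

text \<open>
  Let \<open>\<eta>\<close> be the component of \<open>T\<^sup>\<infinity> \<xi>\<close> orthogonal to \<open>U\<^sup>\<infinity> \<xi>\<close>. Since \<open>(S S\<^sup>* T)\<^sup>\<infinity> \<xi>\<close> and \<open>(S S\<^sup>* U)\<^sup>\<infinity> \<xi>\<close> lie in the
  closure of \<open>U\<^sup>\<infinity> \<xi>\<close>, the vector \<open>(S S\<^sup>*)\<^sup>\<infinity> \<eta>\<close> is orthogonal to \<open>\<eta>\<close>, that is \<open>S\<^sup>* \<eta> = 0\<close> in every entry. So the
  entries of \<open>\<eta>\<close> are disjoint from the range of \<open>U\<close> and vanish on \<open>b\<close>, while those of \<open>T\<^sup>\<infinity> \<xi>\<close> live on \<open>b\<close>.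
  Hence \<open>\<eta>\<close> is orthogonal to \<open>T\<^sup>\<infinity> \<xi>\<close> as well, and \<open>\<eta> = 0\<close>.
\<close>

theorem strongly_dense:
  assumes b: "b \<in> sets N" and Tb: "intertwines M N T (space M) b"
    and bmin: "\<And>u :: 'b \<Rightarrow> complex. (\<forall>S\<in>\<U>. \<forall>f\<in>SQ M. AE y in N. S f y = 0 \<or> u y = 0) \<Longrightarrow> AE y in N. y \<in> b \<longrightarrow> u y = 0"
    and \<xi>: "\<xi> \<in> SQ (seq_meas M)" and e: "0 < e"
  shows "\<exists>S\<in>\<U>. nrm (seq_meas N) (\<lambda>z. amp T \<xi> z - amp S \<xi> z) < e"
proof -
  let ?M = "seq_meas M" and ?N = "seq_meas N"
  let ?V = "(\<lambda>S. amp S \<xi>) ` \<U>"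
  note sfs = sigma_finite_seq_meas[OF sfN]
  have ampS: "amp S F \<in> SQ ?N" if "aeop M N S" "F \<in> SQ ?M" for S F
    using aeop_sq[OF aeop_amp[OF sfM sfN that(1)] that(2)] .
  have V: "lin_sub ?N ?V" by (rule lin_sub_orbit[OF sfM sfN op zero add scale \<xi>])
  have VS: "?V \<subseteq> SQ ?N" using V by (simp add: lin_sub_def)
  define p where "p = proj ?N ?V (amp T \<xi>)"
  define \<eta> where "\<eta> z = amp T \<xi> z - p z" for z
  have TS: "amp T \<xi> \<in> SQ ?N" by (rule ampS[OF T \<xi>])
  have p: "in_cl ?N ?V p" unfolding p_def by (rule proj_in_cl[OF sfs V TS])
  have pS: "p \<in> SQ ?N" using p by (simp add: in_cl_def)
  have eS: "\<eta> \<in> SQ ?N" unfolding \<eta>_def[abs_def] by (rule sq_diff[OF TS pS])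
  have orth: "ip ?N v \<eta> = 0" if "in_cl ?N ?V v" for v
  proof -
    have "ip ?N \<eta> v = 0" unfolding \<eta>_def[abs_def] p_def by (rule proj_orth_cl[OF sfs V TS that])
    then show ?thesis by (metis ip_commute complex_cnj_zero)
  qed
  have kill: "AE x in M. S' (slice \<eta> n) x = 0" if S: "S \<in> \<U>" and S': "adjp M N S S'" for S S' n
  proof -
    note aS = aeop_amp[OF sfM sfN op[OF S]] and aS' = aeop_amp[OF sfN sfM adjp_aeop'[OF S']]
    note SS' = aeop_comp[OF aS' aS]
    have "in_cl ?N ?V (amp S (amp (\<lambda>f. S' (T f)) \<xi>))"
    proof (rule in_cl_aeop[OF aS adjoint_product_in_closure[OF S S' \<xi>]])
      show "(\<lambda>A. amp A \<xi>) ` \<A> \<subseteq> SQ ?M" using aeop_sq[OF aeop_amp[OF sfM sfM A_op] \<xi>] by blast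
      show "amp S v \<in> ?V" if "v \<in> (\<lambda>A. amp A \<xi>) ` \<A>" for v using that U_A[OF S] by (auto simp: amp_comp)
    qed
    moreover have "amp S (amp (\<lambda>f. S' (T f)) \<xi>) = amp S (amp S' (amp T \<xi>))" by (simp add: amp_comp)
    moreover have "in_cl ?N ?V (amp S (amp S' p))"
    proof (rule in_cl_aeop[OF SS' p VS])
      show "amp S (amp S' v) \<in> ?V" if "v \<in> ?V" for v using that tro[OF S S S'] by (auto simp: amp_comp)
    qed
    ultimately have "in_cl ?N ?V (\<lambda>z. amp S (amp S' (amp T \<xi>)) z - amp S (amp S' p) z)"
      using in_cl_diff[OF sfs V] by simp
    then have 0: "ip ?N (\<lambda>z. amp S (amp S' (amp T \<xi>)) z - amp S (amp S' p) z) \<eta> = 0" by (rule orth)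
    have "ip ?N (amp S (amp S' \<eta>)) \<eta> = ip ?N (\<lambda>z. amp S (amp S' (amp T \<xi>)) z - amp S (amp S' p) z) \<eta>"
    proof (rule ip_cong_AE)
      show "AE z in ?N. amp S (amp S' \<eta>) z = amp S (amp S' (amp T \<xi>)) z - amp S (amp S' p) z"
        unfolding \<eta>_def[abs_def] by (rule aeop_diff[OF SS' TS pS])
    qed (simp | intro sq_measurable sq_diff eS aeop_sq[OF SS'] TS pS)+
    moreover have "ip ?N (amp S (amp S' \<eta>)) \<eta> = ip ?M (amp S' \<eta>) (amp S' \<eta>)"
      by (rule adjpD[OF adjp_amp[OF sfM sfN S'] aeop_sq[OF aS' eS] eS])
    ultimately have "nrm ?M (amp S' \<eta>) = 0" using 0 by (simp add: ip_self)
    then have "AE z in ?M. amp S' \<eta> z = 0" using nrm_eq_0_iff[OF aeop_sq[OF aS' eS]] by simp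
    from AE_slice[OF sfM aeop_sq[OF aS' eS] sq_zero this, of n] show ?thesis by simp
  qed
  have vanish: "AE y in N. y \<in> b \<longrightarrow> slice \<eta> n y = 0" for n
  proof (rule bmin, intro ballI)
    fix S f assume S: "S \<in> \<U>" and f: "f \<in> SQ M"
    show "AE y in N. S f y = 0 \<or> slice \<eta> n y = 0"
    proof (rule disjoint_supports[OF aeop_sq[OF op[OF S] f] sq_slice[OF sfN eS]])
      fix \<psi> :: "'b \<Rightarrow> complex" assume \<psi>: "bmult N \<psi>"
      let ?S = "\<lambda>f y. cnj (\<psi> y) * S f y"
      have U: "?S \<in> \<U>" by (rule left[OF S bmult_cnj[OF \<psi>]])
      obtain S' where S': "adjp M N ?S S'" using adjoint_exists[OF sfM op[OF U]] by blast
      have "ip N (S f) (\<lambda>y. \<psi> y * slice \<eta> n y) = ip N (?S f) (slice \<eta> n)"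
        by (simp add: ip_mult_move)
      also have "\<dots> = ip M f (S' (slice \<eta> n))" by (rule adjpD[OF S' f sq_slice[OF sfN eS]])
      also have "\<dots> = ip M f (\<lambda>x. 0)"
        by (rule ip_cong_right[OF f aeop_sq[OF adjp_aeop'[OF S'] sq_slice[OF sfN eS]] sq_zero kill[OF U S']])
      finally show "ip N (S f) (\<lambda>y. \<psi> y * slice \<eta> n y) = 0" by (simp add: ip_zero_right)
    qed
  qed
  have "ip N (slice (amp T \<xi>) n) (slice \<eta> n) = 0" for n
  proof -
    note xi = sq_slice[OF sfM \<xi>, of n]
    have "AE y in N. T (\<lambda>x. indicator (space M) x * slice \<xi> n x) y = T (slice \<xi> n) y"
      by (rule aeop_cong[OF T sq_cut[OF xi] xi]) (auto intro!: AE_I2)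
    moreover have "AE y in N. T (\<lambda>x. indicator (space M) x * slice \<xi> n x) y = indicator b y * T (slice \<xi> n) y"
      using Tb xi by (simp add: intertwines_def)
    ultimately have "AE y in N. T (slice \<xi> n) y * cnj (slice \<eta> n y) = 0"
      using vanish[of n] by eventually_elim (auto simp: indicator_def split: if_splits)
    then have "ip N (T (slice \<xi> n)) (slice \<eta> n) = (\<integral>y. 0 \<partial>N)"
      unfolding ip_def
      by (intro integral_cong_AE borel_measurable_integrable[OF integrable_ip[OF aeop_sq[OF T xi] sq_slice[OF sfN eS]]]) auto
    then show ?thesis by simp
  qed
  then have "ip ?N (amp T \<xi>) \<eta> = 0" using ip_seq_sums[OF sfN TS eS] sums_unique[of "\<lambda>n. 0"] by simp
  moreover have "ip ?N p \<eta> = 0" by (rule orth[OF p])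
  ultimately have "ip ?N \<eta> \<eta> = 0"
    using ip_diff_left[OF TS pS eS] by (simp add: \<eta>_def[abs_def])
  then have "nrm ?N \<eta> = 0" by (simp add: ip_self)
  moreover obtain S where S: "S \<in> \<U>" and lt: "nrm ?N (\<lambda>z. p z - amp S \<xi> z) < e"
    using p e by (auto simp: in_cl_def)
  ultimately have "nrm ?N (\<lambda>z. amp T \<xi> z - amp S \<xi> z) < e"
    using nrm_triangle_sub[OF TS pS ampS[OF op[OF S] \<xi>]] by (simp add: \<eta>_def[abs_def])
  then show ?thesis using S by blast
qed

end

end

section \<open>Tightness, and operators that vanish off an agreement set\<close>

text \<open>
  A countable base generates all open sets by countable unions. The empty set is added to make
  the enumeration total.
\<close>

lemma standard_borel_generated:
  assumes "standard_borel M"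
  obtains B :: "nat \<Rightarrow> 'a set" where "sets M = sigma_sets (space M) (range B)"
proof -
  obtain \<tau> where sc: "second_countable \<tau>" and top: "topspace \<tau> = space M"
    and sets: "sets M = sigma_sets (space M) {U. openin \<tau> U}"
    using assms unfolding standard_borel_def by blast
  obtain \<B> where \<B>: "countable \<B> \<and> (\<forall>V\<in>\<B>. openin \<tau> V) \<and>
      (\<forall>U x. openin \<tau> U \<and> x \<in> U \<longrightarrow> (\<exists>V\<in>\<B>. x \<in> V \<and> V \<subseteq> U))"
    using sc unfolding second_countable_def by (rule exE)
  then have cb: "countable \<B>" and bo: "\<And>V. V \<in> \<B> \<Longrightarrow> openin \<tau> V" by simp_all
  have base: "\<exists>V\<in>\<B>. x \<in> V \<and> V \<subseteq> U" if "openin \<tau> U" "x \<in> U" for U x using \<B> that by simp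
  let ?B = "insert {} \<B>"
  have "sigma_sets (space M) {U. openin \<tau> U} = sigma_sets (space M) ?B"
  proof (rule sigma_sets_eqI)
    fix U assume "U \<in> {U. openin \<tau> U}"
    then have U: "openin \<tau> U" by simp
    have "U = \<Union>{V\<in>\<B>. V \<subseteq> U}" using base[OF U] by blast
    moreover have "\<Union>{V\<in>\<B>. V \<subseteq> U} \<in> sigma_sets (space M) ?B"
      by (rule sigma_sets_UNION) (use cb in \<open>auto intro: sigma_sets.Basic countable_subset[of _ \<B>]\<close>)
    ultimately show "U \<in> sigma_sets (space M) ?B" by simp
  next
    fix V assume "V \<in> ?B"
    then show "V \<in> sigma_sets (space M) {U. openin \<tau> U}" using bo by (auto intro: sigma_sets.Basic)
  qed
  moreover have "range (from_nat_into ?B) = ?B" using cb by (intro range_from_nat_into) auto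
  ultimately show ?thesis using that[of "from_nat_into ?B"] sets by simp
qed

lemma (in finite_measure) measure_Diff_INT_le:
  fixes A :: "nat \<Rightarrow> 'a set"
  assumes A: "\<And>n. A n \<in> sets M" and S: "S \<in> sets M" and le: "\<And>n. measure M (S - A n) \<le> e * (1/2) ^ Suc n"
  shows "measure M (S - (\<Inter>n. A n)) \<le> e"
proof -
  have sums: "(\<lambda>n. e * (1/2::real) ^ Suc n) sums e" using sums_mult[OF power_half_series, of e] by simp
  have sm: "summable (\<lambda>n. measure M (S - A n))"
    by (rule summable_comparison_test[OF _ sums_summable[OF sums]]) (use le in auto)
  have "S - (\<Inter>n. A n) = (\<Union>n. S - A n)" by blast
  also have "measure M \<dots> \<le> (\<Sum>n. measure M (S - A n))"
    using A S sm by (intro finite_measure_subadditive_countably) auto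
  also have "\<dots> \<le> (\<Sum>n. e * (1/2) ^ Suc n)" by (rule suminf_le[OF le sm sums_summable[OF sums]])
  also have "\<dots> = e" using sums by (rule sums_unique[symmetric])
  finally show ?thesis .
qed

locale polish_measure = finite_measure M for M :: "'a measure" +
  fixes \<tau> :: "'a topology"
  assumes cm: "completely_metrizable_space \<tau>" and sc: "second_countable \<tau>"
    and top: "topspace \<tau> = space M" and borel: "sets M = sigma_sets (space M) {U. openin \<tau> U}"
begin

lemma open_sets: "openin \<tau> U \<Longrightarrow> U \<in> sets M"
  by (simp add: borel sigma_sets.Basic)

lemma closed_sets: "closedin \<tau> C \<Longrightarrow> C \<in> sets M"
  using open_sets[of "space M - C"] sets.compl_sets[of "space M - C" M] closedin_subset[of \<tau> C]
  by (auto simp: closedin_def top double_diff)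

text \<open>
  The sets with this property form a \<open>\<sigma>\<close>-algebra; it contains the open sets because they are increasing
  unions of countably many closed sets. Keeping track of open sets from outside makes the property
  stable under complements.
\<close>

lemma closed_open_approx:
  assumes "A \<in> sets M" "0 < e"
  shows "\<exists>C U. closedin \<tau> C \<and> openin \<tau> U \<and> C \<subseteq> A \<and> A \<subseteq> U \<and> measure M (U - C) < e"
proof -
  have "A \<in> sigma_sets (space M) {U. openin \<tau> U}" using assms(1) by (simp add: borel)
  then show ?thesis using assms(2)
  proof (induction arbitrary: e)
    case (Basic U)
    then have U: "openin \<tau> U" by simp
    have "fsigma_in \<tau> U" using open_imp_fsigma_in[OF completely_metrizable_imp_metrizable_space[OF cm] U] .
    then obtain C :: "nat \<Rightarrow> 'a set" where C: "\<And>n. closedin \<tau> (C n)" "\<And>n. C n \<subseteq> C (Suc n)" "(\<Union>n. C n) = U"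
      unfolding fsigma_in_ascending by blast
    have "(\<lambda>n. measure M (C n)) \<longlonglongrightarrow> measure M (\<Union>n. C n)"
      using C closed_sets by (intro finite_Lim_measure_incseq) (auto simp: incseq_Suc_iff)
    from LIMSEQ_D[OF this Basic.prems] obtain n where n: "\<bar>measure M (C n) - measure M U\<bar> < e"
      using C(3) by auto
    have sub: "C n \<subseteq> U" using C(3) by blast
    have "measure M (U - C n) = measure M U - measure M (C n)"
      using sub open_sets[OF U] closed_sets[OF C(1)] by (intro finite_measure_Diff) auto
    then have "measure M (U - C n) < e" using n by linarith
    then show ?case using U C(1) sub by blast
  next
    case Empty
    then show ?case by (intro exI[of _ "{}"]) auto
  next
    case (Compl a)
    from Compl.IH[OF Compl.prems] obtain C U where CU: "closedin \<tau> C \<and> openin \<tau> U \<and> C \<subseteq> a \<and> a \<subseteq> U \<and> measure M (U - C) < e"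
      by (elim exE)
    then have CU1: "closedin \<tau> C" and CU2: "openin \<tau> U" by simp_all
    have "U \<subseteq> space M" using openin_subset[OF CU2] top by simp
    then have eq: "(space M - C) - (space M - U) = U - C" by blast
    show ?case
    proof (rule exI[of _ "space M - U"], rule exI[of _ "space M - C"], intro conjI)
      show "closedin \<tau> (space M - U)" using closedin_diff[OF closedin_topspace CU2] top by simp
      show "openin \<tau> (space M - C)" using openin_diff[OF openin_topspace CU1] top by simp
      show "measure M ((space M - C) - (space M - U)) < e" unfolding eq using CU by simp
    qed (use CU in blast)+
  next
    case (Union a)
    have "\<exists>C U. closedin \<tau> C \<and> openin \<tau> U \<and> C \<subseteq> a i \<and> a i \<subseteq> U \<and> measure M (U - C) < e / 2 * (1/2) ^ Suc i" for i
      using Union.prems by (intro Union.IH) simp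
    then obtain C U where CU: "\<And>i. closedin \<tau> (C i)" "\<And>i. openin \<tau> (U i)" "\<And>i. C i \<subseteq> a i" "\<And>i. a i \<subseteq> U i"
      and small: "\<And>i. measure M (U i - C i) < e / 2 * (1/2) ^ Suc i" by metis
    have Cs: "C i \<in> sets M" and Us: "U i \<in> sets M" for i using CU closed_sets open_sets by auto
    define F where "F k = (\<Union>i<k. C i)" for k
    have Fc: "closedin \<tau> (F k)" for k unfolding F_def using CU(1) by (intro closedin_Union) auto
    have UF: "(\<Union>k. F k) = (\<Union>i. C i)" unfolding F_def by auto
    have "incseq F" unfolding incseq_def F_def by (auto intro: less_le_trans)
    then have "(\<lambda>k. measure M (F k)) \<longlonglongrightarrow> measure M (\<Union>i. C i)"
      using Fc closed_sets UF finite_Lim_measure_incseq[of F] by auto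
    from LIMSEQ_D[OF this, of "e/2"] obtain k where k: "\<bar>measure M (F k) - measure M (\<Union>i. C i)\<bar> < e / 2"
      using Union.prems by auto
    have sub: "F k \<subseteq> (\<Union>i. C i)" using UF by blast
    have "measure M ((\<Union>i. C i) - F k) = measure M (\<Union>i. C i) - measure M (F k)"
      using Cs closed_sets[OF Fc] sub by (intro finite_measure_Diff) auto
    then have 1: "measure M ((\<Union>i. C i) - F k) < e / 2" using k by linarith
    have "measure M ((\<Union>i. U i) - (\<Inter>i. space M - (U i - C i))) \<le> e / 2"
    proof (rule measure_Diff_INT_le)
      fix n
      have "measure M ((\<Union>i. U i) - (space M - (U n - C n))) \<le> measure M (U n - C n)"
        using Us Cs sets.sets_into_space[OF Us] by (intro finite_measure_mono) auto
      then show "measure M ((\<Union>i. U i) - (space M - (U n - C n))) \<le> e / 2 * (1/2) ^ Suc n"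
        using small[of n] by linarith
    qed (use Us Cs in auto)
    moreover have "(\<Union>i. U i) - F k \<subseteq> ((\<Union>i. U i) - (\<Inter>i. space M - (U i - C i))) \<union> ((\<Union>i. C i) - F k)"
      by blast
    then have "measure M ((\<Union>i. U i) - F k)
        \<le> measure M (((\<Union>i. U i) - (\<Inter>i. space M - (U i - C i))) \<union> ((\<Union>i. C i) - F k))"
      using Us Cs closed_sets[OF Fc] by (intro finite_measure_mono) auto
    moreover have "\<dots> \<le> measure M ((\<Union>i. U i) - (\<Inter>i. space M - (U i - C i))) + measure M ((\<Union>i. C i) - F k)"
      using Us Cs closed_sets[OF Fc] by (intro measure_Un_le) auto
    ultimately have "measure M ((\<Union>i. U i) - F k) < e" using 1 by linarith
    moreover have "openin \<tau> (\<Union>i. U i)" using CU(2) by (intro openin_Union) auto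
    moreover have "F k \<subseteq> (\<Union>i. a i)" "(\<Union>i. a i) \<subseteq> (\<Union>i. U i)" using CU(3,4) unfolding F_def by blast+
    ultimately have "closedin \<tau> (F k) \<and> openin \<tau> (\<Union>i. U i) \<and> F k \<subseteq> (\<Union>i. a i) \<and>
        (\<Union>i. a i) \<subseteq> (\<Union>i. U i) \<and> measure M ((\<Union>i. U i) - F k) < e"
      using Fc by (intro conjI)
    then show ?case by (rule exI[of _ "F k", OF exI[of _ "\<Union>i. U i"]])
  qed
qed

lemma closed_approx:
  assumes A: "A \<in> sets M" and e: "0 < e"
  obtains C where "closedin \<tau> C" "C \<subseteq> A" "measure M (A - C) < e"
proof -
  obtain C U where CU: "closedin \<tau> C" "openin \<tau> U" "C \<subseteq> A" "A \<subseteq> U" "measure M (U - C) < e"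
    using closed_open_approx[OF A e] by blast
  have "measure M (A - C) \<le> measure M (U - C)"
    using CU open_sets closed_sets by (intro finite_measure_mono) auto
  then show ?thesis using that[of C] CU by linarith
qed

text \<open>
  For every radius \<open>1 / (n + 1)\<close> finitely many closed balls cover the space up to small measure. The
  intersection of these finite unions is closed and totally bounded, hence compact by
  completeness.
\<close>

lemma tight:
  assumes e: "0 < e"
  obtains K where "compactin \<tau> K" "measure M (space M - K) \<le> e"
proof -
  obtain X d where ms: "Metric_space X d" and mc: "Metric_space.mcomplete X d" and \<tau>: "\<tau> = Metric_space.mtopology X d"
    using cm unfolding completely_metrizable_space_def by blast
  interpret Metric_space X d by (rule ms)
  have X: "X = space M" using top by (simp add: \<tau>)
  obtain \<B> where \<B>: "countable \<B> \<and> (\<forall>V\<in>\<B>. openin \<tau> V) \<and>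
      (\<forall>U x. openin \<tau> U \<and> x \<in> U \<longrightarrow> (\<exists>V\<in>\<B>. x \<in> V \<and> V \<subseteq> U))"
    using sc unfolding second_countable_def by (rule exE)
  then have cb: "countable \<B>" and bo: "\<And>V. V \<in> \<B> \<Longrightarrow> openin \<tau> V" by simp_all
  have base: "\<exists>V\<in>\<B>. x \<in> V \<and> V \<subseteq> U" if "openin \<tau> U" "x \<in> U" for U x using \<B> that by simp
  have "\<exists>F. closedin \<tau> F \<and> measure M (space M - F) \<le> e * (1/2) ^ Suc n \<and>
      (\<exists>c. finite c \<and> F \<subseteq> (\<Union>x\<in>c. mcball x (1 / Suc n)))" for n
  proof -
    let ?r = "1 / real (Suc n)"
    define \<V> where "\<V> = insert {} {V \<in> \<B>. \<exists>x\<in>X. V \<subseteq> mball x ?r}"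
    have cV: "countable \<V>" unfolding \<V>_def using cb by (auto intro: countable_subset[of _ \<B>])
    define V where "V = from_nat_into \<V>"
    have rV: "range V = \<V>" unfolding V_def using cV by (intro range_from_nat_into) (auto simp: \<V>_def)
    have "\<exists>x. V i \<subseteq> mcball x ?r" for i
    proof -
      have "V i \<in> \<V>" using rV by blast
      then show ?thesis unfolding \<V>_def using mball_subset_mcball by fastforce
    qed
    then obtain c where c: "\<And>i. V i \<subseteq> mcball (c i) ?r" by metis
    define F where "F k = (\<Union>i<k. mcball (c i) ?r)" for k
    have Fc: "closedin \<tau> (F k)" for k unfolding F_def \<tau> by (intro closedin_Union) auto
    have cover: "(\<Union>k. F k) = space M"
    proof
      show "(\<Union>k. F k) \<subseteq> space M" using closedin_subset[OF Fc] top by blast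
      show "space M \<subseteq> (\<Union>k. F k)"
      proof
        fix x assume x: "x \<in> space M"
        then have "x \<in> mball x ?r" unfolding in_mball X[symmetric] by simp
        then obtain W where W: "W \<in> \<B>" "x \<in> W" "W \<subseteq> mball x ?r"
          using base[of "mball x ?r" x] by (auto simp: \<tau>)
        then have "W \<in> \<V>" using x X by (auto simp: \<V>_def)
        then obtain i where "W = V i" using rV by blast
        then have "x \<in> mcball (c i) ?r" using W c by blast
        then have "x \<in> F (Suc i)" unfolding F_def by blast
        then show "x \<in> (\<Union>k. F k)" by blast
      qed
    qed
    have "incseq F" unfolding incseq_def F_def by (auto intro: less_le_trans)
    then have "(\<lambda>k. measure M (F k)) \<longlonglongrightarrow> measure M (space M)"
      using finite_Lim_measure_incseq[of F] Fc closed_sets cover by auto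
    from LIMSEQ_D[OF this, of "e * (1/2) ^ Suc n"] obtain k
      where k: "\<bar>measure M (F k) - measure M (space M)\<bar> < e * (1/2) ^ Suc n" using e by auto
    have "measure M (space M - F k) = measure M (space M) - measure M (F k)"
      by (rule finite_measure_compl[OF closed_sets[OF Fc]])
    then have "measure M (space M - F k) \<le> e * (1/2) ^ Suc n" using k by linarith
    moreover have "F k \<subseteq> (\<Union>x\<in>c ` {..<k}. mcball x ?r)" by (auto simp: F_def)
    ultimately show ?thesis using Fc by blast
  qed
  then obtain F c where Fc: "\<And>n. closedin \<tau> (F n)" and Fm: "\<And>n. measure M (space M - F n) \<le> e * (1/2) ^ Suc n"
    and cf: "\<And>n. finite (c n)" and cov: "\<And>n :: nat. F n \<subseteq> (\<Union>x\<in>c n. mcball x (1 / Suc n))" by metis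
  let ?K = "\<Inter>n. F n"
  have K: "closedin \<tau> ?K" using Fc by (intro closedin_Inter) auto
  have "mtotally_bounded ?K"
    unfolding mtotally_bounded_def
  proof (intro allI impI)
    fix \<epsilon> :: real assume "0 < \<epsilon>"
    then obtain n where n: "1 / Suc n < \<epsilon> / 2" by (metis half_gt_zero nat_approx_posE)
    let ?c = "{x \<in> c n. \<exists>y\<in>?K. y \<in> mcball x (1 / Suc n)}"
    define p where "p x = (SOME y. y \<in> ?K \<and> y \<in> mcball x (1 / Suc n))" for x
    have p: "p x \<in> ?K" "p x \<in> mcball x (1 / Suc n)" if "x \<in> ?c" for x
    proof -
      have "\<exists>y. y \<in> ?K \<and> y \<in> mcball x (1 / Suc n)" using that by blast
      from someI_ex[OF this] show "p x \<in> ?K" "p x \<in> mcball x (1 / Suc n)" unfolding p_def by blast+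
    qed
    have "?K \<subseteq> (\<Union>x\<in>p ` ?c. mball x \<epsilon>)"
    proof
      fix y assume y: "y \<in> ?K"
      then have "y \<in> F n" by blast
      then obtain x where x: "x \<in> c n" "y \<in> mcball x (1 / Suc n)" using cov by blast
      then have xc: "x \<in> ?c" using y by blast
      have mem: "x \<in> X" "y \<in> X" "p x \<in> X" using x(2) p(2)[OF xc] by (auto simp: in_mcball)
      have "d (p x) y \<le> d x (p x) + d x y" using triangle[OF mem(3,1,2)] by (simp add: commute)
      also have "\<dots> \<le> 1 / Suc n + 1 / Suc n" using x(2) p(2)[OF xc] by (intro add_mono) (auto simp: in_mcball)
      finally have "d (p x) y < \<epsilon>" using n by linarith
      then have "y \<in> mball (p x) \<epsilon>" using mem by (simp add: in_mball)
      then show "y \<in> (\<Union>x\<in>p ` ?c. mball x \<epsilon>)" using xc by blast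
    qed
    moreover have "finite (p ` ?c)" using cf by auto
    moreover have "p ` ?c \<subseteq> ?K" using p(1) by blast
    ultimately show "\<exists>K. finite K \<and> K \<subseteq> ?K \<and> ?K \<subseteq> (\<Union>x\<in>K. mball x \<epsilon>)" by blast
  qed
  then have "compactin \<tau> (\<tau> closure_of ?K)" unfolding \<tau> using mtotally_bounded_eq_compact_closure_of[OF mc] by blast
  then have "compactin \<tau> ?K" using closure_of_closedin[OF K] by simp
  moreover have "measure M (space M - ?K) \<le> e"
    by (rule measure_Diff_INT_le[OF closed_sets[OF Fc] sets.top Fm])
  ultimately show ?thesis using that by blast
qed

text \<open>
  A simultaneous version of Lusin's theorem for the indicators of all \<open>\<alpha> n\<close>: discard from the space
  what is lost when \<open>\<alpha> n\<close> and its complement are shrunk to closed sets.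
\<close>

lemma compact_clopen_approx:
  fixes \<alpha> :: "nat \<Rightarrow> 'a set"
  assumes A: "A \<in> sets M" and \<alpha>: "\<And>n. \<alpha> n \<in> sets M" and e: "0 < e"
  obtains K where "compactin \<tau> K" "K \<subseteq> A" "K \<in> sets M" "measure M (A - K) < e"
    "\<And>n. closedin \<tau> (K \<inter> \<alpha> n)" "\<And>n. closedin \<tau> (K - \<alpha> n)"
proof -
  \<comment> \<open>The error e is divided among tightness, the set A, and the sequence of sets.\<close>
  obtain K0 where K0: "compactin \<tau> K0" "measure M (space M - K0) \<le> e / 4" using tight[of "e/4"] e by auto
  obtain C0 where C0: "closedin \<tau> C0" "C0 \<subseteq> A" "measure M (A - C0) < e / 4" using closed_approx[OF A, of "e/4"] e by auto
  have "\<exists>C D. closedin \<tau> C \<and> closedin \<tau> D \<and> C \<subseteq> \<alpha> n \<and> D \<subseteq> space M - \<alpha> n \<and>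
      measure M (space M - (C \<union> D)) \<le> e / 4 * (1/2) ^ Suc n" for n
  proof -
    have pos: "0 < e / 8 * (1/2) ^ Suc n" using e by simp
    obtain C where C: "closedin \<tau> C" "C \<subseteq> \<alpha> n" "measure M (\<alpha> n - C) < e / 8 * (1/2) ^ Suc n"
      using closed_approx[OF \<alpha>[of n] pos] by blast
    obtain D where D: "closedin \<tau> D" "D \<subseteq> space M - \<alpha> n" "measure M ((space M - \<alpha> n) - D) < e / 8 * (1/2) ^ Suc n"
      using closed_approx[OF sets.compl_sets[OF \<alpha>[of n]] pos] by blast
    have "space M - (C \<union> D) \<subseteq> (\<alpha> n - C) \<union> ((space M - \<alpha> n) - D)" by blast
    then have "measure M (space M - (C \<union> D)) \<le> measure M ((\<alpha> n - C) \<union> ((space M - \<alpha> n) - D))"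
      using \<alpha> closed_sets C D by (intro finite_measure_mono) auto
    also have "\<dots> \<le> measure M (\<alpha> n - C) + measure M ((space M - \<alpha> n) - D)"
      using \<alpha> closed_sets C D by (intro measure_Un_le) auto
    finally have "measure M (space M - (C \<union> D)) \<le> e / 4 * (1/2) ^ Suc n" using C(3) D(3) by linarith
    then have "closedin \<tau> C \<and> closedin \<tau> D \<and> C \<subseteq> \<alpha> n \<and> D \<subseteq> space M - \<alpha> n \<and>
        measure M (space M - (C \<union> D)) \<le> e / 4 * (1/2) ^ Suc n" using C D by simp
    then show ?thesis by blast
  qed
  then obtain C D where CD: "\<And>n. closedin \<tau> (C n)" "\<And>n. closedin \<tau> (D n)" "\<And>n. C n \<subseteq> \<alpha> n" "\<And>n. D n \<subseteq> space M - \<alpha> n"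
    and m: "\<And>n. measure M (space M - (C n \<union> D n)) \<le> e / 4 * (1/2) ^ Suc n" by metis
  let ?I = "\<Inter>n. C n \<union> D n"
  have I: "closedin \<tau> ?I" using CD by (intro closedin_Inter) auto
  have K0c: "closedin \<tau> K0"
    using compactin_imp_closedin[OF _ K0(1)] completely_metrizable_imp_metrizable_space[OF cm] metrizable_imp_Hausdorff_space by blast
  define K where "K = C0 \<inter> ?I \<inter> K0"
  have Kc: "closedin \<tau> K" unfolding K_def using C0 I K0c by (intro closedin_Int)
  have "compactin \<tau> K" unfolding K_def using C0 I by (intro closed_Int_compactin closedin_Int K0) auto
  moreover have "K \<subseteq> A" using C0 by (auto simp: K_def)
  moreover have "measure M (A - K) < e"
  proof -
    have Im: "measure M (space M - ?I) \<le> e / 4"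
      using CD closed_sets by (intro measure_Diff_INT_le m) auto
    have s: "?I \<in> sets M" "K0 \<in> sets M" "C0 \<in> sets M" using I K0c C0 closed_sets by auto
    have "A - K \<subseteq> (A - C0) \<union> ((space M - ?I) \<union> (space M - K0))"
      using sets.sets_into_space[OF A] unfolding K_def by blast
    then have "measure M (A - K) \<le> measure M ((A - C0) \<union> ((space M - ?I) \<union> (space M - K0)))"
      using s A by (intro finite_measure_mono) auto
    also have "\<dots> \<le> measure M (A - C0) + measure M ((space M - ?I) \<union> (space M - K0))"
      using s A by (intro measure_Un_le) auto
    also have "measure M ((space M - ?I) \<union> (space M - K0)) \<le> measure M (space M - ?I) + measure M (space M - K0)"
      using s by (intro measure_Un_le) auto
    finally show ?thesis using Im C0 K0 e by linarith
  qed
  moreover have "closedin \<tau> (K \<inter> \<alpha> n)" "closedin \<tau> (K - \<alpha> n)" for n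
  proof -
    have "K \<subseteq> C n \<union> D n" unfolding K_def by blast
    then have "K \<inter> \<alpha> n = K \<inter> C n" "K - \<alpha> n = K \<inter> D n" using CD(3,4)[of n] by blast+
    then show "closedin \<tau> (K \<inter> \<alpha> n)" "closedin \<tau> (K - \<alpha> n)" using Kc CD(1,2) by (auto intro: closedin_Int)
  qed
  ultimately show ?thesis using that closed_sets[OF Kc] by blast
qed

end

text \<open>
  The pairs that agree in step \<open>k\<close> form a closed subset of the compact set \<open>K \<times> L\<close>; if these sets have
  empty intersection, finitely many of them already have.
\<close>

lemma compact_agreement:
  fixes \<alpha> :: "nat \<Rightarrow> 'a set" and \<beta> :: "nat \<Rightarrow> 'b set"
  assumes K: "compactin \<sigma> K" "\<And>n. closedin \<sigma> (K \<inter> \<alpha> n)" "\<And>n. closedin \<sigma> (K - \<alpha> n)"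
    and L: "compactin \<tau> L" "\<And>n. closedin \<tau> (L \<inter> \<beta> n)" "\<And>n. closedin \<tau> (L - \<beta> n)"
    and none: "\<And>x y. x \<in> K \<Longrightarrow> y \<in> L \<Longrightarrow> \<exists>n. (x \<in> \<alpha> n) \<noteq> (y \<in> \<beta> n)"
  shows "\<exists>n. \<forall>x\<in>K. \<forall>y\<in>L. \<exists>k<n. (x \<in> \<alpha> k) \<noteq> (y \<in> \<beta> k)"
proof -
  let ?P = "prod_topology \<sigma> \<tau>"
  define E where "E k = ((K \<inter> \<alpha> k) \<times> (L \<inter> \<beta> k)) \<union> ((K - \<alpha> k) \<times> (L - \<beta> k))" for k
  have E: "closedin ?P (E k)" for k
    unfolding E_def using K L by (intro closedin_Un) (auto simp: closedin_prod_Times_iff)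
  define U where "U k = topspace ?P - E k" for k
  have KL: "compactin ?P (K \<times> L)" using K(1) L(1) by (simp add: compactin_Times)
  have sub: "K \<times> L \<subseteq> topspace ?P" using compactin_subset_topspace[OF KL] .
  have cov: "K \<times> L \<subseteq> \<Union>(range U)"
  proof
    fix z assume z: "z \<in> K \<times> L"
    then have "fst z \<in> K" "snd z \<in> L" by auto
    from none[OF this] obtain n where "(fst z \<in> \<alpha> n) \<noteq> (snd z \<in> \<beta> n)" by (rule exE)
    then have "z \<notin> E n" by (auto simp: E_def)
    then show "z \<in> \<Union>(range U)" using z sub by (auto simp: U_def)
  qed
  have "\<forall>W\<in>range U. openin ?P W" unfolding U_def using openin_diff[OF openin_topspace E] by blast
  then obtain \<F> where F: "finite \<F>" "\<F> \<subseteq> range U" "K \<times> L \<subseteq> \<Union>\<F>"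
    using KL cov unfolding compactin_def by meson
  obtain J where J: "finite J" "\<F> = U ` J" using finite_subset_image[OF F(1,2)] by blast
  obtain n where n: "\<forall>k\<in>J. k < n" using J(1) unfolding finite_nat_set_iff_bounded by (rule exE)
  have "\<exists>k<n. (x \<in> \<alpha> k) \<noteq> (y \<in> \<beta> k)" if xy: "x \<in> K" "y \<in> L" for x y
  proof -
    have "(x, y) \<in> \<Union>\<F>" using F(3) xy by blast
    then obtain k where "k \<in> J" "(x, y) \<notin> E k" unfolding J(2) U_def by blast
    then show ?thesis using n xy by (auto simp: E_def)
  qed
  then show ?thesis by blast
qed

definition vanishes_on :: "'a measure \<Rightarrow> 'b measure \<Rightarrow> (('a \<Rightarrow> complex) \<Rightarrow> 'b \<Rightarrow> complex) \<Rightarrow> 'a set \<Rightarrow> 'b set \<Rightarrow> bool" where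
  "vanishes_on M N T A B \<longleftrightarrow> (\<forall>f\<in>SQ M. AE y in N. indicator B y * T (\<lambda>x. indicator A x * f x) y = 0)"

text \<open>
  Cut \<open>K\<close> and \<open>L\<close> along the last pair. Intertwining kills the two mixed pieces, and on the two others
  the last index no longer separates any points.
\<close>

lemma vanishes_on_finite_agreement:
  fixes \<alpha> :: "nat \<Rightarrow> 'a set" and \<beta> :: "nat \<Rightarrow> 'b set"
  assumes T: "aeop M N T" and i: "\<And>n. intertwines M N T (\<alpha> n) (\<beta> n)"
    and \<alpha>: "\<And>n. \<alpha> n \<in> sets M" and \<beta>: "\<And>n. \<beta> n \<in> sets N"
    and K: "K \<in> sets M" and L: "L \<in> sets N" and none: "\<And>x y. x \<in> K \<Longrightarrow> y \<in> L \<Longrightarrow> \<exists>k<n. (x \<in> \<alpha> k) \<noteq> (y \<in> \<beta> k)"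
  shows "vanishes_on M N T K L"
  using K L none
proof (induction n arbitrary: K L)
  case 0
  then have "K = {} \<or> L = {}" by blast
  then show ?case using aeop_zero[OF T] by (auto simp: vanishes_on_def)
next
  case (Suc n)
  let ?K1 = "K \<inter> \<alpha> n" and ?K2 = "K - \<alpha> n" and ?L1 = "L \<inter> \<beta> n" and ?L2 = "L - \<beta> n"
  have 1: "vanishes_on M N T ?K1 ?L1"
  proof (rule Suc.IH)
    fix x y assume xy: "x \<in> ?K1" "y \<in> ?L1"
    then obtain k where "k < Suc n" "(x \<in> \<alpha> k) \<noteq> (y \<in> \<beta> k)" using Suc.prems(3)[of x y] by auto
    then show "\<exists>k<n. (x \<in> \<alpha> k) \<noteq> (y \<in> \<beta> k)" using xy by (auto simp: less_Suc_eq)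
  qed (use Suc.prems \<alpha> \<beta> in auto)
  have 2: "vanishes_on M N T ?K2 ?L2"
  proof (rule Suc.IH)
    fix x y assume xy: "x \<in> ?K2" "y \<in> ?L2"
    then obtain k where "k < Suc n" "(x \<in> \<alpha> k) \<noteq> (y \<in> \<beta> k)" using Suc.prems(3)[of x y] by auto
    then show "\<exists>k<n. (x \<in> \<alpha> k) \<noteq> (y \<in> \<beta> k)" using xy by (auto simp: less_Suc_eq)
  qed (use Suc.prems \<alpha> \<beta> in auto)
  show ?case
    unfolding vanishes_on_def
  proof
    fix f assume f: "f \<in> SQ M"
    let ?f1 = "\<lambda>x. indicator ?K1 x * f x" and ?f2 = "\<lambda>x. indicator ?K2 x * f x"
    have S: "?f1 \<in> SQ M" "?f2 \<in> SQ M" using f Suc.prems \<alpha> by (auto intro: sq_cut)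
    have "(\<lambda>x. indicator K x * f x) = (\<lambda>x. ?f1 x + ?f2 x)" by (auto simp: indicator_def)
    then have "AE y in N. T (\<lambda>x. indicator K x * f x) y = T ?f1 y + T ?f2 y" using aeop_add[OF T S] by simp
    moreover have "AE y in N. T ?f1 y = indicator (\<beta> n) y * T ?f1 y"
    proof -
      have "(\<lambda>x. indicator (\<alpha> n) x * ?f1 x) = ?f1" by (auto simp: indicator_def)
      then show ?thesis using i[of n] S(1) unfolding intertwines_def by metis
    qed
    moreover have "AE y in N. indicator (\<beta> n) y * T ?f2 y = 0"
    proof -
      have "(\<lambda>x. indicator (\<alpha> n) x * ?f2 x) = (\<lambda>x. 0)" by (auto simp: indicator_def)
      then have "AE y in N. T (\<lambda>x. 0) y = indicator (\<beta> n) y * T ?f2 y"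
        using i[of n] S(2) unfolding intertwines_def by metis
      with aeop_zero[OF T] show ?thesis by eventually_elim simp
    qed
    moreover have "AE y in N. indicator ?L1 y * T ?f1 y = 0" "AE y in N. indicator ?L2 y * T ?f2 y = 0"
      using 1 2 f by (auto simp: vanishes_on_def)
    ultimately show "AE y in N. indicator L y * T (\<lambda>x. indicator K x * f x) y = 0"
      by eventually_elim (auto simp: indicator_def split: if_splits)
  qed
qed

text \<open>
  The estimate for compact \<open>K \<subseteq> A\<close> and \<open>L \<subseteq> B\<close> passes to \<open>A\<close> and \<open>B\<close> because the norms of \<open>f\<close> on \<open>A - K\<close>
  and of \<open>T 1\<^bsub>A\<^esub> f\<close> on \<open>B - L\<close> are small.
\<close>

theorem vanishes_off_agreement:
  assumes sbM: "standard_borel M" and sfM: "sigma_finite_measure M"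
    and sbN: "standard_borel N" and sfN: "sigma_finite_measure N"
    and T: "aeop M N T" and i: "\<And>n :: nat. intertwines M N T (\<alpha> n) (\<beta> n)"
    and \<alpha>: "\<And>n. \<alpha> n \<in> sets M" and \<beta>: "\<And>n. \<beta> n \<in> sets N"
    and A: "A \<in> sets M" and B: "B \<in> sets N" and none: "\<And>x y. x \<in> A \<Longrightarrow> y \<in> B \<Longrightarrow> \<exists>n. (x \<in> \<alpha> n) \<noteq> (y \<in> \<beta> n)"
  shows "vanishes_on M N T A B"
proof -
  obtain h where hM: "weight M h" using ex_weight_locale[OF sfM] .
  obtain k where kN: "weight N k" using ex_weight_locale[OF sfN] .
  interpret hM: weight M h by (rule hM)
  interpret kN: weight N k by (rule kN)
  obtain \<sigma> where "completely_metrizable_space \<sigma>" "second_countable \<sigma>" "topspace \<sigma> = space M"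
      "sets M = sigma_sets (space M) {U. openin \<sigma> U}" using sbM unfolding standard_borel_def by blast
  then interpret P: polish_measure "weighted M h" \<sigma>
    by (intro polish_measure.intro hM.finite_weighted polish_measure_axioms.intro) auto
  obtain \<tau> where "completely_metrizable_space \<tau>" "second_countable \<tau>" "topspace \<tau> = space N"
      "sets N = sigma_sets (space N) {U. openin \<tau> U}" using sbN unfolding standard_borel_def by blast
  then interpret Q: polish_measure "weighted N k" \<tau>
    by (intro polish_measure.intro kN.finite_weighted polish_measure_axioms.intro) auto
  obtain C where C: "C > 0" "\<And>f. f \<in> SQ M \<Longrightarrow> nrm N (T f) \<le> C * nrm M f" using aeop_bound[OF T] by blast
  show ?thesis
    unfolding vanishes_on_def
  proof
    fix f assume f: "f \<in> SQ M"
    let ?Af = "\<lambda>x. indicator A x * f x"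
    let ?u = "T ?Af"
    have Af: "?Af \<in> SQ M" by (rule sq_cut[OF f A])
    have u: "?u \<in> SQ N" by (rule aeop_sq[OF T Af])
    have Bu: "(\<lambda>y. indicator B y * ?u y) \<in> SQ N" by (rule sq_cut[OF u B])
    have "nrm N (\<lambda>y. indicator B y * ?u y) \<le> (C + 1) * e" if e: "0 < e" for e
    proof -
      obtain \<delta> where d: "0 < \<delta>" "\<And>A. A \<in> sets M \<Longrightarrow> measure (weighted M h) A < \<delta> \<Longrightarrow> nrm M (\<lambda>x. indicator A x * f x) < e"
        using hM.small_weight_small_norm[OF f e] by blast
      obtain \<delta>' where d': "0 < \<delta>'" "\<And>A. A \<in> sets N \<Longrightarrow> measure (weighted N k) A < \<delta>' \<Longrightarrow> nrm N (\<lambda>x. indicator A x * ?u x) < e"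
        using kN.small_weight_small_norm[OF u e] by blast
      obtain K where K: "compactin \<sigma> K" "K \<subseteq> A" "K \<in> sets M" "measure (weighted M h) (A - K) < \<delta>"
        "\<And>n. closedin \<sigma> (K \<inter> \<alpha> n)" "\<And>n. closedin \<sigma> (K - \<alpha> n)"
        using P.compact_clopen_approx[of A \<alpha> \<delta>] A \<alpha> d(1) by (auto simp: hM.sets_weighted)
      obtain L where L: "compactin \<tau> L" "L \<subseteq> B" "L \<in> sets N" "measure (weighted N k) (B - L) < \<delta>'"
        "\<And>n. closedin \<tau> (L \<inter> \<beta> n)" "\<And>n. closedin \<tau> (L - \<beta> n)"
        using Q.compact_clopen_approx[of B \<beta> \<delta>'] B \<beta> d'(1) by (auto simp: kN.sets_weighted)
      have "\<exists>n. \<forall>x\<in>K. \<forall>y\<in>L. \<exists>k<n. (x \<in> \<alpha> k) \<noteq> (y \<in> \<beta> k)"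
        by (rule compact_agreement[OF K(1,5,6) L(1,5,6) none]) (use K L in auto)
      then obtain n where "\<forall>x\<in>K. \<forall>y\<in>L. \<exists>k<n. (x \<in> \<alpha> k) \<noteq> (y \<in> \<beta> k)" by blast
      then have v: "vanishes_on M N T K L"
        by (intro vanishes_on_finite_agreement[where n = n and \<alpha> = \<alpha> and \<beta> = \<beta>, OF T i \<alpha> \<beta> K(3) L(3)]) blast
      let ?Kf = "\<lambda>x. indicator K x * f x" and ?Rf = "\<lambda>x. indicator (A - K) x * f x"
      have S: "?Kf \<in> SQ M" "?Rf \<in> SQ M" using f K A by (auto intro: sq_cut)
      have "?Af = (\<lambda>x. ?Kf x + ?Rf x)" using K(2) by (auto simp: fun_eq_iff indicator_def)
      then have sp: "AE y in N. ?u y = T ?Kf y + T ?Rf y" using aeop_add[OF T S] by simp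
      let ?v = "\<lambda>y. indicator (B - L) y * ?u y" and ?w = "\<lambda>y. indicator L y * T ?Rf y"
      have vS: "?v \<in> SQ N" and wS: "?w \<in> SQ N" using u aeop_sq[OF T S(2)] L B by (auto intro: sq_cut)
      have "nrm N (\<lambda>y. indicator B y * ?u y) = nrm N (\<lambda>y. ?v y + ?w y)"
      proof (rule nrm_cong_AE)
        have vf: "AE y in N. indicator L y * T ?Kf y = 0" using v f by (simp add: vanishes_on_def)
        show "AE y in N. indicator B y * ?u y = ?v y + ?w y"
          using sp vf
        proof eventually_elim
          case (elim y)
          then show ?case using L(2) by (cases "y \<in> L"; cases "y \<in> B") auto
        qed
      qed (intro sq_measurable sq_add Bu vS wS)+
      also have "\<dots> \<le> nrm N ?v + nrm N ?w" by (rule nrm_triangle[OF vS wS])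
      also have "nrm N ?v \<le> e" using d'(2)[of "B - L"] B L by auto
      also have "nrm N ?w \<le> nrm N (T ?Rf)" by (rule nrm_cut_le[OF aeop_sq[OF T S(2)] L(3)])
      also have "\<dots> \<le> C * nrm M ?Rf" by (rule C(2)[OF S(2)])
      also have "\<dots> \<le> C * e" using d(2)[of "A - K"] A K C(1) by (intro mult_left_mono) auto
      finally show ?thesis by (simp add: distrib_right)
    qed
    note est = this
    have "nrm N (\<lambda>y. indicator B y * ?u y) \<le> 0 + e" if "0 < e" for e
    proof -
      have "0 < e / (C + 1)" using that C(1) by simp
      from est[OF this] show ?thesis using C(1) by simp
    qed
    then have "nrm N (\<lambda>y. indicator B y * ?u y) \<le> 0" by (rule field_le_epsilon)
    then have "nrm N (\<lambda>y. indicator B y * ?u y) = 0" using nrm_nonneg[of N] by (intro antisym) auto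
    then show "AE y in N. indicator B y * ?u y = 0" by (simp add: nrm_eq_0_iff[OF Bu])
  qed
qed

section \<open>Operators on equivalence classes\<close>

lemma l2_class_eq: "f \<in> SQ M \<Longrightarrow> l2_class M f = {g \<in> SQ M. AE x in M. f x = g x}"
  by (auto simp: l2_class_def ae_rel_def)

lemma l2_class_in [simp]: "f \<in> SQ M \<Longrightarrow> l2_class M f \<in> L2 M"
  by (simp add: L2_def l2_class_def quotientI)

lemma l2_rep_class:
  assumes "f \<in> SQ M" shows "l2_rep (l2_class M f) \<in> SQ M" "AE x in M. f x = l2_rep (l2_class M f) x"
proof -
  have "f \<in> l2_class M f" using assms by (simp add: l2_class_eq)
  then have "l2_rep (l2_class M f) \<in> l2_class M f" unfolding l2_rep_def by (rule someI[of "\<lambda>g. g \<in> l2_class M f"])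
  then show "l2_rep (l2_class M f) \<in> SQ M" "AE x in M. f x = l2_rep (l2_class M f) x"
    using assms by (auto simp: l2_class_eq)
qed

lemma l2_class_eq_iff:
  assumes "f \<in> SQ M" "g \<in> SQ M" shows "l2_class M f = l2_class M g \<longleftrightarrow> (AE x in M. f x = g x)"
proof
  assume "l2_class M f = l2_class M g"
  then have "g \<in> l2_class M f" using assms by (simp add: l2_class_eq)
  then show "AE x in M. f x = g x" using assms by (simp add: l2_class_eq)
next
  assume eq: "AE x in M. f x = g x"
  have "(AE x in M. f x = k x) \<longleftrightarrow> (AE x in M. g x = k x)" for k
  proof
    show "AE x in M. g x = k x" if "AE x in M. f x = k x" using that eq by eventually_elim simp
    show "AE x in M. f x = k x" if "AE x in M. g x = k x" using that eq by eventually_elim simp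
  qed
  then show "l2_class M f = l2_class M g" using assms by (simp add: l2_class_eq)
qed

lemma L2_E: assumes "u \<in> L2 M" shows "l2_rep u \<in> SQ M" "l2_class M (l2_rep u) = u"
proof -
  obtain f where f: "f \<in> SQ M" "u = l2_class M f" using assms by (auto simp: L2_def l2_class_def elim: quotientE)
  show S: "l2_rep u \<in> SQ M" using l2_rep_class[OF f(1)] f(2) by simp
  have "AE x in M. l2_rep u x = f x" using l2_rep_class(2)[OF f(1)] unfolding f(2) by eventually_elim simp
  then show "l2_class M (l2_rep u) = u" using l2_class_eq_iff[OF S f(1)] f(2) by simp
qed

lemma l2_norm_nrm: "l2_norm M u = nrm M (l2_rep u)"
  and l2_inner_ip: "l2_inner M u v = ip M (l2_rep u) (l2_rep v)"
  and l2_dist_nrm: "l2_dist M u v = nrm M (\<lambda>x. l2_rep u x - l2_rep v x)"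
  by (simp_all add: l2_norm_def nrm_def l2_inner_def ip_def l2_dist_def)

definition lift :: "'a measure \<Rightarrow> 'b measure \<Rightarrow> (('a \<Rightarrow> complex) \<Rightarrow> 'b \<Rightarrow> complex) \<Rightarrow> ('a, 'b) l2_op" where
  "lift M N R = (\<lambda>u\<in>L2 M. l2_class N (R (l2_rep u)))"

text \<open>
  The inverse of \<open>lift\<close> up to null sets (\<open>lift_rop\<close>, \<open>rop_lift\<close>).
\<close>

definition rop :: "'a measure \<Rightarrow> ('a, 'b) l2_op \<Rightarrow> ('a \<Rightarrow> complex) \<Rightarrow> 'b \<Rightarrow> complex" where
  "rop M T f = l2_rep (T (l2_class M f))"

lemma lift_class:
  assumes R: "aeop M N R" and f: "f \<in> SQ M" shows "lift M N R (l2_class M f) = l2_class N (R f)"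
proof -
  note r = l2_rep_class[OF f]
  have "AE y in N. R (l2_rep (l2_class M f)) y = R f y"
    by (rule aeop_cong[OF R r(1) f]) (use r(2) in eventually_elim, simp)
  then show ?thesis using f r(1) by (simp add: lift_def l2_class_eq_iff aeop_sq[OF R])
qed

lemma lift_bounded: assumes R: "aeop M N R" shows "lift M N R \<in> bounded_ops M N"
proof -
  note E = L2_E[of _ M] and RS = aeop_sq[OF R]
  have rl: "l2_rep (lift M N R u) \<in> SQ N" "AE y in N. R (l2_rep u) y = l2_rep (lift M N R u) y" if "u \<in> L2 M" for u
    using l2_rep_class[OF RS[OF E(1)[OF that]]] that by (auto simp: lift_def)
  have "lift M N R \<in> L2 M \<rightarrow>\<^sub>E L2 N"
    by (auto simp: lift_def PiE_def extensional_def RS E)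
  moreover have "lift M N R (l2_add M u v) = l2_add N (lift M N R u) (lift M N R v)" if u: "u \<in> L2 M" and v: "v \<in> L2 M" for u v
  proof -
    have "lift M N R (l2_add M u v) = l2_class N (R (\<lambda>x. l2_rep u x + l2_rep v x))"
      unfolding l2_add_def by (rule lift_class[OF R sq_add[OF E(1)[OF u] E(1)[OF v]]])
    also have "\<dots> = l2_class N (\<lambda>y. l2_rep (lift M N R u) y + l2_rep (lift M N R v) y)"
      unfolding l2_class_eq_iff[OF RS[OF sq_add[OF E(1)[OF u] E(1)[OF v]]] sq_add[OF rl(1)[OF u] rl(1)[OF v]]]
      using aeop_add[OF R E(1)[OF u] E(1)[OF v]] rl(2)[OF u] rl(2)[OF v] by eventually_elim simp
    finally show ?thesis by (simp add: l2_add_def)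
  qed
  moreover have "lift M N R (l2_scale M c u) = l2_scale N c (lift M N R u)" if u: "u \<in> L2 M" for u c
  proof -
    have "lift M N R (l2_scale M c u) = l2_class N (R (\<lambda>x. c * l2_rep u x))"
      unfolding l2_scale_def by (rule lift_class[OF R sq_scale[OF E(1)[OF u]]])
    also have "\<dots> = l2_class N (\<lambda>y. c * l2_rep (lift M N R u) y)"
      unfolding l2_class_eq_iff[OF RS[OF sq_scale[OF E(1)[OF u]]] sq_scale[OF rl(1)[OF u]]]
      using aeop_scale[OF R E(1)[OF u], of c] rl(2)[OF u] by eventually_elim simp
    finally show ?thesis by (simp add: l2_scale_def)
  qed
  moreover have "\<exists>C. \<forall>u\<in>L2 M. l2_norm N (lift M N R u) \<le> C * l2_norm M u"
  proof -
    obtain C where C: "C > 0" "\<And>f. f \<in> SQ M \<Longrightarrow> nrm N (R f) \<le> C * nrm M f" using aeop_bound[OF R] by blast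
    have "l2_norm N (lift M N R u) \<le> C * l2_norm M u" if u: "u \<in> L2 M" for u
    proof -
      have "nrm N (R (l2_rep u)) = nrm N (l2_rep (lift M N R u))"
        by (rule nrm_cong_AE[OF sq_measurable[OF RS[OF E(1)[OF u]]] sq_measurable[OF rl(1)[OF u]] rl(2)[OF u]])
      then show ?thesis using C(2)[OF E(1)[OF u]] by (simp add: l2_norm_nrm)
    qed
    then show ?thesis by blast
  qed
  ultimately show ?thesis by (simp add: bounded_ops_def)
qed

lemma bounded_ops_in: "T \<in> bounded_ops M N \<Longrightarrow> u \<in> L2 M \<Longrightarrow> T u \<in> L2 N"
  by (auto simp: bounded_ops_def)

lemma rop_sq: "T \<in> bounded_ops M N \<Longrightarrow> f \<in> SQ M \<Longrightarrow> rop M T f \<in> SQ N"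
  by (simp add: rop_def L2_E bounded_ops_in)

lemma rop_class: "T \<in> bounded_ops M N \<Longrightarrow> f \<in> SQ M \<Longrightarrow> l2_class N (rop M T f) = T (l2_class M f)"
  by (simp add: rop_def L2_E bounded_ops_in)

lemma rop_rep: "u \<in> L2 M \<Longrightarrow> rop M T (l2_rep u) = l2_rep (T u)"
  by (simp add: rop_def L2_E)

lemma l2_add_class:
  assumes f: "f \<in> SQ M" and g: "g \<in> SQ M" shows "l2_add M (l2_class M f) (l2_class M g) = l2_class M (\<lambda>x. f x + g x)"
  unfolding l2_add_def l2_class_eq_iff[OF sq_add[OF l2_rep_class(1)[OF f] l2_rep_class(1)[OF g]] sq_add[OF f g]]
  using l2_rep_class(2)[OF f] l2_rep_class(2)[OF g] by eventually_elim simp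

lemma l2_scale_class:
  assumes f: "f \<in> SQ M" shows "l2_scale M c (l2_class M f) = l2_class M (\<lambda>x. c * f x)"
  unfolding l2_scale_def l2_class_eq_iff[OF sq_scale[OF l2_rep_class(1)[OF f]] sq_scale[OF f]]
  using l2_rep_class(2)[OF f] by eventually_elim simp

lemma l2_norm_class: assumes f: "f \<in> SQ M" shows "l2_norm M (l2_class M f) = nrm M f"
  unfolding l2_norm_nrm
  by (rule nrm_cong_AE[symmetric]) (use l2_rep_class[OF f] f in \<open>auto simp: sq_integrable_def\<close>)

lemma aeop_rop: assumes T: "T \<in> bounded_ops M N" shows "aeop M N (rop M T)"
  unfolding aeop_def
proof (intro conjI ballI allI)
  note S = rop_sq[OF T]
  have T1: "T (l2_add M u v) = l2_add N (T u) (T v)" if "u \<in> L2 M" "v \<in> L2 M" for u v using T that by (simp add: bounded_ops_def)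
  have T2: "T (l2_scale M c u) = l2_scale N c (T u)" if "u \<in> L2 M" for u c using T that by (simp add: bounded_ops_def)
  fix f assume f: "f \<in> SQ M"
  show "rop M T f \<in> SQ N" using f by (rule S)
  show "AE y in N. rop M T (\<lambda>x. c * f x) y = c * rop M T f y" for c
  proof -
    have "l2_class N (rop M T (\<lambda>x. c * f x)) = T (l2_scale M c (l2_class M f))"
      by (simp only: rop_class[OF T sq_scale[OF f]] l2_scale_class[OF f])
    also have "\<dots> = l2_class N (\<lambda>y. c * rop M T f y)"
      by (simp only: T2[OF l2_class_in[OF f]] rop_class[OF T f, symmetric] l2_scale_class[OF S[OF f]])
    finally show ?thesis unfolding l2_class_eq_iff[OF S[OF sq_scale[OF f]] sq_scale[OF S[OF f]]] .
  qed
  fix g assume g: "g \<in> SQ M"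
  show "AE y in N. rop M T (\<lambda>x. f x + g x) y = rop M T f y + rop M T g y"
  proof -
    have "l2_class N (rop M T (\<lambda>x. f x + g x)) = T (l2_add M (l2_class M f) (l2_class M g))"
      by (simp only: rop_class[OF T sq_add[OF f g]] l2_add_class[OF f g])
    also have "\<dots> = l2_class N (\<lambda>y. rop M T f y + rop M T g y)"
      by (simp only: T1[OF l2_class_in[OF f] l2_class_in[OF g]] rop_class[OF T f, symmetric]
          rop_class[OF T g, symmetric] l2_add_class[OF S[OF f] S[OF g]])
    finally show ?thesis unfolding l2_class_eq_iff[OF S[OF sq_add[OF f g]] sq_add[OF S[OF f] S[OF g]]] .
  qed
next
  obtain C where C: "\<forall>u\<in>L2 M. l2_norm N (T u) \<le> C * l2_norm M u" using T by (auto simp: bounded_ops_def)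
  have "nrm N (rop M T f) \<le> C * nrm M f" if f: "f \<in> SQ M" for f
    using C[rule_format, OF l2_class_in[OF f]] unfolding l2_norm_class[OF f] by (simp add: l2_norm_nrm rop_def)
  then show "\<exists>C. \<forall>f\<in>SQ M. nrm N (rop M T f) \<le> C * nrm M f" by blast
qed

lemma lift_rop: assumes T: "T \<in> bounded_ops M N" shows "lift M N (rop M T) = T"
proof (rule extensionalityI[of _ "L2 M"])
  show "lift M N (rop M T) \<in> extensional (L2 M)" by (simp add: lift_def)
  show "T \<in> extensional (L2 M)" using T by (auto simp: bounded_ops_def PiE_def)
  show "lift M N (rop M T) u = T u" if "u \<in> L2 M" for u
    using that by (simp add: lift_def rop_class[OF T] L2_E)
qed

lemma rop_lift: assumes R: "aeop M N R" and f: "f \<in> SQ M" shows "AE y in N. rop M (lift M N R) f y = R f y"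
  unfolding rop_def lift_class[OF R f] using l2_rep_class(2)[OF aeop_sq[OF R f]] by eventually_elim simp

lemma lift_eq_iff:
  assumes R: "aeop M N R" and S: "aeop M N S"
  shows "lift M N R = lift M N S \<longleftrightarrow> (\<forall>f\<in>SQ M. AE y in N. R f y = S f y)"
proof
  assume eq: "lift M N R = lift M N S"
  show "\<forall>f\<in>SQ M. AE y in N. R f y = S f y"
  proof
    fix f assume f: "f \<in> SQ M"
    have "l2_class N (R f) = l2_class N (S f)" using lift_class[OF R f] lift_class[OF S f] eq by simp
    then show "AE y in N. R f y = S f y" using l2_class_eq_iff[OF aeop_sq[OF R f] aeop_sq[OF S f]] by simp
  qed
next
  assume eq: "\<forall>f\<in>SQ M. AE y in N. R f y = S f y"
  show "lift M N R = lift M N S"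
    unfolding lift_def
  proof (rule restrict_ext)
    fix u assume "u \<in> L2 M"
    note r = L2_E(1)[OF this]
    show "l2_class N (R (l2_rep u)) = l2_class N (S (l2_rep u))"
      using l2_class_eq_iff[OF aeop_sq[OF R r] aeop_sq[OF S r]] eq r by simp
  qed
qed

lemma op_zero_lift: "op_zero M N = lift M N (\<lambda>f y. 0)"
  by (simp add: op_zero_def lift_def l2_zero_def)

lemma op_add_lift:
  assumes R: "aeop M N R" and S: "aeop M N S"
  shows "op_add M N (lift M N R) (lift M N S) = lift M N (\<lambda>f y. R f y + S f y)"
  unfolding op_add_def lift_def
  by (rule restrict_ext) (simp add: l2_add_class aeop_sq[OF R] aeop_sq[OF S] L2_E)

lemma op_scale_lift:
  assumes R: "aeop M N R" shows "op_scale M N c (lift M N R) = lift M N (\<lambda>f y. c * R f y)"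
  unfolding op_scale_def lift_def
  by (rule restrict_ext) (simp add: l2_scale_class aeop_sq[OF R] L2_E)

lemma compose_lift:
  assumes R: "aeop M N R" and S: "aeop N L S"
  shows "compose (L2 M) (lift N L S) (lift M N R) = lift M L (\<lambda>f. S (R f))"
proof -
  have "lift N L S (lift M N R u) = l2_class L (S (R (l2_rep u)))" if u: "u \<in> L2 M" for u
    using lift_class[OF S aeop_sq[OF R L2_E(1)[OF u]]] u by (simp add: lift_def)
  then have "compose (L2 M) (lift N L S) (lift M N R) = (\<lambda>u\<in>L2 M. l2_class L (S (R (l2_rep u))))"
    unfolding compose_def by (rule restrict_ext)
  then show ?thesis by (simp only: lift_def[of M L])
qed

lemma mult_op_lift: "mult_op M \<phi> = lift M M (\<lambda>f x. \<phi> x * f x)"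
  by (simp add: mult_op_def lift_def)

lemma mult_proj_lift: "mult_proj M A = lift M M (\<lambda>f x. indicator A x * f x)"
  by (simp add: mult_proj_def mult_op_lift)

lemma l2_inner_class:
  assumes f: "f \<in> SQ M" and g: "g \<in> SQ M" shows "l2_inner M (l2_class M f) (l2_class M g) = ip M f g"
  unfolding l2_inner_ip
  by (rule ip_cong_AE[symmetric]) (use l2_rep_class[OF f] l2_rep_class[OF g] f g in \<open>auto simp: sq_integrable_def\<close>)

lemma op_adj_lift:
  assumes a: "adjp M N R S" shows "op_adj M N (lift M N R) = lift N M S"
  unfolding op_adj_def
proof (rule the_equality)
  note R = adjp_aeop[OF a] and S = adjp_aeop'[OF a]
  have inner: "l2_inner N (lift M N R u) v = ip N (R (l2_rep u)) (l2_rep v)" if "u \<in> L2 M" "v \<in> L2 N" for u v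
    using l2_inner_class[OF aeop_sq[OF R L2_E(1)[OF that(1)]] L2_E(1)[OF that(2)]] that
    by (simp add: lift_def L2_E)
  have inner': "l2_inner M u (lift N M S v) = ip M (l2_rep u) (S (l2_rep v))" if "u \<in> L2 M" "v \<in> L2 N" for u v
    using l2_inner_class[OF L2_E(1)[OF that(1)] aeop_sq[OF S L2_E(1)[OF that(2)]]] that
    by (simp add: lift_def L2_E)
  show "lift N M S \<in> bounded_ops N M \<and> (\<forall>u\<in>L2 M. \<forall>v\<in>L2 N. l2_inner N (lift M N R u) v = l2_inner M u (lift N M S v))"
    using lift_bounded[OF S] adjpD[OF a] by (simp add: inner inner' L2_E)
  fix S' assume S': "S' \<in> bounded_ops N M \<and> (\<forall>u\<in>L2 M. \<forall>v\<in>L2 N. l2_inner N (lift M N R u) v = l2_inner M u (S' v))"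
  have op': "aeop N M (rop N S')" using S' by (intro aeop_rop) simp
  have "lift N M (rop N S') = lift N M S"
    unfolding lift_eq_iff[OF op' S]
  proof
    fix g assume g: "g \<in> SQ N"
    show "AE x in M. rop N S' g x = S g x"
    proof (rule AE_eqI_ip[OF aeop_sq[OF op' g] aeop_sq[OF S g]])
      fix k assume k: "k \<in> SQ M"
      have "ip M k (rop N S' g) = l2_inner M (l2_class M k) (S' (l2_class N g))"
        using l2_inner_class[OF k aeop_sq[OF op' g]] rop_class[of S' N M g] S' g by simp
      also have "\<dots> = l2_inner N (lift M N R (l2_class M k)) (l2_class N g)" using S' k g by simp
      also have "\<dots> = ip N (R k) g" by (simp add: lift_class[OF R k] l2_inner_class aeop_sq[OF R k] g)
      also have "\<dots> = ip M k (S g)" by (rule adjpD[OF a k g])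
      finally show "ip M (rop N S' g) k = ip M (S g) k" by (metis ip_commute)
    qed
  qed
  then show "S' = lift N M S" using lift_rop S' by metis
qed

lemma supported_by_lift:
  assumes T: "aeop M N T"
  shows "supported_by M N (lift M N T) \<kappa> \<longleftrightarrow>
    (\<forall>A\<in>sets M. \<forall>B\<in>sets N. (A \<times> B) \<inter> \<kappa> = {} \<longrightarrow> vanishes_on M N T A B)"
proof -
  have "compose (L2 M) (mult_proj N B) (compose (L2 M) (lift M N T) (mult_proj M A)) = op_zero M N \<longleftrightarrow> vanishes_on M N T A B"
    if A: "A \<in> sets M" and B: "B \<in> sets N" for A B
  proof -
    note TA = aeop_comp[OF aeop_cut[OF A] T] and BTA = aeop_comp[OF aeop_comp[OF aeop_cut[OF A] T] aeop_cut[OF B]]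
    have "compose (L2 M) (mult_proj N B) (compose (L2 M) (lift M N T) (mult_proj M A))
        = lift M N (\<lambda>f y. indicator B y * T (\<lambda>x. indicator A x * f x) y)"
      unfolding mult_proj_lift compose_lift[OF aeop_cut[OF A] T] compose_lift[OF TA aeop_cut[OF B]] ..
    then show ?thesis
      unfolding op_zero_lift vanishes_on_def by (simp add: lift_eq_iff[OF BTA aeop_const_zero])
  qed
  then show ?thesis by (auto simp: supported_by_def)
qed

lemma ops_supported_lift:
  "T \<in> ops_supported M N \<kappa> \<longleftrightarrow> T \<in> bounded_ops M N \<and>
    (\<forall>A\<in>sets M. \<forall>B\<in>sets N. (A \<times> B) \<inter> \<kappa> = {} \<longrightarrow> vanishes_on M N (rop M T) A B)"
proof (cases "T \<in> bounded_ops M N")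
  case True
  then show ?thesis using supported_by_lift[OF aeop_rop[OF True], of \<kappa>] by (simp add: ops_supported_def lift_rop)
qed (simp add: ops_supported_def)

lemma lift_in_ops_supported:
  assumes R: "aeop M N R"
  shows "lift M N R \<in> ops_supported M N \<kappa> \<longleftrightarrow>
    (\<forall>A\<in>sets M. \<forall>B\<in>sets N. (A \<times> B) \<inter> \<kappa> = {} \<longrightarrow> vanishes_on M N R A B)"
  using supported_by_lift[OF R] lift_bounded[OF R] by (simp add: ops_supported_def)

lemma ops_supported_subspace: "linear_subspace M N (ops_supported M N \<kappa>)"
  unfolding linear_subspace_def
proof (intro conjI ballI allI)
  show "ops_supported M N \<kappa> \<subseteq> bounded_ops M N" by (auto simp: ops_supported_def)
  show "op_zero M N \<in> ops_supported M N \<kappa>"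
    unfolding op_zero_lift lift_in_ops_supported[OF aeop_const_zero] by (simp add: vanishes_on_def)
  fix S assume S: "S \<in> ops_supported M N \<kappa>"
  then have Sb: "S \<in> bounded_ops M N" by (simp add: ops_supported_def)
  note opS = aeop_rop[OF Sb]
  show "op_scale M N c S \<in> ops_supported M N \<kappa>" for c
  proof -
    have "lift M N (\<lambda>f y. c * rop M S f y) \<in> ops_supported M N \<kappa>"
      unfolding lift_in_ops_supported[OF aeop_smult[OF opS]] vanishes_on_def
    proof (intro ballI impI)
      fix A B f assume "A \<in> sets M" "B \<in> sets N" "A \<times> B \<inter> \<kappa> = {}" "f \<in> SQ M"
      then have "AE y in N. indicator B y * rop M S (\<lambda>x. indicator A x * f x) y = 0"
        using S by (auto simp: ops_supported_lift vanishes_on_def)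
      then show "AE y in N. indicator B y * (c * rop M S (\<lambda>x. indicator A x * f x) y) = 0"
        by eventually_elim auto
    qed
    then show ?thesis using op_scale_lift[OF opS, of c] by (simp add: lift_rop[OF Sb])
  qed
  fix T assume T: "T \<in> ops_supported M N \<kappa>"
  then have Tb: "T \<in> bounded_ops M N" by (simp add: ops_supported_def)
  note opT = aeop_rop[OF Tb]
  have "lift M N (\<lambda>f y. rop M S f y + rop M T f y) \<in> ops_supported M N \<kappa>"
    unfolding lift_in_ops_supported[OF aeop_plus[OF opS opT]] vanishes_on_def
  proof (intro ballI impI)
    fix A B f assume "A \<in> sets M" "B \<in> sets N" "A \<times> B \<inter> \<kappa> = {}" "f \<in> SQ M"
    then have "AE y in N. indicator B y * rop M S (\<lambda>x. indicator A x * f x) y = 0"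
      "AE y in N. indicator B y * rop M T (\<lambda>x. indicator A x * f x) y = 0"
      using S T by (auto simp: ops_supported_lift vanishes_on_def)
    then show "AE y in N. indicator B y * (rop M S (\<lambda>x. indicator A x * f x) y + rop M T (\<lambda>x. indicator A x * f x) y) = 0"
      by eventually_elim (auto simp: distrib_left)
  qed
  then show "op_add M N S T \<in> ops_supported M N \<kappa>" using op_add_lift[OF opS opT] by (simp add: lift_rop Sb Tb)
qed

lemma ops_supported_bimodule: "masa_bimodule M N (ops_supported M N \<kappa>)"
  unfolding masa_bimodule_def
proof (intro conjI ballI)
  show "linear_subspace M N (ops_supported M N \<kappa>)" by (rule ops_supported_subspace)
  fix S T R assume S: "S \<in> mult_algebra N" and T: "T \<in> ops_supported M N \<kappa>" and R: "R \<in> mult_algebra M"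
  obtain \<psi> C where \<psi>: "S = mult_op N \<psi>" "\<psi> \<in> borel_measurable N" "AE y in N. cmod (\<psi> y) \<le> C"
    using S by (auto simp: mult_algebra_def ess_bounded_def)
  obtain \<phi> D where \<phi>: "R = mult_op M \<phi>" "\<phi> \<in> borel_measurable M" "AE x in M. cmod (\<phi> x) \<le> D"
    using R by (auto simp: mult_algebra_def ess_bounded_def)
  have Tb: "T \<in> bounded_ops M N" using T by (simp add: ops_supported_def)
  note opT = aeop_rop[OF Tb] and opR = aeop_mult[OF \<phi>(2,3)] and opS = aeop_mult[OF \<psi>(2,3)]
  note TR = aeop_comp[OF opR opT] and STR = aeop_comp[OF aeop_comp[OF opR opT] opS]
  have "compose (L2 M) S (compose (L2 M) T R) = compose (L2 M) S (compose (L2 M) (lift M N (rop M T)) R)"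
    by (simp add: lift_rop[OF Tb])
  also have "\<dots> = lift M N (\<lambda>f y. \<psi> y * rop M T (\<lambda>x. \<phi> x * f x) y)"
    unfolding \<psi>(1) \<phi>(1) mult_op_lift compose_lift[OF opR opT] compose_lift[OF TR opS] ..
  also have "\<dots> \<in> ops_supported M N \<kappa>"
    unfolding lift_in_ops_supported[OF STR] vanishes_on_def
  proof (intro ballI impI)
    fix A B f assume A: "A \<in> sets M" "B \<in> sets N" "A \<times> B \<inter> \<kappa> = {}" and f: "f \<in> SQ M"
    have "AE y in N. indicator B y * rop M T (\<lambda>x. indicator A x * (\<phi> x * f x)) y = 0"
      using T A sq_mult[OF f \<phi>(2,3)] by (auto simp: ops_supported_lift vanishes_on_def)
    moreover have "(\<lambda>x. indicator A x * (\<phi> x * f x)) = (\<lambda>x. \<phi> x * (indicator A x * f x))" by (simp add: mult_ac)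
    ultimately have "AE y in N. indicator B y * rop M T (\<lambda>x. \<phi> x * (indicator A x * f x)) y = 0" by simp
    then show "AE y in N. indicator B y * (\<psi> y * rop M T (\<lambda>x. \<phi> x * (indicator A x * f x)) y) = 0"
      by eventually_elim auto
  qed
  finally show "compose (L2 M) S (compose (L2 M) T R) \<in> ops_supported M N \<kappa>" .
qed

lemma Metric_space_L2: "Metric_space (L2 N) (l2_dist N)"
proof
  show "0 \<le> l2_dist N u v" for u v by (simp add: l2_dist_nrm)
  show "l2_dist N u v = l2_dist N v u" for u v unfolding l2_dist_nrm by (rule nrm_minus_commute)
  fix u v assume u: "u \<in> L2 N" and v: "v \<in> L2 N"
  have "l2_dist N u v = 0 \<longleftrightarrow> l2_class N (l2_rep u) = l2_class N (l2_rep v)"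
    unfolding l2_dist_nrm l2_class_eq_iff[OF L2_E(1)[OF u] L2_E(1)[OF v]] AE_eq_iff_nrm[OF L2_E(1)[OF u] L2_E(1)[OF v]] ..
  then show "l2_dist N u v = 0 \<longleftrightarrow> u = v" using u v by (simp add: L2_E)
  fix w assume w: "w \<in> L2 N"
  show "l2_dist N u w \<le> l2_dist N u v + l2_dist N v w"
    unfolding l2_dist_nrm by (rule nrm_triangle_sub) (use u v w in \<open>auto intro: L2_E\<close>)
qed

text \<open>
  If \<open>T u\<close> is a limit of vectors \<open>S u\<close> with \<open>S\<close> supported by \<open>\<kappa>\<close>, then \<open>1\<^bsub>B\<^esub> T 1\<^bsub>A\<^esub> f\<close> is a limit of vectors
  \<open>1\<^bsub>B\<^esub> S 1\<^bsub>A\<^esub> f = 0\<close>.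
\<close>

lemma ops_supported_reflexive: "reflexive_space M N (ops_supported M N \<kappa>)"
  unfolding reflexive_space_def
proof (intro ballI impI)
  fix T assume T: "T \<in> bounded_ops M N"
    and cl: "\<forall>u\<in>L2 M. T u \<in> Metric_space.mtopology (L2 N) (l2_dist N) closure_of (\<lambda>A. A u) ` ops_supported M N \<kappa>"
  interpret Metric_space "L2 N" "l2_dist N" by (rule Metric_space_L2)
  show "T \<in> ops_supported M N \<kappa>"
    unfolding ops_supported_lift vanishes_on_def
  proof (intro conjI T ballI impI)
    fix A B f assume A: "A \<in> sets M" and B: "B \<in> sets N" and AB: "A \<times> B \<inter> \<kappa> = {}" and f: "f \<in> SQ M"
    let ?f = "\<lambda>x. indicator A x * f x"
    have f': "?f \<in> SQ M" by (rule sq_cut[OF f A])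
    let ?u = "\<lambda>y. indicator B y * rop M T ?f y"
    have u: "?u \<in> SQ N" by (rule sq_cut[OF rop_sq[OF T f'] B])
    have "nrm N ?u \<le> 0 + r" if r: "0 < r" for r
    proof -
      have "T (l2_class M ?f) \<in> mtopology closure_of (\<lambda>A. A (l2_class M ?f)) ` ops_supported M N \<kappa>"
        using cl f' by simp
      then obtain S where S: "S \<in> ops_supported M N \<kappa>" and d: "S (l2_class M ?f) \<in> mball (T (l2_class M ?f)) r"
        using r unfolding metric_closure_of by auto
      have Sb: "S \<in> bounded_ops M N" using S by (simp add: ops_supported_def)
      have z: "AE y in N. indicator B y * rop M S ?f y = 0"
        using S A B AB f by (auto simp: ops_supported_lift vanishes_on_def)
      let ?d = "\<lambda>y. rop M T ?f y - rop M S ?f y"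
      have dS: "?d \<in> SQ N" using rop_sq[OF T f'] rop_sq[OF Sb f'] by (rule sq_diff)
      have "nrm N ?u = nrm N (\<lambda>y. indicator B y * ?d y)"
      proof (rule nrm_cong_AE[OF sq_measurable[OF u] sq_measurable[OF sq_cut[OF dS B]]])
        show "AE y in N. indicator B y * rop M T ?f y = indicator B y * ?d y"
          using z by eventually_elim (auto simp: right_diff_distrib)
      qed
      also have "\<dots> \<le> nrm N ?d" by (rule nrm_cut_le[OF dS B])
      also have "\<dots> < r" using d by (simp add: in_mball l2_dist_nrm rop_def)
      finally show ?thesis by simp
    qed
    then have "nrm N ?u \<le> 0" by (rule field_le_epsilon)
    then have "nrm N ?u = 0" using nrm_nonneg[of N] by (intro antisym) auto
    then show "AE y in N. ?u y = 0" by (simp add: nrm_eq_0_iff[OF u])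
  qed
qed

section \<open>The weak-star topology\<close>

definition seq_rep :: "(nat \<Rightarrow> ('a \<Rightarrow> complex) set) \<Rightarrow> nat \<times> 'a \<Rightarrow> complex" where
  "seq_rep X = (\<lambda>(n, x). l2_rep (X n) x)"

lemma slice_seq_rep [simp]: "slice (seq_rep X) n = l2_rep (X n)"
  by (simp add: slice_def seq_rep_def)

lemma seq_rep_sq:
  assumes sf: "sigma_finite_measure M" and X: "sq_summable_seq M X" shows "seq_rep X \<in> SQ (seq_meas M)"
proof -
  have "X n \<in> L2 M" for n using X by (auto simp: sq_summable_seq_def)
  then show ?thesis using X by (simp add: sq_seq_iff[OF sf] L2_E sq_summable_seq_def l2_norm_nrm)
qed

text \<open>
  The functionals that define the weak-star topology are the vector functionals of the amplified
  operator.
\<close>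

lemma trace_pairing:
  assumes sfM: "sigma_finite_measure M" and sfN: "sigma_finite_measure N"
    and X: "sq_summable_seq M X" and Y: "sq_summable_seq N Y" and S: "S \<in> bounded_ops M N"
  shows "(\<Sum>n. l2_inner N (S (X n)) (Y n)) = ip (seq_meas N) (amp (rop M S) (seq_rep X)) (seq_rep Y)"
proof -
  have XL: "X n \<in> L2 M" for n using X by (auto simp: sq_summable_seq_def)
  have "amp (rop M S) (seq_rep X) \<in> SQ (seq_meas N)"
    by (rule aeop_sq[OF aeop_amp[OF sfM sfN aeop_rop[OF S]] seq_rep_sq[OF sfM X]])
  from ip_seq_sums[OF sfN this seq_rep_sq[OF sfN Y]] show ?thesis
    by (simp add: sums_iff l2_inner_ip rop_rep[OF XL])
qed

text \<open>
  The isomorphism of \<open>\<ell>\<^sup>2 \<oplus> \<ell>\<^sup>2\<close> with \<open>\<ell>\<^sup>2\<close>; it allows to replace two vectors by one.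
\<close>

definition interleave :: "(nat \<times> 'a \<Rightarrow> complex) \<Rightarrow> (nat \<times> 'a \<Rightarrow> complex) \<Rightarrow> nat \<times> 'a \<Rightarrow> complex" where
  "interleave F G = (\<lambda>(n, x). if even n then F (n div 2, x) else G ((n - 1) div 2, x))"

lemma slice_interleave: "slice (interleave F G) n = (if even n then slice F (n div 2) else slice G ((n - 1) div 2))"
  by (auto simp: slice_def interleave_def)

lemma amp_interleave:
  fixes R :: "('a \<Rightarrow> complex) \<Rightarrow> 'b \<Rightarrow> complex"
  shows "amp R (interleave F G) = interleave (amp R F) (amp R G)"
proof
  fix z :: "nat \<times> 'b"
  obtain n y where z: "z = (n, y)" by (cases z)
  have "interleave (amp R F) (amp R G) (n, y) = (if even n then amp R F (n div 2, y) else amp R G ((n - 1) div 2, y))"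
    by (simp add: interleave_def)
  then show "amp R (interleave F G) z = interleave (amp R F) (amp R G) z"
    unfolding z by (simp add: amp_def slice_interleave)
qed

lemma interleave_diff: "(\<lambda>z. interleave F G z - interleave F' G' z) = interleave (\<lambda>z. F z - F' z) (\<lambda>z. G z - G' z)"
  by (auto simp: interleave_def)

lemma interleave_sums:
  assumes sf: "sigma_finite_measure M" and F: "F \<in> SQ (seq_meas M)" and G: "G \<in> SQ (seq_meas M)"
  shows "(\<lambda>n. (nrm M (slice (interleave F G) n))\<^sup>2) sums ((nrm (seq_meas M) F)\<^sup>2 + (nrm (seq_meas M) G)\<^sup>2)"
proof -
  have "(nrm M (slice (interleave F G) n))\<^sup>2 =
      (if even n then (nrm M (slice F (n div 2)))\<^sup>2 else (nrm M (slice G ((n - 1) div 2)))\<^sup>2)" for n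
    by (simp add: slice_interleave)
  then show ?thesis
    using sums_if[OF nrm_seq_sums[OF sf G] nrm_seq_sums[OF sf F]] by (simp add: add.commute)
qed

lemma interleave_sq:
  assumes sf: "sigma_finite_measure M" and F: "F \<in> SQ (seq_meas M)" and G: "G \<in> SQ (seq_meas M)"
  shows "interleave F G \<in> SQ (seq_meas M)"
  unfolding sq_seq_iff[OF sf]
proof
  show "\<forall>n. slice (interleave F G) n \<in> SQ M"
    unfolding slice_interleave using sq_slice[OF sf F] sq_slice[OF sf G] by simp
  show "summable (\<lambda>n. (nrm M (slice (interleave F G) n))\<^sup>2)"
    by (rule sums_summable[OF interleave_sums[OF sf F G]])
qed

lemma nrm_interleave:
  assumes sf: "sigma_finite_measure M" and F: "F \<in> SQ (seq_meas M)" and G: "G \<in> SQ (seq_meas M)"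
  shows "(nrm (seq_meas M) (interleave F G))\<^sup>2 = (nrm (seq_meas M) F)\<^sup>2 + (nrm (seq_meas M) G)\<^sup>2"
  using sums_unique2[OF nrm_seq_sums[OF sf interleave_sq[OF sf F G]] interleave_sums[OF sf F G]] .

lemma wstar_topspace: "topspace (wstar_topology M N) = bounded_ops M N"
proof -
  have z: "sq_summable_seq L (\<lambda>n. l2_zero L)" for L :: "'c measure"
    unfolding sq_summable_seq_def l2_zero_def l2_norm_class[OF sq_zero] by auto
  have "bounded_ops M N \<in> {{T \<in> bounded_ops M N. (\<Sum>n. l2_inner N (T (x n)) (y n)) \<in> G} | x y G.
        sq_summable_seq M x \<and> sq_summable_seq N y \<and> open G}"
    using z[of M] z[of N] by (auto intro!: exI[of _ "\<lambda>n. l2_zero M"] exI[of _ "\<lambda>n. l2_zero N"] exI[of _ UNIV])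
  then show ?thesis unfolding wstar_topology_def topology_generated_by_topspace by blast
qed

text \<open>
  A basic weak-star neighbourhood is given by finitely many functionals, and by interleaving finitely
  many sequences it is controlled by one.
\<close>

theorem wstar_open_strong_nbhd:
  assumes sfM: "sigma_finite_measure M" and sfN: "sigma_finite_measure N"
    and O: "openin (wstar_topology M N) W" and T: "T \<in> W"
  shows "\<exists>\<xi>\<in>SQ (seq_meas M). \<exists>\<delta>>0. \<forall>S\<in>bounded_ops M N.
    nrm (seq_meas N) (\<lambda>z. amp (rop M T) \<xi> z - amp (rop M S) \<xi> z) < \<delta> \<longrightarrow> S \<in> W"
proof -
  have Tb: "T \<in> bounded_ops M N" using openin_subset[OF O] T by (auto simp: wstar_topspace)
  let ?d = "\<lambda>S \<xi>. nrm (seq_meas N) (\<lambda>z. amp (rop M T) \<xi> z - amp (rop M S) \<xi> z)"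
  have ampS: "amp (rop M S) \<xi> \<in> SQ (seq_meas N)" if "S \<in> bounded_ops M N" "\<xi> \<in> SQ (seq_meas M)" for S \<xi>
    by (rule aeop_sq[OF aeop_amp[OF sfM sfN aeop_rop[OF that(1)]] that(2)])
  have "generate_topology_on {{T \<in> bounded_ops M N. (\<Sum>n. l2_inner N (T (x n)) (y n)) \<in> G} | x y G.
        sq_summable_seq M x \<and> sq_summable_seq N y \<and> open G} W"
    using O unfolding wstar_topology_def by (rule openin_topology_generated_by)
  then show ?thesis using T
  proof (induction)
    case Empty
    then show ?case by simp
  next
    case (Int a b)
    obtain \<xi>1 \<delta>1 where 1: "\<xi>1 \<in> SQ (seq_meas M)" "0 < \<delta>1" "\<And>S. S \<in> bounded_ops M N \<Longrightarrow> ?d S \<xi>1 < \<delta>1 \<Longrightarrow> S \<in> a"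
      using Int.IH(1) Int.prems by auto
    obtain \<xi>2 \<delta>2 where 2: "\<xi>2 \<in> SQ (seq_meas M)" "0 < \<delta>2" "\<And>S. S \<in> bounded_ops M N \<Longrightarrow> ?d S \<xi>2 < \<delta>2 \<Longrightarrow> S \<in> b"
      using Int.IH(2) Int.prems by auto
    let ?\<xi> = "interleave \<xi>1 \<xi>2"
    have le: "?d S \<xi>1 \<le> ?d S ?\<xi> \<and> ?d S \<xi>2 \<le> ?d S ?\<xi>" if S: "S \<in> bounded_ops M N" for S
    proof -
      have D: "(\<lambda>z. amp (rop M T) \<xi> z - amp (rop M S) \<xi> z) \<in> SQ (seq_meas N)" if "\<xi> \<in> SQ (seq_meas M)" for \<xi>
        by (rule sq_diff[OF ampS[OF Tb that] ampS[OF S that]])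
      have "(?d S ?\<xi>)\<^sup>2 = (?d S \<xi>1)\<^sup>2 + (?d S \<xi>2)\<^sup>2"
        unfolding amp_interleave interleave_diff by (rule nrm_interleave[OF sfN D[OF 1(1)] D[OF 2(1)]])
      then have "(?d S \<xi>1)\<^sup>2 \<le> (?d S ?\<xi>)\<^sup>2" "(?d S \<xi>2)\<^sup>2 \<le> (?d S ?\<xi>)\<^sup>2" by simp_all
      then show ?thesis using power2_le_imp_le nrm_nonneg by blast
    qed
    show ?case
    proof (intro bexI[of _ ?\<xi>] exI[of _ "min \<delta>1 \<delta>2"] conjI ballI impI)
      show "?\<xi> \<in> SQ (seq_meas M)" by (rule interleave_sq[OF sfM 1(1) 2(1)])
      show "0 < min \<delta>1 \<delta>2" using 1 2 by simp
      fix S assume S: "S \<in> bounded_ops M N" and lt: "?d S ?\<xi> < min \<delta>1 \<delta>2"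
      have "?d S \<xi>1 < \<delta>1" "?d S \<xi>2 < \<delta>2" using le[OF S] lt by linarith+
      then show "S \<in> a \<inter> b" using 1(3)[OF S] 2(3)[OF S] by simp
    qed
  next
    case (UN K)
    then obtain k where k: "k \<in> K" "T \<in> k" by blast
    from UN.IH[OF k] k(1) show ?case by blast
  next
    case (Basis s)
    then obtain X Y G where X: "sq_summable_seq M X" and Y: "sq_summable_seq N Y" and G: "open G"
      and s: "s = {T \<in> bounded_ops M N. (\<Sum>n. l2_inner N (T (X n)) (Y n)) \<in> G}" by blast
    let ?\<xi> = "seq_rep X" and ?\<upsilon> = "seq_rep Y"
    have xi: "?\<xi> \<in> SQ (seq_meas M)" and ups: "?\<upsilon> \<in> SQ (seq_meas N)"
      using seq_rep_sq[OF sfM X] seq_rep_sq[OF sfN Y] by auto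
    let ?\<omega> = "\<lambda>S. ip (seq_meas N) (amp (rop M S) ?\<xi>) ?\<upsilon>"
    have "?\<omega> T \<in> G" using Basis.prems Tb by (simp add: s trace_pairing[OF sfM sfN X Y])
    then obtain e where e: "0 < e" "\<And>w. dist w (?\<omega> T) < e \<Longrightarrow> w \<in> G" using G open_dist by metis
    show ?case
    proof (intro bexI[OF _ xi] exI[of _ "e / (nrm (seq_meas N) ?\<upsilon> + 1)"] conjI ballI impI)
      show pos: "0 < e / (nrm (seq_meas N) ?\<upsilon> + 1)" using e(1) by (simp add: add_nonneg_pos)
      fix S assume S: "S \<in> bounded_ops M N" and lt: "?d S ?\<xi> < e / (nrm (seq_meas N) ?\<upsilon> + 1)"
      have "dist (?\<omega> S) (?\<omega> T) = cmod (ip (seq_meas N) (\<lambda>z. amp (rop M T) ?\<xi> z - amp (rop M S) ?\<xi> z) ?\<upsilon>)"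
        by (simp add: dist_norm ip_diff_left[OF ampS[OF Tb xi] ampS[OF S xi] ups] norm_minus_commute)
      also have "\<dots> \<le> ?d S ?\<xi> * nrm (seq_meas N) ?\<upsilon>"
        by (rule cauchy_schwarz[OF sq_diff[OF ampS[OF Tb xi] ampS[OF S xi]] ups])
      also have "\<dots> \<le> ?d S ?\<xi> * (nrm (seq_meas N) ?\<upsilon> + 1)" by (intro mult_left_mono) auto
      also have "\<dots> < e / (nrm (seq_meas N) ?\<upsilon> + 1) * (nrm (seq_meas N) ?\<upsilon> + 1)"
        using lt by (intro mult_strict_right_mono) (auto simp: add_nonneg_pos)
      also have "\<dots> = e" using add_nonneg_pos[OF nrm_nonneg[of "seq_meas N" ?\<upsilon>], of 1] by simp
      finally have "?\<omega> S \<in> G" by (rule e(2))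
      then show "S \<in> s" using S by (simp add: s trace_pairing[OF sfM sfN X Y])
    qed
  qed
qed

text \<open>
  If \<open>w = 1\<^bsub>B\<^esub> T 1\<^bsub>A\<^esub> f\<close> is not zero for some rectangle \<open>A \<times> B\<close> that misses \<open>\<kappa>\<close>, the functional with the
  vectors \<open>1\<^bsub>A\<^esub> f\<close> and \<open>w\<close> is nonzero on \<open>T\<close> and vanishes on all operators supported by \<open>\<kappa>\<close>.
\<close>

lemma ops_supported_wstar_closed:
  assumes sfM: "sigma_finite_measure M" and sfN: "sigma_finite_measure N"
  shows "closedin (wstar_topology M N) (ops_supported M N \<kappa>)"
  unfolding closedin_def wstar_topspace
proof (intro conjI)
  show "ops_supported M N \<kappa> \<subseteq> bounded_ops M N" by (auto simp: ops_supported_def)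
  show "openin (wstar_topology M N) (bounded_ops M N - ops_supported M N \<kappa>)"
  proof (subst openin_subopen, intro ballI)
    fix T assume "T \<in> bounded_ops M N - ops_supported M N \<kappa>"
    then have T: "T \<in> bounded_ops M N" and "T \<notin> ops_supported M N \<kappa>" by auto
    then obtain A B f where A: "A \<in> sets M" and B: "B \<in> sets N" and AB: "A \<times> B \<inter> \<kappa> = {}" and f: "f \<in> SQ M"
      and nz: "\<not> (AE y in N. indicator B y * rop M T (\<lambda>x. indicator A x * f x) y = 0)"
      unfolding ops_supported_lift vanishes_on_def by blast
    let ?f = "\<lambda>x. indicator A x * f x"
    let ?w = "\<lambda>y. indicator B y * rop M T ?f y"
    have f': "?f \<in> SQ M" by (rule sq_cut[OF f A])
    have w: "?w \<in> SQ N" by (rule sq_cut[OF rop_sq[OF T f'] B])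
    define X where "X n = (if n = (0::nat) then l2_class M ?f else l2_zero M)" for n
    define Y where "Y n = (if n = (0::nat) then l2_class N ?w else l2_zero N)" for n
    have sq: "sq_summable_seq L (\<lambda>n. if n = (0::nat) then l2_class L g else l2_zero L)" if "g \<in> SQ L"
      for L :: "'c measure" and g
      unfolding sq_summable_seq_def
    proof
      show "range (\<lambda>n. if n = (0::nat) then l2_class L g else l2_zero L) \<subseteq> L2 L" using that by (auto simp: l2_zero_def)
      show "summable (\<lambda>n. (l2_norm L (if n = (0::nat) then l2_class L g else l2_zero L))\<^sup>2)"
        by (rule summable_finite[of "{0}"]) (auto simp: l2_zero_def l2_norm_class)
    qed
    have X: "sq_summable_seq M X" and Y: "sq_summable_seq N Y"
      unfolding X_def[abs_def] Y_def[abs_def] using sq[OF f'] sq[OF w] by auto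
    have val: "(\<Sum>n. l2_inner N (S (X n)) (Y n)) = ip N (rop M S ?f) ?w" if S: "S \<in> bounded_ops M N" for S
    proof -
      have "l2_inner N (S (X n)) (Y n) = 0" if "n \<noteq> 0" for n
      proof -
        have "S (X n) = l2_class N (rop M S (\<lambda>x. 0))" using that rop_class[OF S sq_zero] by (simp add: X_def l2_zero_def)
        then show ?thesis
          using that l2_inner_class[OF rop_sq[OF S sq_zero] sq_zero] by (simp add: Y_def l2_zero_def ip_zero_right)
      qed
      then have "(\<Sum>n. l2_inner N (S (X n)) (Y n)) = (\<Sum>n\<in>{0}. l2_inner N (S (X n)) (Y n))"
        by (intro suminf_finite) auto
      also have "\<dots> = l2_inner N (l2_class N (rop M S ?f)) (l2_class N ?w)"
        using rop_class[OF S f'] by (simp add: X_def Y_def)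
      also have "\<dots> = ip N (rop M S ?f) ?w" by (rule l2_inner_class[OF rop_sq[OF S f'] w])
      finally show ?thesis .
    qed
    let ?V = "{S \<in> bounded_ops M N. (\<Sum>n. l2_inner N (S (X n)) (Y n)) \<in> - {0}}"
    have "openin (wstar_topology M N) ?V"
      unfolding wstar_topology_def
      by (rule topology_generated_by_Basis) (use X Y in \<open>blast intro: open_Compl closed_singleton\<close>)
    moreover have "T \<in> ?V"
    proof -
      have "ip N (rop M T ?f) ?w = ip N ?w ?w"
      proof -
        have "(\<lambda>y. indicator B y * ?w y) = ?w" by (auto simp: indicator_def)
        then show ?thesis using ip_cut_move[of N B "rop M T ?f" ?w] by simp
      qed
      moreover have "nrm N ?w \<noteq> 0" using nz nrm_eq_0_iff[OF w] by simp
      ultimately show ?thesis using T val[OF T] by (simp add: ip_self)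
    qed
    moreover have "?V \<subseteq> bounded_ops M N - ops_supported M N \<kappa>"
    proof
      fix S assume S: "S \<in> ?V"
      then have Sb: "S \<in> bounded_ops M N" by simp
      have "S \<notin> ops_supported M N \<kappa>"
      proof
        assume "S \<in> ops_supported M N \<kappa>"
        then have z: "AE y in N. indicator B y * rop M S ?f y = 0"
          using A B AB f by (auto simp: ops_supported_lift vanishes_on_def)
        have "(\<lambda>y. indicator B y * ?w y) = ?w" by (auto simp: indicator_def)
        then have "ip N (rop M S ?f) ?w = ip N (\<lambda>y. indicator B y * rop M S ?f y) ?w"
          using ip_cut_move[of N B "rop M S ?f" ?w] by simp
        also have "\<dots> = ip N (\<lambda>y. 0) ?w"
          by (rule ip_cong_AE) (use z w rop_sq[OF Sb f'] B in \<open>auto simp: sq_integrable_def\<close>)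
        finally show False using S val[OF Sb] by (simp add: ip_zero_left)
      qed
      then show "S \<in> bounded_ops M N - ops_supported M N \<kappa>" using Sb by simp
    qed
    ultimately show "\<exists>V. openin (wstar_topology M N) V \<and> T \<in> V \<and> V \<subseteq> bounded_ops M N - ops_supported M N \<kappa>"
      by (intro exI[of _ ?V] conjI)
  qed
qed

section \<open>Agreement sets\<close>

definition agreement :: "'a measure \<Rightarrow> 'b measure \<Rightarrow> (nat \<Rightarrow> 'a set) \<Rightarrow> (nat \<Rightarrow> 'b set) \<Rightarrow> ('a \<times> 'b) set" where
  "agreement M N \<alpha> \<beta> = {(x, y) \<in> space M \<times> space N. \<forall>n. x \<in> \<alpha> n \<longleftrightarrow> y \<in> \<beta> n}"

text \<open>
  From left to right, the rectangles \<open>\<alpha> n \<times> (Y - \<beta> n)\<close> and \<open>(X - \<alpha> n) \<times> \<beta> n\<close> miss the agreement set, and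
  vanishing on both is the intertwining relation. The other direction is
  \<open>vanishes_off_agreement\<close>.
\<close>

theorem ops_supported_agreement:
  fixes \<alpha> :: "nat \<Rightarrow> 'a set" and \<beta> :: "nat \<Rightarrow> 'b set"
  assumes sb: "standard_borel M" "sigma_finite_measure M" "standard_borel N" "sigma_finite_measure N"
    and \<alpha>: "\<And>n. \<alpha> n \<in> sets M" and \<beta>: "\<And>n. \<beta> n \<in> sets N"
  shows "T \<in> ops_supported M N (agreement M N \<alpha> \<beta>) \<longleftrightarrow>
    T \<in> bounded_ops M N \<and> (\<forall>n. intertwines M N (rop M T) (\<alpha> n) (\<beta> n))"
proof (cases "T \<in> bounded_ops M N")
  case True
  note opT = aeop_rop[OF True]
  show ?thesis
  proof
    assume T: "T \<in> ops_supported M N (agreement M N \<alpha> \<beta>)"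
    have "intertwines M N (rop M T) (\<alpha> n) (\<beta> n)" for n
      unfolding intertwines_def
    proof
      fix f assume f: "f \<in> SQ M"
      let ?R = "rop M T" and ?a = "\<lambda>x. indicator (\<alpha> n) x * f x" and ?b = "\<lambda>x. indicator (space M - \<alpha> n) x * f x"
      have S: "?a \<in> SQ M" "?b \<in> SQ M" using f \<alpha> by (auto intro: sq_cut)
      have "vanishes_on M N ?R (\<alpha> n) (space N - \<beta> n)"
        using T \<alpha> \<beta> unfolding ops_supported_lift agreement_def by blast
      moreover have "vanishes_on M N ?R (space M - \<alpha> n) (\<beta> n)"
        using T \<alpha> \<beta> unfolding ops_supported_lift agreement_def by blast
      ultimately have v: "AE y in N. indicator (space N - \<beta> n) y * ?R ?a y = 0" "AE y in N. indicator (\<beta> n) y * ?R ?b y = 0"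
        using f by (auto simp: vanishes_on_def)
      have "AE y in N. ?R f y = ?R (\<lambda>x. ?a x + ?b x) y"
        by (rule aeop_cong[OF opT f sq_add[OF S]]) (auto simp: indicator_def intro!: AE_I2)
      then show "AE y in N. ?R ?a y = indicator (\<beta> n) y * ?R f y"
        using aeop_add[OF opT S] v AE_space
      proof eventually_elim
        case (elim y)
        then show ?case by (cases "y \<in> \<beta> n") auto
      qed
    qed
    then show "T \<in> bounded_ops M N \<and> (\<forall>n. intertwines M N (rop M T) (\<alpha> n) (\<beta> n))" using True by simp
  next
    assume "T \<in> bounded_ops M N \<and> (\<forall>n. intertwines M N (rop M T) (\<alpha> n) (\<beta> n))"
    then have i: "\<And>n. intertwines M N (rop M T) (\<alpha> n) (\<beta> n)" by simp
    show "T \<in> ops_supported M N (agreement M N \<alpha> \<beta>)"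
      unfolding ops_supported_lift
    proof (intro conjI True ballI impI)
      fix A B assume A: "A \<in> sets M" and B: "B \<in> sets N" and d: "A \<times> B \<inter> agreement M N \<alpha> \<beta> = {}"
      show "vanishes_on M N (rop M T) A B"
      proof (rule vanishes_off_agreement[OF sb opT i \<alpha> \<beta> A B])
        fix x y assume xy: "x \<in> A" "y \<in> B"
        then have "x \<in> space M" "y \<in> space N" "(x, y) \<notin> agreement M N \<alpha> \<beta>"
          using A B d sets.sets_into_space by blast+
        then show "\<exists>n. (x \<in> \<alpha> n) \<noteq> (y \<in> \<beta> n)" by (auto simp: agreement_def)
      qed
    qed
  qed
qed (simp add: ops_supported_def)

text \<open>
  The relations \<open>C 1\<^bsub>\<alpha>\<^esub> = 1\<^bsub>\<beta>\<^esub> C\<close>, \<open>B\<^sup>* 1\<^bsub>\<beta>\<^esub> = 1\<^bsub>\<alpha>\<^esub> B\<^sup>*\<close> and \<open>A 1\<^bsub>\<alpha>\<^esub> = 1\<^bsub>\<beta>\<^esub> A\<close> compose.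
\<close>

theorem ops_supported_agreement_normalizing:
  fixes \<alpha> :: "nat \<Rightarrow> 'a set" and \<beta> :: "nat \<Rightarrow> 'b set"
  assumes sb: "standard_borel M" "sigma_finite_measure M" "standard_borel N" "sigma_finite_measure N"
    and \<alpha>: "\<And>n. \<alpha> n \<in> sets M" and \<beta>: "\<And>n. \<beta> n \<in> sets N"
  shows "normalizing M N (ops_supported M N (agreement M N \<alpha> \<beta>))"
  unfolding normalizing_def
proof (intro conjI ops_supported_subspace ballI)
  let ?U = "ops_supported M N (agreement M N \<alpha> \<beta>)"
  note iff = ops_supported_agreement[OF sb \<alpha> \<beta>]
  fix A B C assume U: "A \<in> ?U" "B \<in> ?U" "C \<in> ?U"
  have b: "A \<in> bounded_ops M N" "B \<in> bounded_ops M N" "C \<in> bounded_ops M N"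
    and i: "\<And>n. intertwines M N (rop M A) (\<alpha> n) (\<beta> n)" "\<And>n. intertwines M N (rop M B) (\<alpha> n) (\<beta> n)"
      "\<And>n. intertwines M N (rop M C) (\<alpha> n) (\<beta> n)"
    using U unfolding iff by auto
  note opA = aeop_rop[OF b(1)] and opB = aeop_rop[OF b(2)] and opC = aeop_rop[OF b(3)]
  obtain B' where B': "adjp M N (rop M B) B'" using adjoint_exists[OF sb(2) opB] by blast
  note opB' = adjp_aeop'[OF B']
  note BC = aeop_comp[OF opC opB'] and ABC = aeop_comp[OF aeop_comp[OF opC opB'] opA]
  let ?R = "\<lambda>f. rop M A (B' (rop M C f))"
  have "compose (L2 M) A (compose (L2 M) (op_adj M N B) C) =
      compose (L2 M) (lift M N (rop M A)) (compose (L2 M) (op_adj M N (lift M N (rop M B))) (lift M N (rop M C)))"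
    by (simp add: lift_rop b)
  also have "\<dots> = lift M N ?R"
    unfolding op_adj_lift[OF B'] compose_lift[OF opC opB'] compose_lift[OF BC opA] ..
  finally have eq: "compose (L2 M) A (compose (L2 M) (op_adj M N B) C) = lift M N ?R" .
  have "intertwines M N (rop M (lift M N ?R)) (\<alpha> n) (\<beta> n)" for n
  proof -
    have BCi: "intertwines M M (\<lambda>f. B' (rop M C f)) (\<alpha> n) (\<alpha> n)"
      by (rule intertwines_comp[OF opC opB' i(3) intertwines_adjoint[OF B' i(2) \<alpha> \<beta>] \<alpha> \<beta>])
    have R: "intertwines M N ?R (\<alpha> n) (\<beta> n)"
      by (rule intertwines_comp[OF BC opA BCi i(1) \<alpha> \<alpha>])
    show ?thesis
      unfolding intertwines_def
    proof
      fix f assume f: "f \<in> SQ M"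
      have "AE y in N. ?R (\<lambda>x. indicator (\<alpha> n) x * f x) y = indicator (\<beta> n) y * ?R f y"
        using R f by (simp add: intertwines_def)
      then show "AE y in N. rop M (lift M N ?R) (\<lambda>x. indicator (\<alpha> n) x * f x) y = indicator (\<beta> n) y * rop M (lift M N ?R) f y"
        using rop_lift[OF ABC sq_cut[OF f \<alpha>[of n]]] rop_lift[OF ABC f] by eventually_elim simp
    qed
  qed
  then show "compose (L2 M) A (compose (L2 M) (op_adj M N B) C) \<in> ?U"
    unfolding eq iff using lift_bounded[OF ABC] by simp
qed

lemma agreement_complement:
  assumes \<alpha>: "\<And>n. \<alpha> n \<in> sets M" and \<beta>: "\<And>n. \<beta> n \<in> sets N"
  shows "countable_rectangle_union M N (space M \<times> space N - agreement M N \<alpha> \<beta>)"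
proof -
  define a where "a n = (if even n then \<alpha> (n div 2) else space M - \<alpha> (n div 2))" for n
  define b where "b n = (if even n then space N - \<beta> (n div 2) else \<beta> (n div 2))" for n
  have as: "\<alpha> n \<subseteq> space M" and bs: "\<beta> n \<subseteq> space N" for n
    using sets.sets_into_space[OF \<alpha>] sets.sets_into_space[OF \<beta>] by auto
  have "space M \<times> space N - agreement M N \<alpha> \<beta> = (\<Union>n. a n \<times> b n)"
  proof (intro equalityI subsetI)
    fix z assume "z \<in> space M \<times> space N - agreement M N \<alpha> \<beta>"
    then obtain x y n where z: "z = (x, y)" "x \<in> space M" "y \<in> space N" "(x \<in> \<alpha> n) \<noteq> (y \<in> \<beta> n)"
      by (auto simp: agreement_def)
    show "z \<in> (\<Union>n. a n \<times> b n)"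
    proof (cases "x \<in> \<alpha> n")
      case True
      then have "z \<in> a (2 * n) \<times> b (2 * n)" using z by (auto simp: a_def b_def)
      then show ?thesis by blast
    next
      case False
      then have "z \<in> a (2 * n + 1) \<times> b (2 * n + 1)" using z by (auto simp: a_def b_def)
      then show ?thesis by blast
    qed
  next
    fix z assume "z \<in> (\<Union>n. a n \<times> b n)"
    then obtain n where "z \<in> a n \<times> b n" by blast
    then show "z \<in> space M \<times> space N - agreement M N \<alpha> \<beta>"
      using as[of "n div 2"] bs[of "n div 2"] by (auto simp: a_def b_def agreement_def split: if_splits)
  qed
  moreover have "range a \<subseteq> sets M" "range b \<subseteq> sets N" using \<alpha> \<beta> by (auto simp: a_def b_def)
  ultimately show ?thesis unfolding countable_rectangle_union_def by blast
qed

text \<open>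
  Two real numbers are equal iff the same rational numbers lie above them.
\<close>

lemma level_sets_agreement:
  fixes f :: "'a \<Rightarrow> real" and g :: "'b \<Rightarrow> real"
  assumes "f \<in> measurable M (restrict_space borel {0..1})" "g \<in> measurable N (restrict_space borel {0..1})"
  obtains \<alpha> :: "nat \<Rightarrow> 'a set" and \<beta> :: "nat \<Rightarrow> 'b set" where "\<And>n. \<alpha> n \<in> sets M" "\<And>n. \<beta> n \<in> sets N"
    "agreement M N \<alpha> \<beta> = {(x, y) \<in> space M \<times> space N. f x = g y}"
proof -
  have [measurable]: "f \<in> borel_measurable M" "g \<in> borel_measurable N"
    using assms by (simp_all add: measurable_restrict_space2_iff)
  obtain r :: "nat \<Rightarrow> real" where r: "range r = \<rat>" using range_from_nat_into[OF _ countable_rat] by (metis Rats_0 empty_iff)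
  define \<alpha> where "\<alpha> n = {x \<in> space M. f x < r n}" for n
  define \<beta> where "\<beta> n = {y \<in> space N. g y < r n}" for n
  have "agreement M N \<alpha> \<beta> = {(x, y) \<in> space M \<times> space N. f x = g y}"
  proof -
    have "(\<forall>n. f x < r n \<longleftrightarrow> g y < r n) \<longleftrightarrow> f x = g y" for x y
    proof
      assume eq: "\<forall>n. f x < r n \<longleftrightarrow> g y < r n"
      show "f x = g y"
      proof (rule ccontr)
        assume "f x \<noteq> g y"
        then consider "f x < g y" | "g y < f x" by linarith
        then show False
        proof cases
          case 1
          then obtain q where "q \<in> \<rat>" "f x < q" "q < g y" using Rats_dense_in_real by blast
          moreover from this obtain n where "q = r n" using r by (metis imageE)
          ultimately show False using eq by (metis less_asym)
        next
          case 2
          then obtain q where "q \<in> \<rat>" "g y < q" "q < f x" using Rats_dense_in_real by blast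
          moreover from this obtain n where "q = r n" using r by (metis imageE)
          ultimately show False using eq by (metis less_asym)
        qed
      qed
    qed simp
    then show ?thesis by (auto simp: agreement_def \<alpha>_def \<beta>_def)
  qed
  moreover have "\<alpha> n \<in> sets M" "\<beta> n \<in> sets N" for n unfolding \<alpha>_def \<beta>_def by measurable
  ultimately show ?thesis using that by blast
qed

section \<open>Coding sequences of sets by the Cantor set\<close>

text \<open>
  The point of the Cantor middle-third set with the ternary digits 2 where \<open>b\<close> holds.
\<close>

definition cantor :: "(nat \<Rightarrow> bool) \<Rightarrow> real" where
  "cantor b = (\<Sum>n. if b n then 2 / 3 * (1/3) ^ n else 0)"

lemma cantor_term_sums: "(\<lambda>n. 2 / 3 * (1/3::real) ^ n) sums 1"
  using sums_mult[OF geometric_sums[of "1/3::real"], of "2/3"] by simp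

lemma cantor_summable: "summable (\<lambda>n. if b n then 2 / 3 * (1/3::real) ^ n else 0)"
  by (rule summable_comparison_test[OF _ sums_summable[OF cantor_term_sums]]) auto

lemma cantor_bounds: "0 \<le> cantor b" "cantor b \<le> 1"
proof -
  show "0 \<le> cantor b" unfolding cantor_def by (rule suminf_nonneg[OF cantor_summable]) auto
  have "cantor b \<le> (\<Sum>n. 2 / 3 * (1/3) ^ n)"
    unfolding cantor_def by (rule suminf_le[OF _ cantor_summable sums_summable[OF cantor_term_sums]]) auto
  then show "cantor b \<le> 1" using sums_unique[OF cantor_term_sums] by simp
qed

lemma cantor_Suc: "cantor b = (if b 0 then 2 / 3 else 0) + 1 / 3 * cantor (\<lambda>n. b (Suc n))"
proof -
  have "cantor b = (\<Sum>n. if b (Suc n) then 2 / 3 * (1/3) ^ Suc n else 0) + (if b 0 then 2 / 3 else 0)"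
    unfolding cantor_def using suminf_split_head[OF cantor_summable[of b]] by simp
  also have "(\<Sum>n. if b (Suc n) then 2 / 3 * (1/3) ^ Suc n else 0) = (\<Sum>n. 1 / 3 * (if b (Suc n) then 2 / 3 * (1/3::real) ^ n else 0))"
    by (rule suminf_cong) simp
  also have "\<dots> = 1 / 3 * cantor (\<lambda>n. b (Suc n))"
    unfolding cantor_def by (rule suminf_mult[OF cantor_summable])
  finally show ?thesis by simp
qed

text \<open>
  The first digit is determined since the remaining digits contribute at most \<open>1/3\<close>; induction on the
  position does the rest.
\<close>

lemma cantor_inj: "cantor b = cantor c \<longleftrightarrow> (\<forall>n. b n = c n)"
proof
  assume "cantor b = cantor c"
  moreover have "cantor b = cantor c \<Longrightarrow> b n = c n" for n
  proof (induction n arbitrary: b c)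
    case 0
    then show ?case
      using cantor_bounds[of "\<lambda>n. b (Suc n)"] cantor_bounds[of "\<lambda>n. c (Suc n)"]
      by (auto simp: cantor_Suc[of b] cantor_Suc[of c] split: if_splits)
  next
    case (Suc n)
    have "b 0 = c 0"
      using Suc.prems cantor_bounds[of "\<lambda>n. b (Suc n)"] cantor_bounds[of "\<lambda>n. c (Suc n)"]
      by (auto simp: cantor_Suc[of b] cantor_Suc[of c] split: if_splits)
    then have "cantor (\<lambda>n. b (Suc n)) = cantor (\<lambda>n. c (Suc n))"
      using Suc.prems by (simp add: cantor_Suc[of b] cantor_Suc[of c])
    then show ?case by (rule Suc.IH)
  qed
  ultimately show "\<forall>n. b n = c n" by blast
next
  assume "\<forall>n. b n = c n"
  then have "b = c" by blast
  then show "cantor b = cantor c" by simp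
qed

lemma cantor_measurable:
  assumes [measurable]: "\<And>n. \<alpha> n \<in> sets M"
  shows "(\<lambda>x. cantor (\<lambda>n. x \<in> \<alpha> n)) \<in> measurable M (restrict_space borel {0..1})"
proof -
  have "(\<lambda>x. cantor (\<lambda>n. x \<in> \<alpha> n)) \<in> borel_measurable M" unfolding cantor_def by measurable
  then show ?thesis using cantor_bounds by (auto simp: measurable_restrict_space2_iff)
qed

lemma agreement_cantor:
  "agreement M N \<alpha> \<beta> = {(x, y) \<in> space M \<times> space N. cantor (\<lambda>n. x \<in> \<alpha> n) = cantor (\<lambda>n. y \<in> \<beta> n)}"
  by (simp add: agreement_def cantor_inj)

section \<open>Normalizing bimodules\<close>

lemma masa_tro_of_normalizing:
  assumes sfM: "sigma_finite_measure M" and sfN: "sigma_finite_measure N"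
    and norm: "normalizing M N U" and bim: "masa_bimodule M N U"
  shows "masa_tro M N {R. aeop M N R \<and> lift M N R \<in> U}"
proof (rule masa_tro.intro)
  have sub: "linear_subspace M N U" using norm by (simp add: normalizing_def)
  show "sigma_finite_measure M" "sigma_finite_measure N" by fact+
  show "aeop M N R" if "R \<in> {R. aeop M N R \<and> lift M N R \<in> U}" for R using that by simp
  show "R' \<in> {R. aeop M N R \<and> lift M N R \<in> U}"
    if "R \<in> {R. aeop M N R \<and> lift M N R \<in> U}" "aeop M N R'" "\<And>f. f \<in> SQ M \<Longrightarrow> AE y in N. R' f y = R f y" for R R'
  proof -
    have "lift M N R' = lift M N R" using that lift_eq_iff by blast
    then show ?thesis using that by simp
  qed
  show "(\<lambda>f y. 0) \<in> {R. aeop M N R \<and> lift M N R \<in> U}"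
    using sub by (simp add: aeop_const_zero linear_subspace_def op_zero_lift[symmetric])
  show "(\<lambda>f y. R f y + S f y) \<in> {R. aeop M N R \<and> lift M N R \<in> U}"
    if "R \<in> {R. aeop M N R \<and> lift M N R \<in> U}" "S \<in> {R. aeop M N R \<and> lift M N R \<in> U}" for R S
    using that sub by (auto simp: aeop_plus linear_subspace_def op_add_lift[symmetric])
  show "(\<lambda>f y. c * R f y) \<in> {R. aeop M N R \<and> lift M N R \<in> U}"
    if "R \<in> {R. aeop M N R \<and> lift M N R \<in> U}" for R c
    using that sub by (auto simp: aeop_smult linear_subspace_def op_scale_lift[symmetric])
  have bm: "aeop M N (\<lambda>f y. \<psi> y * R (\<lambda>x. \<phi> x * f x) y) \<and> lift M N (\<lambda>f y. \<psi> y * R (\<lambda>x. \<phi> x * f x) y) \<in> U"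
    if R: "aeop M N R" "lift M N R \<in> U" and \<psi>: "bmult N \<psi>" and \<phi>: "bmult M \<phi>" for R \<phi> \<psi>
  proof -
    note p = aeop_bmult[OF \<phi>] and q = aeop_bmult[OF \<psi>]
    have "\<psi> \<in> ess_bounded N" "\<phi> \<in> ess_bounded M"
      using \<psi> \<phi> unfolding ess_bounded_def bmult_def by (auto intro: AE_I2)
    then have "mult_op N \<psi> \<in> mult_algebra N" "mult_op M \<phi> \<in> mult_algebra M"
      unfolding mult_algebra_def by (auto intro: imageI)
    then have "compose (L2 M) (mult_op N \<psi>) (compose (L2 M) (lift M N R) (mult_op M \<phi>)) \<in> U"
      using bim R by (simp add: masa_bimodule_def)
    then show ?thesis
      unfolding mult_op_lift compose_lift[OF p R(1)] compose_lift[OF aeop_comp[OF p R(1)] q]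
      using aeop_comp[OF aeop_comp[OF p R(1)] q] by simp
  qed
  show "(\<lambda>f y. \<psi> y * R f y) \<in> {R. aeop M N R \<and> lift M N R \<in> U}"
    if "R \<in> {R. aeop M N R \<and> lift M N R \<in> U}" "bmult N \<psi>" for R \<psi>
    using bm[of R \<psi> "\<lambda>x. 1"] that by simp
  show "(\<lambda>f. R (\<lambda>x. \<phi> x * f x)) \<in> {R. aeop M N R \<and> lift M N R \<in> U}"
    if "R \<in> {R. aeop M N R \<and> lift M N R \<in> U}" "bmult M \<phi>" for R \<phi>
    using bm[of R "\<lambda>x. 1" \<phi>] that by simp
  show "(\<lambda>f. A (B' (C f))) \<in> {R. aeop M N R \<and> lift M N R \<in> U}"
    if A: "A \<in> {R. aeop M N R \<and> lift M N R \<in> U}" and B: "B \<in> {R. aeop M N R \<and> lift M N R \<in> U}"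
      and B': "adjp M N B B'" and C: "C \<in> {R. aeop M N R \<and> lift M N R \<in> U}" for A B B' C
  proof -
    have ops: "aeop M N A" "aeop M N C" and U: "lift M N A \<in> U" "lift M N B \<in> U" "lift M N C \<in> U" using A B C by auto
    note b = adjp_aeop'[OF B']
    have "compose (L2 M) (lift M N A) (compose (L2 M) (op_adj M N (lift M N B)) (lift M N C)) \<in> U"
      using norm U by (simp add: normalizing_def)
    then show ?thesis
      unfolding op_adj_lift[OF B'] compose_lift[OF ops(2) b] compose_lift[OF aeop_comp[OF ops(2) b] ops(1)]
      using aeop_comp[OF aeop_comp[OF ops(2) b] ops(1)] by simp
  qed
qed

text \<open>
  The sequences consist of the pair formed by the whole space and the support of the range of \<open>U\<close>,
  followed by a dense sequence of projections in the commutant of \<open>\<A>\<close> with their partners. An operator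
  that is supported by the agreement set but lies outside of \<open>U\<close> would have a weak-star neighbourhood
  disjoint from \<open>U\<close>, against \<open>strongly_dense\<close>.
\<close>

theorem normalizing_bimodule_is_agreement:
  fixes M :: "'a measure" and N :: "'b measure"
  assumes sb: "standard_borel M" "sigma_finite_measure M" "standard_borel N" "sigma_finite_measure N"
    and cl: "closedin (wstar_topology M N) U" and norm: "normalizing M N U" and bim: "masa_bimodule M N U"
  shows "\<exists>(\<alpha> :: nat \<Rightarrow> 'a set) (\<beta> :: nat \<Rightarrow> 'b set). (\<forall>n. \<alpha> n \<in> sets M) \<and> (\<forall>n. \<beta> n \<in> sets N) \<and>
    U = ops_supported M N (agreement M N \<alpha> \<beta>)"
proof -
  note sfM = sb(2) and sfN = sb(4)
  let ?\<U> = "{R. aeop M N R \<and> lift M N R \<in> U}"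
  interpret masa_tro M N ?\<U> by (rule masa_tro_of_normalizing[OF sfM sfN norm bim])
  have Ub: "U \<subseteq> bounded_ops M N" using norm by (simp add: normalizing_def linear_subspace_def)
  have rop_U: "rop M T \<in> ?\<U>" if "T \<in> U" for T using that Ub by (auto simp: aeop_rop lift_rop)
  obtain B :: "nat \<Rightarrow> 'a set" where gen: "sets M = sigma_sets (space M) (range B)"
    using standard_borel_generated[OF sb(1)] .
  obtain h where w: "weight M h" using ex_weight_locale[OF sfM] .
  interpret w: weight M h by (rule w)
  interpret D: finite_measure "weighted M h" by (rule w.finite_weighted)
  have spaceM: "space M \<in> comm_sets"
    unfolding comm_sets_def
  proof (intro CollectI conjI ballI)
    fix A assume "A \<in> \<A>"
    note A = A_op[OF this]
    show "commutes_mult M A (indicator (space M))"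
      unfolding commutes_mult_def
    proof
      fix f assume f: "f \<in> SQ M"
      have "AE x in M. A (\<lambda>x. indicator (space M) x * f x) x = A f x"
        by (rule aeop_cong[OF A sq_cut[OF f] f]) (auto intro!: AE_I2)
      then show "AE x in M. A (\<lambda>x. indicator (space M) x * f x) x = indicator (space M) x * A f x"
        using AE_space by eventually_elim simp
    qed
  qed simp
  have gen': "sets (weighted M h) = sigma_sets (space (weighted M h)) (range B)"
    unfolding w.sets_weighted w.space_weighted by (rule gen)
  have sub: "comm_sets \<subseteq> sets (weighted M h)" by (auto simp: comm_sets_def)
  have ne: "comm_sets \<noteq> {}" using spaceM by blast
  obtain \<alpha>' :: "nat \<Rightarrow> 'a set" where \<alpha>': "range \<alpha>' \<subseteq> comm_sets"
    and dense_all: "\<forall>A\<in>comm_sets. \<forall>e>0. \<exists>n. measure (weighted M h) (sym_diff A (\<alpha>' n)) < e"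
    using D.countable_dense_subfamily[OF gen' sub ne] by (elim exE conjE)
  have dense: "\<exists>n. measure (weighted M h) (sym_diff A (\<alpha>' n)) < e" if "A \<in> comm_sets" "0 < e" for A e
    using dense_all that by simp
  have "\<forall>n. \<exists>b. b \<in> sets N \<and> (\<forall>S\<in>?\<U>. intertwines M N S (\<alpha>' n) b)"
  proof
    fix n
    have "\<alpha>' n \<in> comm_sets" using \<alpha>' by blast
    from partner[OF this] show "\<exists>b. b \<in> sets N \<and> (\<forall>S\<in>?\<U>. intertwines M N S (\<alpha>' n) b)" unfolding Bex_def .
  qed
  from choice[OF this] obtain \<beta>' where \<beta>_all: "\<forall>n. \<beta>' n \<in> sets N \<and> (\<forall>S\<in>?\<U>. intertwines M N S (\<alpha>' n) (\<beta>' n))"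
    by (rule exE)
  have \<beta>': "\<beta>' n \<in> sets N" for n using \<beta>_all by simp
  have \<beta>'_int: "intertwines M N S (\<alpha>' n) (\<beta>' n)" if "S \<in> ?\<U>" for S n using \<beta>_all that by blast
  obtain b where b: "b \<in> sets N" and bU: "\<forall>S\<in>?\<U>. intertwines M N S (space M) b"
    and bmin_all: "\<forall>u. (\<forall>S\<in>?\<U>. \<forall>f\<in>SQ M. AE y in N. S f y = 0 \<or> u y = (0::complex)) \<longrightarrow> (AE y in N. y \<in> b \<longrightarrow> u y = 0)"
    using range_support by (elim bexE conjE)
  have bmin: "AE y in N. y \<in> b \<longrightarrow> u y = 0"
    if "\<forall>S\<in>?\<U>. \<forall>f\<in>SQ M. AE y in N. S f y = 0 \<or> u y = 0" for u :: "'b \<Rightarrow> complex"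
    using bmin_all that by (elim allE impE)
  \<comment> \<open>The pair with index 0 carries the minimal partner of the whole space.\<close>
  define \<alpha> where "\<alpha> = case_nat (space M) \<alpha>'"
  define \<beta> where "\<beta> = case_nat b \<beta>'"
  have \<alpha>c: "\<alpha> n \<in> comm_sets" for n using \<alpha>' spaceM by (cases n) (auto simp: \<alpha>_def)
  have \<alpha>s: "\<alpha> n \<in> sets M" for n using \<alpha>c[of n] by (simp add: comm_sets_def)
  have \<beta>s: "\<beta> n \<in> sets N" for n using \<beta>' b by (cases n) (simp_all add: \<beta>_def)
  have int: "intertwines M N S (\<alpha> n) (\<beta> n)" if "S \<in> ?\<U>" for S n
    using bspec[OF bU that] \<beta>'_int[OF that] by (cases n) (simp_all add: \<alpha>_def \<beta>_def)
  have dense': "\<exists>n. measure (weighted M h) (sym_diff A (\<alpha> n)) < e" if A: "A \<in> comm_sets" "0 < e" for A e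
  proof -
    obtain n where "measure (weighted M h) (sym_diff A (\<alpha>' n)) < e" using dense[OF A] by blast
    then show ?thesis by (intro exI[of _ "Suc n"]) (simp add: \<alpha>_def)
  qed
  note iff = ops_supported_agreement[OF sb \<alpha>s \<beta>s]
  have "U = ops_supported M N (agreement M N \<alpha> \<beta>)"
  proof (intro equalityI subsetI)
    fix T assume "T \<in> U"
    then show "T \<in> ops_supported M N (agreement M N \<alpha> \<beta>)"
      unfolding iff using Ub int[OF rop_U] by blast
  next
    fix T assume "T \<in> ops_supported M N (agreement M N \<alpha> \<beta>)"
    then have T: "T \<in> bounded_ops M N" and Ti: "\<And>n. intertwines M N (rop M T) (\<alpha> n) (\<beta> n)" unfolding iff by auto
    show "T \<in> U"
    proof (rule ccontr)
      assume "T \<notin> U"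
      moreover have "openin (wstar_topology M N) (bounded_ops M N - U)"
        using cl unfolding closedin_def wstar_topspace by simp
      ultimately obtain \<xi> \<delta> where \<xi>: "\<xi> \<in> SQ (seq_meas M)" and \<delta>: "0 < \<delta>"
        and far: "\<And>S. S \<in> bounded_ops M N \<Longrightarrow>
          nrm (seq_meas N) (\<lambda>z. amp (rop M T) \<xi> z - amp (rop M S) \<xi> z) < \<delta> \<Longrightarrow> S \<in> bounded_ops M N - U"
        using wstar_open_strong_nbhd[OF sfM sfN, of "bounded_ops M N - U" T] T by blast
      have "intertwines M N (rop M T) (space M) b" using Ti[of 0] by (simp add: \<alpha>_def \<beta>_def)
      then obtain R where R: "R \<in> ?\<U>" and near: "nrm (seq_meas N) (\<lambda>z. amp (rop M T) \<xi> z - amp R \<xi> z) < \<delta>"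
        using strongly_dense[OF w \<alpha>c \<beta>s int dense' aeop_rop[OF T] Ti b _ bmin \<xi> \<delta>] by blast
      have Ra: "aeop M N R" and RU: "lift M N R \<in> U" using R by auto
      let ?S = "lift M N R"
      have S: "?S \<in> bounded_ops M N" by (rule lift_bounded[OF Ra])
      have X: "amp R \<xi> \<in> SQ (seq_meas N)" "amp (rop M ?S) \<xi> \<in> SQ (seq_meas N)" "amp (rop M T) \<xi> \<in> SQ (seq_meas N)"
        using aeop_sq[OF aeop_amp[OF sfM sfN Ra] \<xi>] aeop_sq[OF aeop_amp[OF sfM sfN aeop_rop[OF S]] \<xi>]
          aeop_sq[OF aeop_amp[OF sfM sfN aeop_rop[OF T]] \<xi>] by auto
      have "AE z in seq_meas N. amp (rop M ?S) \<xi> z = amp R \<xi> z"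
        unfolding AE_seq_eq_iff[OF sfN X(2,1)] using rop_lift[OF Ra sq_slice[OF sfM \<xi>]] by simp
      then have "AE z in seq_meas N. amp (rop M T) \<xi> z - amp (rop M ?S) \<xi> z = amp (rop M T) \<xi> z - amp R \<xi> z"
        by eventually_elim simp
      then have "nrm (seq_meas N) (\<lambda>z. amp (rop M T) \<xi> z - amp (rop M ?S) \<xi> z) = nrm (seq_meas N) (\<lambda>z. amp (rop M T) \<xi> z - amp R \<xi> z)"
        by (intro nrm_cong_AE sq_measurable sq_diff X)
      then have "?S \<in> bounded_ops M N - U" using near by (intro far[OF S]) simp
      then show False using RU by simp
    qed
  qed
  then show ?thesis using \<alpha>s \<beta>s by blast
qed

theorem theorem3p2:
  fixes M :: "'a measure" and N :: "'b measure"
  assumes "standard_borel M" and "sigma_finite_measure M"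
    and "standard_borel N" and "sigma_finite_measure N"
  shows
    "(\<forall>U. closedin (wstar_topology M N) U \<and> normalizing M N U \<and> masa_bimodule M N U \<longrightarrow>
        (\<exists>f \<in> measurable M (restrict_space borel {0..1::real}).
         \<exists>g \<in> measurable N (restrict_space borel {0..1::real}).
           is_omega_support M N U {(x, y) \<in> space M \<times> space N. f x = g y})) \<and>
     (\<forall>f \<in> measurable M (restrict_space borel {0..1::real}).
      \<forall>g \<in> measurable N (restrict_space borel {0..1::real}).
        closedin (wstar_topology M N) (ops_supported M N {(x, y) \<in> space M \<times> space N. f x = g y}) \<and>
        normalizing M N (ops_supported M N {(x, y) \<in> space M \<times> space N. f x = g y}) \<and>
        masa_bimodule M N (ops_supported M N {(x, y) \<in> space M \<times> space N. f x = g y}))"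
proof (intro conjI allI impI ballI)
  fix U assume "closedin (wstar_topology M N) U \<and> normalizing M N U \<and> masa_bimodule M N U"
  then obtain \<alpha> :: "nat \<Rightarrow> 'a set" and \<beta> :: "nat \<Rightarrow> 'b set" where \<alpha>: "\<And>n. \<alpha> n \<in> sets M" and \<beta>: "\<And>n. \<beta> n \<in> sets N"
    and U: "U = ops_supported M N (agreement M N \<alpha> \<beta>)"
    using normalizing_bimodule_is_agreement[OF assms, of U] by blast
  \<comment> \<open>The complement of an agreement set is itself a countable union of rectangles; no null sets enter.\<close>
  have "marginally_equiv M N \<rho> \<rho>" for \<rho> by (auto simp: marginally_equiv_def)
  then have "is_omega_support M N U (agreement M N \<alpha> \<beta>)"
    unfolding is_omega_support_def
    using ops_supported_bimodule[of M N "agreement M N \<alpha> \<beta>"] ops_supported_reflexive[of M N "agreement M N \<alpha> \<beta>"]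
      agreement_complement[of \<alpha> M \<beta> N, OF \<alpha> \<beta>] U
    by (intro conjI) (auto simp: agreement_def)
  then have supp: "is_omega_support M N U
      {(x, y) \<in> space M \<times> space N. cantor (\<lambda>n. x \<in> \<alpha> n) = cantor (\<lambda>n. y \<in> \<beta> n)}"
    unfolding agreement_cantor .
  have mf: "(\<lambda>x. cantor (\<lambda>n. x \<in> \<alpha> n)) \<in> measurable M (restrict_space borel {0..1})"
    and mg: "(\<lambda>y. cantor (\<lambda>n. y \<in> \<beta> n)) \<in> measurable N (restrict_space borel {0..1})"
    using cantor_measurable[of \<alpha> M, OF \<alpha>] cantor_measurable[of \<beta> N, OF \<beta>] by simp_all
  show "\<exists>f \<in> measurable M (restrict_space borel {0..1::real}).
         \<exists>g \<in> measurable N (restrict_space borel {0..1::real}).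
           is_omega_support M N U {(x, y) \<in> space M \<times> space N. f x = g y}"
    by (rule bexI[OF _ mf], rule bexI[OF _ mg], rule supp)
next
  fix f g assume fg: "f \<in> measurable M (restrict_space borel {0..1::real})" "g \<in> measurable N (restrict_space borel {0..1::real})"
  let ?\<kappa> = "{(x, y) \<in> space M \<times> space N. f x = g y}"
  obtain \<alpha> :: "nat \<Rightarrow> 'a set" and \<beta> :: "nat \<Rightarrow> 'b set" where \<alpha>: "\<And>n. \<alpha> n \<in> sets M" and \<beta>: "\<And>n. \<beta> n \<in> sets N"
    and eq: "agreement M N \<alpha> \<beta> = ?\<kappa>"
    using level_sets_agreement[OF fg] by blast
  show "closedin (wstar_topology M N) (ops_supported M N ?\<kappa>)"
    by (rule ops_supported_wstar_closed[OF assms(2,4)])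
  show "normalizing M N (ops_supported M N ?\<kappa>)"
    using ops_supported_agreement_normalizing[where \<alpha> = \<alpha> and \<beta> = \<beta>, OF assms \<alpha> \<beta>] unfolding eq .
  show "masa_bimodule M N (ops_supported M N ?\<kappa>)" by (rule ops_supported_bimodule)
qed

end
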